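(* Let $M^3$ be an indefinite proper affine hypersphere of $\mathbb{R}^4$ (with $S=H\,\mathrm{Id}$, $H\neq0$ constant) which admits a pointwise $\mathbb{Z}_3$- or $\mathrm{SO}(2)$-symmetry, and suppose $H=\alpha_{22}^2-a_4^2$ on $M^3$ (functions as in the context). Then $M^3$ is affine equivalent with $$\varphi:I\times N^2\to\mathbb{R}^4,\quad (t,v,w)\mapsto(\gamma_1(t)v,\ \gamma_1(t)w,\ \gamma_1(t)f(v,w)+\gamma_2(t),\ \gamma_1(t)),$$ where $\psi:N^2\to\mathbb{R}^3$, $(v,w)\mapsto(v,w,f(v,w))$, is a positive definite improper affine sphere with affine normal $(0,0,1)$ and $\gamma=(\gamma_1,\gamma_2):I\to\mathbb{R}^2$ is a curve. Moreover, if $M^3$ admits a pointwise $\mathrm{SO}(2)$-symmetry, then $N^2$ is an elliptic paraboloid.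
   Context: Setting: $\varphi:M^3\to\mathbb{R}^4$ nondegenerate hypersurface with Blaschke normal $\xi$, $D_X\varphi_*Y=\varphi_*(\nabla_XY)+h(X,Y)\xi$, $D_X\xi=-\varphi_*(SX)$; $h$ affine metric (Lorentzian), $K=\nabla-\hat\nabla$ the difference tensor, $\hat\nabla$ the Levi-Civita connection of $h$. Affine hypersphere: $S=H\,\mathrm{Id}$, $H$ constant; proper if $H\neq0$. Pointwise $G$-symmetry: for every $p$ the group of $h_p$-isometries $L$ of $T_pM$ with $\det L=1$ and $K_p(LX,LY)=LK_p(X,Y)$ is isomorphic to $G$. Under $\mathbb{Z}_3$- or $\mathrm{SO}(2)$-symmetry, locally there is an $h$-orthonormal frame $\{T,V,W\}$ ($h(T,T)=-1$, $h(V,V)=h(W,W)=1$) and functions $a_4>0$, $a_6\ge0$ ($a_6>0$ for $\mathbb{Z}_3$, $a_6=0$ for $\mathrm{SO}(2)$) with $K(T,T)=-2a_4T$, $K(T,V)=a_4V$, $K(T,W)=a_4W$, $K(V,V)=-a_4T+a_6V$, $K(V,W)=-a_6W$, $K(W,W)=-a_4T-a_6V$; $\alpha_{22}:=h(\hat\nabla_VT,V)$. *)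

theory Defs
  imports "HOL-Analysis.Analysis" "HOL-Algebra.Elementary_Groups"
begin

definition pd :: "(real^'n \<Rightarrow> 'b::real_normed_vector) \<Rightarrow> 'n \<Rightarrow> real^'n \<Rightarrow> 'b" where
  "pd f i = (\<lambda>x. frechet_derivative f (at x) (axis i 1))"

fun dpart :: "'n list \<Rightarrow> (real^'n \<Rightarrow> 'b::real_normed_vector) \<Rightarrow> real^'n \<Rightarrow> 'b" where
  "dpart [] f = f"
| "dpart (i # is) f = pd (dpart is f) i"

definition smooth_on :: "(real^'n) set \<Rightarrow> (real^'n \<Rightarrow> 'b::real_normed_vector) \<Rightarrow> bool" where
  "smooth_on U f \<longleftrightarrow> (\<forall>is. dpart is f differentiable_on U)"

definition cderiv :: "(real \<Rightarrow> 'b::real_normed_vector) \<Rightarrow> real \<Rightarrow> 'b" where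
  "cderiv g = (\<lambda>t. vector_derivative g (at t))"

definition smooth_curve_on :: "real set \<Rightarrow> (real \<Rightarrow> 'b::real_normed_vector) \<Rightarrow> bool" where
  "smooth_curve_on I g \<longleftrightarrow> (\<forall>k. (cderiv ^^ k) g differentiable_on I)"

text \<open>Matrix with columns phi_1, phi_2, phi_3, xi (column index 4 = 0 in type 4).\<close>
definition frame_mat3 :: "(real^3 \<Rightarrow> real^4) \<Rightarrow> (real^3 \<Rightarrow> real^4) \<Rightarrow> real^3 \<Rightarrow> real^4^4" where
  "frame_mat3 \<phi> \<xi> x = (\<chi> r c. if c = 1 then pd \<phi> 1 x $ r else if c = 2 then pd \<phi> 2 x $ r
                          else if c = 3 then pd \<phi> 3 x $ r else \<xi> x $ r)"

text \<open>xi is the (equi)affine Blaschke normal of the immersion phi on U, with induced affine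
  metric h (matrix of h in the coordinate frame) and induced connection coefficients Gamma:
  D_{d_i} phi_*(d_j) = phi_*(sum_k Gamma x i j $ k d_k) + h_ij xi.\<close>
definition blaschke3 :: "(real^3) set \<Rightarrow> (real^3 \<Rightarrow> real^4) \<Rightarrow> (real^3 \<Rightarrow> real^4)
    \<Rightarrow> (real^3 \<Rightarrow> real^3^3) \<Rightarrow> (real^3 \<Rightarrow> 3 \<Rightarrow> 3 \<Rightarrow> real^3) \<Rightarrow> bool" where
  "blaschke3 U \<phi> \<xi> h \<Gamma> \<longleftrightarrow>
     open U \<and> smooth_on U \<phi> \<and> smooth_on U \<xi> \<and>
     (\<forall>x\<in>U. det (frame_mat3 \<phi> \<xi> x) \<noteq> 0) \<and>
     (\<forall>x\<in>U. \<forall>i j. pd (pd \<phi> j) i x = (\<Sum>k\<in>UNIV. (\<Gamma> x i j $ k) *\<^sub>R pd \<phi> k x) + (h x $ i $ j) *\<^sub>R \<xi> x) \<and>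
     (\<forall>x\<in>U. det (h x) \<noteq> 0) \<and>
     (\<forall>x\<in>U. \<forall>i. pd \<xi> i x \<in> span (range (\<lambda>k. pd \<phi> k x))) \<and>
     (\<forall>x\<in>U. (det (frame_mat3 \<phi> \<xi> x))\<^sup>2 = \<bar>det (h x)\<bar>)"

definition frame_mat2 :: "(real^2 \<Rightarrow> real^3) \<Rightarrow> (real^2 \<Rightarrow> real^3) \<Rightarrow> real^2 \<Rightarrow> real^3^3" where
  "frame_mat2 \<psi> \<xi> y = (\<chi> r c. if c = 1 then pd \<psi> 1 y $ r else if c = 2 then pd \<psi> 2 y $ r
                          else \<xi> y $ r)"

definition blaschke2 :: "(real^2) set \<Rightarrow> (real^2 \<Rightarrow> real^3) \<Rightarrow> (real^2 \<Rightarrow> real^3)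
    \<Rightarrow> (real^2 \<Rightarrow> real^2^2) \<Rightarrow> (real^2 \<Rightarrow> 2 \<Rightarrow> 2 \<Rightarrow> real^2) \<Rightarrow> bool" where
  "blaschke2 N \<psi> \<xi> h \<Gamma> \<longleftrightarrow>
     open N \<and> smooth_on N \<psi> \<and> smooth_on N \<xi> \<and>
     (\<forall>y\<in>N. det (frame_mat2 \<psi> \<xi> y) \<noteq> 0) \<and>
     (\<forall>y\<in>N. \<forall>i j. pd (pd \<psi> j) i y = (\<Sum>k\<in>UNIV. (\<Gamma> y i j $ k) *\<^sub>R pd \<psi> k y) + (h y $ i $ j) *\<^sub>R \<xi> y) \<and>
     (\<forall>y\<in>N. det (h y) \<noteq> 0) \<and>
     (\<forall>y\<in>N. \<forall>i. pd \<xi> i y \<in> span (range (\<lambda>k. pd \<psi> k y))) \<and>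
     (\<forall>y\<in>N. (det (frame_mat2 \<psi> \<xi> y))\<^sup>2 = \<bar>det (h y)\<bar>)"

definition pos_def_improper_affine_sphere ::
    "(real^2) set \<Rightarrow> (real^2 \<Rightarrow> real^3) \<Rightarrow> (real^2 \<Rightarrow> real^3) \<Rightarrow> bool" where
  "pos_def_improper_affine_sphere N \<psi> \<xi> \<longleftrightarrow>
     (\<exists>h \<Gamma>. blaschke2 N \<psi> \<xi> h \<Gamma> \<and>
        (\<forall>y\<in>N. \<forall>u. u \<noteq> 0 \<longrightarrow> u \<bullet> (h y *v u) > 0) \<and>
        (\<forall>y\<in>N. \<forall>i. pd \<xi> i y = 0))"

definition hmet :: "(real^3 \<Rightarrow> real^3^3) \<Rightarrow> real^3 \<Rightarrow> real^3 \<Rightarrow> real^3 \<Rightarrow> real" where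
  "hmet h x u v = u \<bullet> (h x *v v)"

definition lc_christoffel :: "(real^3 \<Rightarrow> real^3^3) \<Rightarrow> real^3 \<Rightarrow> 3 \<Rightarrow> 3 \<Rightarrow> real^3" where
  "lc_christoffel h x i j = (\<chi> k. (1/2) * (\<Sum>l\<in>UNIV. matrix_inv (h x) $ k $ l *
       (pd (\<lambda>y. h y $ j $ l) i x + pd (\<lambda>y. h y $ i $ l) j x - pd (\<lambda>y. h y $ i $ j) l x)))"

definition Kcomp :: "(real^3 \<Rightarrow> real^3^3) \<Rightarrow> (real^3 \<Rightarrow> 3 \<Rightarrow> 3 \<Rightarrow> real^3) \<Rightarrow> real^3 \<Rightarrow> 3 \<Rightarrow> 3 \<Rightarrow> real^3" where
  "Kcomp h \<Gamma> x i j = \<Gamma> x i j - lc_christoffel h x i j"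

definition Kbil :: "(real^3 \<Rightarrow> real^3^3) \<Rightarrow> (real^3 \<Rightarrow> 3 \<Rightarrow> 3 \<Rightarrow> real^3) \<Rightarrow> real^3 \<Rightarrow> real^3 \<Rightarrow> real^3 \<Rightarrow> real^3" where
  "Kbil h \<Gamma> x u v = (\<Sum>i\<in>UNIV. \<Sum>j\<in>UNIV. (u $ i * v $ j) *\<^sub>R Kcomp h \<Gamma> x i j)"

definition lc_cov :: "(real^3 \<Rightarrow> real^3^3) \<Rightarrow> (real^3 \<Rightarrow> real^3) \<Rightarrow> (real^3 \<Rightarrow> real^3) \<Rightarrow> real^3 \<Rightarrow> real^3" where
  "lc_cov h X Y x = (\<Sum>i\<in>UNIV. (X x $ i) *\<^sub>R pd Y i x)
      + (\<Sum>i\<in>UNIV. \<Sum>j\<in>UNIV. (X x $ i * Y x $ j) *\<^sub>R lc_christoffel h x i j)"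

definition sym_group :: "(real^3 \<Rightarrow> real^3^3) \<Rightarrow> (real^3 \<Rightarrow> 3 \<Rightarrow> 3 \<Rightarrow> real^3) \<Rightarrow> real^3 \<Rightarrow> (real^3^3) monoid" where
  "sym_group h \<Gamma> x = \<lparr>carrier = {L. transpose L ** h x ** L = h x \<and> det L = 1 \<and>
        (\<forall>u v. Kbil h \<Gamma> x (L *v u) (L *v v) = L *v Kbil h \<Gamma> x u v)},
      monoid.mult = (\<lambda>A B. A ** B), one = mat 1\<rparr>"

definition Z3_group :: "int monoid" where
  "Z3_group = integer_mod_group 3"

definition SO2_group :: "(real^2^2) monoid" where
  "SO2_group = \<lparr>carrier = {A. transpose A ** A = mat 1 \<and> det A = 1},
      monoid.mult = (\<lambda>A B. A ** B), one = mat 1\<rparr>"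

definition model_map :: "(real \<Rightarrow> real^2) \<Rightarrow> (real^2 \<Rightarrow> real) \<Rightarrow> real^3 \<Rightarrow> real^4" where
  "model_map \<gamma> f x = (let t = x $ 1; v = x $ 2; w = x $ 3; g1 = \<gamma> t $ 1; g2 = \<gamma> t $ 2;
      vw = (\<chi> i. if i = 1 then v else w) :: real^2
    in (\<chi> r. if r = 1 then g1 * v else if r = 2 then g1 * w
             else if r = 3 then g1 * f vw + g2 else g1))"

definition graph_map :: "(real^2 \<Rightarrow> real) \<Rightarrow> real^2 \<Rightarrow> real^3" where
  "graph_map f y = (\<chi> r. if r = 1 then y $ 1 else if r = 2 then y $ 2 else f y)"

definition e3 :: "real^3" where
  "e3 = axis 3 1"

definition on_elliptic_paraboloid :: "(real^3) set \<Rightarrow> bool" where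
  "on_elliptic_paraboloid S \<longleftrightarrow> (\<exists>A :: real^3^3. \<exists>b. invertible A \<and>
      (\<forall>y\<in>S. let z = A *v y + b in z $ 3 = (z $ 1)\<^sup>2 + (z $ 2)\<^sup>2))"

definition prod_dom :: "real set \<Rightarrow> (real^2) set \<Rightarrow> (real^3) set" where
  "prod_dom I N = {x. x $ 1 \<in> I \<and> ((\<chi> i. if i = 1 then x $ 2 else x $ 3) :: real^2) \<in> N}"

end

theory Submission
  imports Defs
begin

text \<open>
  Write \<open>\<alpha> = \<alpha>\<^sub>2\<^sub>2\<close>, \<open>a = a\<^sub>4\<close>. The Codazzi and Gauss equations in the frame \<open>T, V, W\<close> give
  \<open>T a = -4 \<alpha> a\<close> and \<open>T \<alpha> = -4 a\<^sup>2\<close>, while \<open>a\<close> and \<open>\<alpha>\<close> are constant along \<open>V\<close> and \<open>W\<close>.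
  Placing the origin so that \<open>\<xi> = - H \<phi>\<close>, the hypothesis \<open>H = (\<alpha> - a) (\<alpha> + a)\<close> makes
  \<open>T - (\<alpha> + a) \<phi>\<close> a field of constant direction and makes the 3-space spanned by it together with
  \<open>V\<close> and \<open>W\<close> parallel. Taking the former as third basis vector and the latter as the kernel of
  the fourth coordinate, \<open>y = A \<phi>\<close> satisfies \<open>T y = \<lambda> e\<^sub>3 + (\<alpha> + a) y\<close> with \<open>\<lambda>\<close> constant
  along \<open>V\<close> and \<open>W\<close>. Hence \<open>(t, v, w) = (y\<^sub>4, y\<^sub>1 / y\<^sub>4, y\<^sub>2 / y\<^sub>4)\<close> are coordinates, and
  \<open>y\<^sub>3 / y\<^sub>4\<close> splits as \<open>f(v, w) + k(t)\<close> because its \<open>t\<close>-derivative does not depend on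
  \<open>(v, w)\<close>. In the basis of the \<open>(v, w)\<close>-plane given by \<open>V\<close> and \<open>W\<close>, the Hessian of \<open>f\<close> is
  the identity matrix, and this basis has determinant one, so the Hessian determinant of \<open>f\<close> is one.
  If \<open>a\<^sub>6 = 0\<close> then \<open>V\<close> and \<open>W\<close> rotate the basis, the Hessian is constant, and \<open>f\<close> is quadratic.
\<close>

section \<open>Smooth functions on open sets\<close>

text \<open>The mechanism is the factorisation of H. The transversal part of VV\<phi> and of
  WW\<phi> is (\<alpha> - a) T + \<xi>, and with \<xi> = - H \<phi> this is (\<alpha> - a) times the
  field T - (\<alpha> + a) \<phi>. So each leaf spanned by V and W lies in an affine 3-space and has
  the common fixed direction as transversal. As H is nonzero, neither factor vanishes: \<alpha> + a
  makes the fourth coordinate a parameter transversal to the leaves, while \<alpha> - a makes the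
  leaves nondegenerate and fixes the scale of the third basis vector. The obstacle comes earlier.
  The Codazzi equations alone do not make T geodesic and the leaves umbilic, because the linear
  systems for the remaining connection coefficients degenerate when a_6 = 2 a_4; there the
  hypothesis on H has to be differentiated. Smoothness is given for \<phi>, \<xi> and the frame. The
  metric and all coefficient functions inherit it as solutions of linear systems.\<close>

lemma has_derivative_pd:
  fixes f :: "real^'n \<Rightarrow> 'b::real_normed_vector"
  assumes "f differentiable (at x)"
  shows "(f has_derivative (\<lambda>u. \<Sum>i\<in>UNIV. (u $ i) *\<^sub>R pd f i x)) (at x)"
proof -
  let ?D = "frechet_derivative f (at x)"
  have D: "(f has_derivative ?D) (at x)"
    using assms frechet_derivative_works by blast
  then interpret linear ?D
    using has_derivative_linear by blast
  have "?D u = (\<Sum>i\<in>UNIV. (u $ i) *\<^sub>R pd f i x)" for u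
  proof -
    have "?D u = ?D (\<Sum>i\<in>UNIV. (u $ i) *\<^sub>R axis i 1)"
      by (subst basis_expansion[of u, symmetric]) (simp add: scalar_mult_eq_scaleR)
    also have "\<dots> = (\<Sum>i\<in>UNIV. (u $ i) *\<^sub>R pd f i x)"
      by (simp add: sum scaleR pd_def)
    finally show ?thesis .
  qed
  then have "?D = (\<lambda>u. \<Sum>i\<in>UNIV. (u $ i) *\<^sub>R pd f i x)"
    by blast
  with D show ?thesis by simp
qed

lemma pd_eqI:
  assumes "(f has_derivative f') (at x)"
  shows "pd f i x = f' (axis i 1)"
  unfolding pd_def using frechet_derivative_at[OF assms] by metis

lemma sum_axis_scaleR:
  fixes g :: "'n::finite \<Rightarrow> 'b::real_vector"
  shows "(\<Sum>k\<in>UNIV. (axis i 1 $ k :: real) *\<^sub>R g k) = g i"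
proof -
  have "(\<Sum>k\<in>UNIV. (axis i 1 $ k :: real) *\<^sub>R g k) = (\<Sum>k\<in>UNIV. if k = i then g k else 0)"
    by (rule sum.cong) (simp_all add: axis_def)
  then show ?thesis by simp
qed

lemma sum_axis_mult: "(\<Sum>k\<in>UNIV. axis i 1 $ k * g k) = (g i :: real)"
  using sum_axis_scaleR[of i g] by simp

text \<open>\<open>frechet_derivative\<close> is chosen among all maps satisfying
  \<open>has_derivative\<close>. Functions that agree near \<open>x\<close> have the same
  candidates, so the equality holds even at points of nondifferentiability.\<close>

lemma pd_cong:
  assumes "open U" "x \<in> U" "\<And>y. y \<in> U \<Longrightarrow> f y = g y"
  shows "pd f i x = pd g i x"
proof -
  have "(f has_derivative f') (at x) \<longleftrightarrow> (g has_derivative f') (at x)" for f'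
    using assms by (metis has_derivative_transform_within_open)
  then show ?thesis
    by (simp add: pd_def frechet_derivative_def)
qed

lemma dpart_append: "dpart (is @ js) f = dpart is (dpart js f)"
  by (induction "is") auto

lemma dpart_snoc: "dpart (is @ [j]) f = dpart is (pd f j)"
  by (simp add: dpart_append)

lemma smooth_on_pd: "smooth_on U f \<Longrightarrow> smooth_on U (pd f i)"
  unfolding smooth_on_def by (metis dpart_snoc)

lemma smooth_on_differentiable_on: "smooth_on U f \<Longrightarrow> f differentiable_on U"
  unfolding smooth_on_def by (metis dpart.simps(1))

lemma smooth_on_differentiable:
  "smooth_on U f \<Longrightarrow> open U \<Longrightarrow> x \<in> U \<Longrightarrow> f differentiable (at x)"
  using smooth_on_differentiable_on differentiable_on_eq_differentiable_at by blast

lemma smooth_on_continuous_on: "smooth_on U f \<Longrightarrow> continuous_on U f"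
  by (simp add: differentiable_imp_continuous_on smooth_on_differentiable_on)

lemma smooth_on_subset:
  "smooth_on U f \<Longrightarrow> V \<subseteq> U \<Longrightarrow> smooth_on V f"
  unfolding smooth_on_def using differentiable_on_subset by blast

text \<open>\<open>dpart\<close> adds each new derivative on the outside, whereas the product and
  chain rules act on \<open>f\<close> itself. Peeling off the innermost derivative and bounding the
  order by \<open>n\<close> turns every closure property into an induction on
  \<open>n\<close>.\<close>

primrec diff_upto :: "nat \<Rightarrow> (real^'n) set \<Rightarrow> (real^'n \<Rightarrow> 'b::real_normed_vector) \<Rightarrow> bool" where
  "diff_upto 0 U f \<longleftrightarrow> True"
| "diff_upto (Suc n) U f \<longleftrightarrow> f differentiable_on U \<and> (\<forall>i. diff_upto n U (pd f i))"

lemma diff_upto_dpart: "diff_upto n U f \<Longrightarrow> length is < n \<Longrightarrow> dpart is f differentiable_on U"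
proof (induction n arbitrary: f "is")
  case (Suc n)
  then show ?case
    by (cases "is" rule: rev_cases) (auto simp: dpart_snoc)
qed simp

lemma smooth_on_iff_diff_upto: "smooth_on U f \<longleftrightarrow> (\<forall>n. diff_upto n U f)"
proof
  have "smooth_on U f \<Longrightarrow> diff_upto n U f" for n
    by (induction n arbitrary: f) (auto simp: smooth_on_differentiable_on smooth_on_pd)
  then show "smooth_on U f \<Longrightarrow> \<forall>n. diff_upto n U f" by blast
  show "\<forall>n. diff_upto n U f \<Longrightarrow> smooth_on U f"
    unfolding smooth_on_def using diff_upto_dpart lessI by blast
qed

lemma differentiable_on_cong_open:
  assumes "open U" "\<And>y. y \<in> U \<Longrightarrow> f y = g y" "f differentiable_on U"
  shows "g differentiable_on U"
  unfolding differentiable_on_eq_differentiable_at[OF assms(1)]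
proof
  fix x assume x: "x \<in> U"
  then have "(f has_derivative frechet_derivative f (at x)) (at x)"
    using assms(1,3) by (simp add: differentiable_on_eq_differentiable_at frechet_derivative_works)
  then show "g differentiable at x"
    using has_derivative_transform_within_open[OF _ assms(1) x] assms(2) by (blast intro: differentiableI)
qed

lemma diff_upto_cong:
  assumes "open U" "\<And>y. y \<in> U \<Longrightarrow> f y = g y" "diff_upto n U f"
  shows "diff_upto n U g"
  using assms(2,3)
proof (induction n arbitrary: f g)
  case (Suc n)
  have "g differentiable_on U"
    using differentiable_on_cong_open[OF assms(1), of f g] Suc by simp
  moreover have "diff_upto n U (pd g i)" for i
    by (rule Suc.IH[of "pd f i"]) (use pd_cong[OF assms(1)] Suc.prems in auto)
  ultimately show ?case by simp
qed simp

lemma smooth_on_cong: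
  assumes "open U" "\<And>y. y \<in> U \<Longrightarrow> f y = g y" "smooth_on U f"
  shows "smooth_on U g"
  using assms unfolding smooth_on_iff_diff_upto by (blast intro: diff_upto_cong)

text \<open>The derivative of a product or composite still contains undifferentiated factors; in the
  inductions these are used with the order lowered by one.\<close>

lemma diff_upto_Suc_D: "diff_upto (Suc n) U f \<Longrightarrow> diff_upto n U f"
  by (induction n arbitrary: f) auto

lemma diff_upto_const:
  fixes U :: "(real^'n) set"
  shows "diff_upto n U (\<lambda>x. c)"
proof (induction n arbitrary: c)
  case (Suc n)
  have "pd (\<lambda>x. c) i = (\<lambda>x. 0)" for i :: 'n
    by (auto simp: pd_def)
  with Suc show ?case by (simp)
qed simp

lemma pd_add:
  "f differentiable (at x) \<Longrightarrow> g differentiable (at x) \<Longrightarrow> pd (\<lambda>x. f x + g x) i x = pd f i x + pd g i x"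
  using pd_eqI[OF has_derivative_add[OF has_derivative_pd has_derivative_pd], of f x g i]
  by (simp add: sum_axis_scaleR)

lemma pd_bilinear:
  assumes "bounded_bilinear B" "f differentiable (at x)" "g differentiable (at x)"
  shows "pd (\<lambda>x. B (f x) (g x)) i x = B (pd f i x) (g x) + B (f x) (pd g i x)"
  using pd_eqI[OF bounded_bilinear.FDERIV[OF assms(1) has_derivative_pd[OF assms(2)] has_derivative_pd[OF assms(3)]], of i]
  by (simp add: sum_axis_scaleR)

lemma pd_linear:
  assumes "bounded_linear L" "f differentiable (at x)"
  shows "pd (\<lambda>x. L (f x)) i x = L (pd f i x)"
  using pd_eqI[OF bounded_linear.has_derivative[OF assms(1) has_derivative_pd[OF assms(2)]], of i]
  by (simp add: sum_axis_scaleR)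

lemma diff_upto_add:
  assumes "open U" "diff_upto n U f" "diff_upto n U g"
  shows "diff_upto n U (\<lambda>x. f x + g x)"
  using assms(2,3)
proof (induction n arbitrary: f g)
  case (Suc n)
  have d: "f differentiable (at x)" "g differentiable (at x)" if "x \<in> U" for x
    using Suc.prems that assms(1) by (auto simp: differentiable_on_eq_differentiable_at)
  have "diff_upto n U (pd (\<lambda>x. f x + g x) i)" for i
    by (rule diff_upto_cong[OF assms(1), of "\<lambda>x. pd f i x + pd g i x"])
       (use Suc in \<open>auto simp: pd_add d\<close>)
  then show ?case using Suc.prems by auto
qed simp

lemma diff_upto_bilinear:
  assumes "bounded_bilinear B" "open U" "diff_upto n U f" "diff_upto n U g"
  shows "diff_upto n U (\<lambda>x. B (f x) (g x))"
  using assms(3,4)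
proof (induction n arbitrary: f g)
  case (Suc n)
  have d: "f differentiable (at x)" "g differentiable (at x)" if "x \<in> U" for x
    using Suc.prems that assms(2) by (auto simp: differentiable_on_eq_differentiable_at)
  have "diff_upto n U (pd (\<lambda>x. B (f x) (g x)) i)" for i
  proof (rule diff_upto_cong[OF assms(2)])
    show "diff_upto n U (\<lambda>x. B (pd f i x) (g x) + B (f x) (pd g i x))"
      using Suc.prems diff_upto_Suc_D[OF Suc.prems(1)] diff_upto_Suc_D[OF Suc.prems(2)]
      by (intro diff_upto_add[OF assms(2) Suc.IH Suc.IH]) auto
  qed (simp add: pd_bilinear[OF assms(1)] d)
  moreover have "(\<lambda>x. B (f x) (g x)) differentiable_on U"
    unfolding differentiable_on_eq_differentiable_at[OF assms(2)]
    using bounded_bilinear.FDERIV[OF assms(1) has_derivative_pd[OF d(1)] has_derivative_pd[OF d(2)]]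
    by (auto intro: differentiableI)
  ultimately show ?case by auto
qed simp

lemma diff_upto_linear:
  assumes "bounded_linear L" "open U" "diff_upto n U f"
  shows "diff_upto n U (\<lambda>x. L (f x))"
  using assms(3)
proof (induction n arbitrary: f)
  case (Suc n)
  have d: "f differentiable (at x)" if "x \<in> U" for x
    using Suc.prems that assms(2) by (auto simp: differentiable_on_eq_differentiable_at)
  have "diff_upto n U (pd (\<lambda>x. L (f x)) i)" for i
    by (rule diff_upto_cong[OF assms(2), of "\<lambda>x. L (pd f i x)"])
       (use Suc in \<open>auto simp: pd_linear[OF assms(1)] d\<close>)
  moreover have "(\<lambda>x. L (f x)) differentiable_on U"
    unfolding differentiable_on_eq_differentiable_at[OF assms(2)]
    using bounded_linear.has_derivative[OF assms(1) has_derivative_pd[OF d]]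
    by (auto intro: differentiableI)
  ultimately show ?case by auto
qed simp

lemma diff_upto_sum:
  assumes "open U" "\<And>a. a \<in> A \<Longrightarrow> diff_upto n U (f a)"
  shows "diff_upto n U (\<lambda>x. \<Sum>a\<in>A. f a x)"
  using assms by (induction A rule: infinite_finite_induct) (auto simp: diff_upto_const diff_upto_add)

lemma pd_compose:
  fixes f :: "real^'m \<Rightarrow> 'b::real_normed_vector" and g :: "real^'n \<Rightarrow> real^'m"
  assumes "g differentiable (at x)" "f differentiable (at (g x))"
  shows "pd (\<lambda>x. f (g x)) i x = (\<Sum>j\<in>UNIV. (pd g i x $ j) *\<^sub>R pd f j (g x))"
  using pd_eqI[OF has_derivative_compose[OF has_derivative_pd[OF assms(1)] has_derivative_pd[OF assms(2)]], of i]
  by (simp add: sum_axis_scaleR)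

text \<open>The inner map stays fixed in the induction: its derivatives enter only as coefficients
  of the chain rule, and the induction hypothesis is applied to \<open>pd f j\<close>.\<close>

lemma diff_upto_compose:
  fixes f :: "real^'m \<Rightarrow> 'b::real_normed_vector" and g :: "real^'n \<Rightarrow> real^'m"
  assumes "open U" "open V" "g ` U \<subseteq> V" "diff_upto n U g" "diff_upto n V f"
  shows "diff_upto n U (\<lambda>x. f (g x))"
  using assms(4,5)
proof (induction n arbitrary: f)
  case (Suc n)
  have d: "g differentiable (at x)" "f differentiable (at (g x))" if "x \<in> U" for x
    using Suc.prems that assms(1-3) by (auto simp: differentiable_on_eq_differentiable_at image_subset_iff)
  have "diff_upto n U (pd (\<lambda>x. f (g x)) i)" for i
  proof (rule diff_upto_cong[OF assms(1)])
    show "diff_upto n U (\<lambda>x. \<Sum>j\<in>UNIV. (pd g i x $ j) *\<^sub>R pd f j (g x))"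
      using Suc.prems diff_upto_Suc_D[OF Suc.prems(1)]
      by (intro diff_upto_sum[OF assms(1)] diff_upto_bilinear[OF bounded_bilinear_scaleR assms(1)]
           diff_upto_linear[OF bounded_linear_vec_nth assms(1)] Suc.IH) auto
  qed (simp add: pd_compose d)
  moreover have "(\<lambda>x. f (g x)) differentiable_on U"
    using d assms(1) differentiable_chain_at[of g _ f]
    by (auto simp: differentiable_on_eq_differentiable_at o_def)
  ultimately show ?case by auto
qed simp

lemma pd_inverse:
  fixes f :: "real^'n \<Rightarrow> real"
  assumes "f differentiable (at x)" "f x \<noteq> 0"
  shows "pd (\<lambda>x. inverse (f x)) i x = - (inverse (f x) * pd f i x * inverse (f x))"
  using pd_eqI[OF Deriv.has_derivative_inverse[OF assms(2) has_derivative_pd[OF assms(1)]], of i]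
  by (simp add: sum_axis_mult)

text \<open>The derivative is a polynomial in \<open>inverse (f x)\<close> and
  \<open>pd f i x\<close>, so order \<open>n\<close> of the inverse yields order
  \<open>n + 1\<close>.\<close>

lemma diff_upto_inverse:
  fixes f :: "real^'n \<Rightarrow> real"
  assumes "open U" "\<And>x. x \<in> U \<Longrightarrow> f x \<noteq> 0" "diff_upto n U f"
  shows "diff_upto n U (\<lambda>x. inverse (f x))"
  using assms(3)
proof (induction n)
  case (Suc n)
  have d: "f differentiable (at x)" if "x \<in> U" for x
    using Suc.prems that assms(1) by (auto simp: differentiable_on_eq_differentiable_at)
  have "diff_upto n U (pd (\<lambda>x. inverse (f x)) i)" for i
  proof (rule diff_upto_cong[OF assms(1)])
    show "diff_upto n U (\<lambda>x. - (inverse (f x) * pd f i x * inverse (f x)))"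
      using Suc.prems diff_upto_Suc_D[OF Suc.prems(1)]
      by (intro diff_upto_linear[OF bounded_linear_minus[OF bounded_linear_ident] assms(1)]
           diff_upto_bilinear[OF bounded_bilinear_mult assms(1)] Suc.IH) auto
  qed (simp add: pd_inverse d assms(2))
  moreover have "(\<lambda>x. inverse (f x)) differentiable_on U"
    using d assms(1,2) by (auto simp: differentiable_on_eq_differentiable_at)
  ultimately show ?case by auto
qed simp

named_theorems smooth_intros

lemma smooth_on_const [smooth_intros]: "smooth_on U (\<lambda>x. c)"
  by (simp add: smooth_on_iff_diff_upto diff_upto_const)

lemma smooth_on_add [smooth_intros]:
  "open U \<Longrightarrow> smooth_on U f \<Longrightarrow> smooth_on U g \<Longrightarrow> smooth_on U (\<lambda>x. f x + g x)"
  by (simp add: smooth_on_iff_diff_upto diff_upto_add)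

lemma smooth_on_linear:
  "bounded_linear L \<Longrightarrow> open U \<Longrightarrow> smooth_on U f \<Longrightarrow> smooth_on U (\<lambda>x. L (f x))"
  by (simp add: smooth_on_iff_diff_upto diff_upto_linear)

lemma smooth_on_minus [smooth_intros]:
  "open U \<Longrightarrow> smooth_on U f \<Longrightarrow> smooth_on U (\<lambda>x. - f x)"
  using smooth_on_linear[OF bounded_linear_minus[OF bounded_linear_ident]] by blast

lemma smooth_on_diff [smooth_intros]:
  "open U \<Longrightarrow> smooth_on U f \<Longrightarrow> smooth_on U g \<Longrightarrow> smooth_on U (\<lambda>x. f x - g x)"
  using smooth_on_add[OF _ _ smooth_on_minus, of U f g] by simp

lemma smooth_on_bilinear:
  "bounded_bilinear B \<Longrightarrow> open U \<Longrightarrow> smooth_on U f \<Longrightarrow> smooth_on U g \<Longrightarrow> smooth_on U (\<lambda>x. B (f x) (g x))"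
  by (simp add: smooth_on_iff_diff_upto diff_upto_bilinear)

lemma smooth_on_mult [smooth_intros]:
  fixes f g :: "real^'n \<Rightarrow> real"
  shows "open U \<Longrightarrow> smooth_on U f \<Longrightarrow> smooth_on U g \<Longrightarrow> smooth_on U (\<lambda>x. f x * g x)"
  using smooth_on_bilinear[OF bounded_bilinear_mult] by blast

lemma smooth_on_scaleR [smooth_intros]:
  "open U \<Longrightarrow> smooth_on U f \<Longrightarrow> smooth_on U g \<Longrightarrow> smooth_on U (\<lambda>x. f x *\<^sub>R g x)"
  using smooth_on_bilinear[OF bounded_bilinear_scaleR] by blast

lemma smooth_on_inner [smooth_intros]:
  "open U \<Longrightarrow> smooth_on U f \<Longrightarrow> smooth_on U g \<Longrightarrow> smooth_on U (\<lambda>x. f x \<bullet> g x)"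
  using smooth_on_bilinear[OF bounded_bilinear_inner] by blast

lemma smooth_on_sum [smooth_intros]:
  "open U \<Longrightarrow> (\<And>a. a \<in> A \<Longrightarrow> smooth_on U (f a)) \<Longrightarrow> smooth_on U (\<lambda>x. \<Sum>a\<in>A. f a x)"
  by (simp add: smooth_on_iff_diff_upto diff_upto_sum)

lemma smooth_on_prod [smooth_intros]:
  fixes f :: "'a \<Rightarrow> real^'n \<Rightarrow> real"
  assumes "open U" "\<And>a. a \<in> A \<Longrightarrow> smooth_on U (f a)"
  shows "smooth_on U (\<lambda>x. \<Prod>a\<in>A. f a x)"
  using assms by (induction A rule: infinite_finite_induct) (auto intro!: smooth_intros)

lemma smooth_on_inverse [smooth_intros]:
  fixes f :: "real^'n \<Rightarrow> real"
  shows "open U \<Longrightarrow> (\<And>x. x \<in> U \<Longrightarrow> f x \<noteq> 0) \<Longrightarrow> smooth_on U f \<Longrightarrow> smooth_on U (\<lambda>x. inverse (f x))"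
  by (simp add: smooth_on_iff_diff_upto diff_upto_inverse)

lemma smooth_on_divide [smooth_intros]:
  fixes f g :: "real^'n \<Rightarrow> real"
  shows "open U \<Longrightarrow> smooth_on U f \<Longrightarrow> smooth_on U g \<Longrightarrow> (\<And>x. x \<in> U \<Longrightarrow> g x \<noteq> 0) \<Longrightarrow> smooth_on U (\<lambda>x. f x / g x)"
  using smooth_on_mult[OF _ _ smooth_on_inverse, of U f g] by (simp add: divide_inverse)

lemma smooth_on_compose:
  fixes f :: "real^'m \<Rightarrow> 'b::real_normed_vector" and g :: "real^'n \<Rightarrow> real^'m"
  assumes "open U" "open V" "g ` U \<subseteq> V" "smooth_on U g" "smooth_on V f"
  shows "smooth_on U (\<lambda>x. f (g x))"
  using assms by (simp add: smooth_on_iff_diff_upto diff_upto_compose)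

lemma smooth_on_nth [smooth_intros]:
  "open U \<Longrightarrow> smooth_on U f \<Longrightarrow> smooth_on U (\<lambda>x. f x $ i)"
  using smooth_on_linear[OF bounded_linear_vec_nth] by blast

lemma smooth_on_ident [smooth_intros]: 
  fixes U :: "(real^'n) set"
  shows "smooth_on U (\<lambda>x. x)"
proof -
  have "pd (\<lambda>x::real^'n. x) i = (\<lambda>x. axis i 1)" for i
    by (auto simp: pd_def)
  then have "diff_upto n U (\<lambda>x. x)" for n
    by (cases n) (auto simp: diff_upto_const)
  then show ?thesis by (simp add: smooth_on_iff_diff_upto)
qed

lemma smooth_on_vec:
  fixes f :: "real^'n \<Rightarrow> real^'m"
  assumes "open U" "\<And>i. smooth_on U (\<lambda>x. f x $ i)"
  shows "smooth_on U f"
proof -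
  have "smooth_on U (\<lambda>x. \<Sum>i\<in>UNIV. f x $ i *\<^sub>R (axis i 1 :: real^'m))"
    using assms by (intro smooth_on_sum smooth_on_scaleR smooth_on_const) auto
  moreover have "(\<Sum>i\<in>UNIV. f x $ i *\<^sub>R axis i 1) = f x" for x
    using basis_expansion[of "f x"] by (simp add: scalar_mult_eq_scaleR)
  ultimately show ?thesis by simp
qed

lemma smooth_on_vec_lambda [smooth_intros]:
  fixes f :: "'m::finite \<Rightarrow> real^'n \<Rightarrow> real"
  assumes "open U" "\<And>i. smooth_on U (f i)"
  shows "smooth_on U (\<lambda>x. \<chi> i. f i x)"
  by (rule smooth_on_vec) (use assms in auto)

lemma smooth_on_det:
  fixes M :: "real^'n \<Rightarrow> real^'m^'m"
  assumes "open U" "\<And>i j. smooth_on U (\<lambda>x. M x $ i $ j)"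
  shows "smooth_on U (\<lambda>x. det (M x))"
  unfolding det_def using assms by (intro smooth_on_sum smooth_on_prod smooth_on_mult smooth_on_const) auto

text \<open>Cramer's rule writes the solution as quotients of determinants. This is how quantities
  known only as coefficients of an expansion, such as \<open>h\<close> and the connection
  coefficients, acquire smoothness.\<close>

lemma smooth_on_linear_system:
  fixes M :: "real^'n \<Rightarrow> real^'m^'m"
  assumes "open U" "\<And>i j. smooth_on U (\<lambda>x. M x $ i $ j)" "\<And>i. smooth_on U (\<lambda>x. b x $ i)"
    and "\<And>x. x \<in> U \<Longrightarrow> det (M x) \<noteq> 0" "\<And>x. x \<in> U \<Longrightarrow> M x *v c x = b x"
  shows "smooth_on U c"
proof -
  have "smooth_on U (\<lambda>x. (\<chi> k. det (\<chi> i j. if j = k then b x $ i else M x $ i $ j) / det (M x)))"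
  proof (intro smooth_on_vec_lambda smooth_on_divide smooth_on_det assms)
    fix k i j
    show "smooth_on U (\<lambda>x. (\<chi> i j. if j = k then b x $ i else M x $ i $ j) $ i $ j)"
      using assms by (cases "j = k") auto
  qed
  then show ?thesis
    by (rule smooth_on_cong[OF assms(1), rotated]) (simp add: cramer[THEN iffD1, OF assms(4,5)])
qed

section \<open>Second derivatives, directional derivatives and smooth local inverses\<close>

lemma has_vector_derivative_line:
  fixes f :: "real^'n \<Rightarrow> 'b::real_normed_vector"
  assumes "f differentiable (at (z + s *\<^sub>R axis i 1))"
  shows "((\<lambda>s. f (z + s *\<^sub>R axis i 1)) has_vector_derivative pd f i (z + s *\<^sub>R axis i 1)) (at s)"
proof -
  have "((\<lambda>s. z + s *\<^sub>R axis i 1) has_derivative (\<lambda>h. h *\<^sub>R axis i 1)) (at s)"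
    by (auto intro!: derivative_eq_intros)
  from has_derivative_compose[OF this has_derivative_pd[OF assms]]
  have "((\<lambda>s. f (z + s *\<^sub>R axis i 1)) has_derivative
      (\<lambda>h. \<Sum>k\<in>UNIV. ((h *\<^sub>R axis i 1) $ k) *\<^sub>R pd f k (z + s *\<^sub>R axis i 1))) (at s)" .
  moreover have "(\<Sum>k\<in>UNIV. ((h *\<^sub>R axis i 1) $ k) *\<^sub>R pd f k y) = h *\<^sub>R pd f i y" for h y
    using sum_axis_scaleR[of i "\<lambda>k. h *\<^sub>R pd f k y"] by (simp add: mult.commute)
  ultimately show ?thesis
    by (simp add: has_vector_derivative_def)
qed

text \<open>The mean value theorem is used twice: in direction \<open>i\<close> for the difference
  of \<open>f\<close> in direction \<open>j\<close>, then in direction \<open>j\<close> for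
  \<open>pd f i\<close>. The second difference is symmetric in \<open>i\<close> and
  \<open>j\<close>, so exchanging them evaluates it by the other mixed derivative. The square of
  side \<open>e\<close> stays within distance \<open>2 * e\<close> of \<open>x\<close>, hence inside
  the ball.\<close>

lemma second_difference_mvt:
  fixes f :: "real^'n \<Rightarrow> real"
  assumes "open U" "smooth_on U f" "0 < e" "ball x (3 * e) \<subseteq> U"
  obtains y where "y \<in> ball x (3 * e)"
    "f (x + e *\<^sub>R axis i 1 + e *\<^sub>R axis j 1) - f (x + e *\<^sub>R axis i 1) - f (x + e *\<^sub>R axis j 1) + f x
      = e\<^sup>2 * pd (pd f i) j y"
proof -
  have inU: "x + s *\<^sub>R axis i 1 + t *\<^sub>R axis j 1 \<in> ball x (3 * e)" if "0 \<le> s" "s \<le> e" "0 \<le> t" "t \<le> e" for s t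
  proof -
    have "norm (s *\<^sub>R axis i 1 + t *\<^sub>R axis j 1 :: real^'n) \<le> \<bar>s\<bar> + \<bar>t\<bar>"
      by (rule order_trans[OF norm_triangle_ineq]) (simp add: norm_axis_1)
    also have "\<dots> < 3 * e" using that assms(3) by simp
    finally show ?thesis
      by (simp add: dist_norm norm_minus_commute algebra_simps)
  qed
  have d: "f differentiable (at y)" "pd f i differentiable (at y)" if "y \<in> ball x (3 * e)" for y
    using that assms smooth_on_differentiable smooth_on_pd by blast+
  define g where "g s = f ((x + e *\<^sub>R axis j 1) + s *\<^sub>R axis i 1) - f (x + s *\<^sub>R axis i 1)" for s
  define g' where "g' s = pd f i ((x + e *\<^sub>R axis j 1) + s *\<^sub>R axis i 1) - pd f i (x + s *\<^sub>R axis i 1)" for s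
  have "(g has_real_derivative g' s) (at s)" if "0 \<le> s" "s \<le> e" for s
    unfolding g_def g'_def has_real_derivative_iff_has_vector_derivative
    using inU[of s e] inU[of s 0] that assms(3)
    by (intro has_vector_derivative_diff has_vector_derivative_line d) (auto simp: algebra_simps)
  from MVT2[OF assms(3) this] obtain s where s: "0 < s" "s < e" "g e - g 0 = (e - 0) * g' s"
    by blast
  define k where "k t = pd f i ((x + s *\<^sub>R axis i 1) + t *\<^sub>R axis j 1)" for t
  have "(k has_real_derivative pd (pd f i) j ((x + s *\<^sub>R axis i 1) + t *\<^sub>R axis j 1)) (at t)"
    if "0 \<le> t" "t \<le> e" for t
    unfolding k_def has_real_derivative_iff_has_vector_derivative
    using inU[of s t] that s by (intro has_vector_derivative_line d) auto
  from MVT2[OF assms(3) this] obtain t where t: "0 < t" "t < e"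
    "k e - k 0 = (e - 0) * pd (pd f i) j ((x + s *\<^sub>R axis i 1) + t *\<^sub>R axis j 1)"
    by blast
  show ?thesis
  proof
    show "x + s *\<^sub>R axis i 1 + t *\<^sub>R axis j 1 \<in> ball x (3 * e)" using inU s t by simp
    have "g' s = k e - k 0" by (simp add: g'_def k_def algebra_simps)
    with s t have "g e - g 0 = e\<^sup>2 * pd (pd f i) j (x + s *\<^sub>R axis i 1 + t *\<^sub>R axis j 1)"
      by (simp add: power2_eq_square)
    then show "f (x + e *\<^sub>R axis i 1 + e *\<^sub>R axis j 1) - f (x + e *\<^sub>R axis i 1) - f (x + e *\<^sub>R axis j 1) + f x
      = e\<^sup>2 * pd (pd f i) j (x + s *\<^sub>R axis i 1 + t *\<^sub>R axis j 1)"
      by (simp add: g_def algebra_simps)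
  qed
qed

lemma pd_commute_real:
  fixes f :: "real^'n \<Rightarrow> real"
  assumes "open U" "smooth_on U f" "x \<in> U"
  shows "pd (pd f i) j x = pd (pd f j) i x"
proof (rule ccontr)
  let ?A = "pd (pd f i) j" and ?B = "pd (pd f j) i"
  assume ne: "?A x \<noteq> ?B x"
  define h where "h y z = \<bar>?A y - ?A x\<bar> + \<bar>?B z - ?B x\<bar>" for y z
  \<comment> \<open>Half the gap: two values closer than \<open>?d\<close> to \<open>?A x\<close>
    and \<open>?B x\<close> respectively cannot coincide.\<close>
  let ?d = "\<bar>?A x - ?B x\<bar> / 2"
  have "isCont ?A x" "isCont ?B x"
    using assms smooth_on_pd smooth_on_differentiable differentiable_imp_continuous_within by blast+
  then obtain d1 d2 where d: "0 < d1" "\<And>y. dist y x < d1 \<Longrightarrow> dist (?A y) (?A x) < ?d"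
    "0 < d2" "\<And>y. dist y x < d2 \<Longrightarrow> dist (?B y) (?B x) < ?d"
    unfolding continuous_at_eps_delta dist_norm using ne by (metis half_gt_zero zero_less_abs_iff right_minus_eq)
  obtain r where r: "0 < r" "ball x r \<subseteq> U"
    using assms openE by blast
  define e where "e = min r (min d1 d2) / 3"
  have e: "0 < e" "ball x (3 * e) \<subseteq> U" "3 * e \<le> d1" "3 * e \<le> d2"
    using r d by (auto simp: e_def)
  obtain y where y: "y \<in> ball x (3 * e)"
    "f (x + e *\<^sub>R axis i 1 + e *\<^sub>R axis j 1) - f (x + e *\<^sub>R axis i 1) - f (x + e *\<^sub>R axis j 1) + f x = e\<^sup>2 * ?A y"
    using second_difference_mvt[OF assms(1,2) e(1,2)] by metis
  obtain z where z: "z \<in> ball x (3 * e)"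
    "f (x + e *\<^sub>R axis j 1 + e *\<^sub>R axis i 1) - f (x + e *\<^sub>R axis j 1) - f (x + e *\<^sub>R axis i 1) + f x = e\<^sup>2 * ?B z"
    using second_difference_mvt[OF assms(1,2) e(1,2)] by metis
  have "x + e *\<^sub>R axis j 1 + e *\<^sub>R axis i 1 = x + e *\<^sub>R axis i 1 + e *\<^sub>R axis j 1"
    by (simp add: algebra_simps)
  from y(2) z(2)[unfolded this] have "e\<^sup>2 * ?A y = e\<^sup>2 * ?B z" by linarith
  with e have "?A y = ?B z" by simp
  moreover have "\<bar>?A y - ?A x\<bar> < ?d" "\<bar>?B z - ?B x\<bar> < ?d"
    using d(2)[of y] d(4)[of z] y(1) z(1) e by (simp_all add: dist_commute dist_real_def abs_minus_commute)
  ultimately show False by (simp add: abs_if split: if_splits)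
qed

lemma pd_nth:
  "f differentiable (at x) \<Longrightarrow> pd (\<lambda>x. f x $ k) i x = pd f i x $ k"
  using pd_linear[OF bounded_linear_vec_nth] .

lemma pd_commute:
  fixes f :: "real^'n \<Rightarrow> real^'m"
  assumes "open U" "smooth_on U f" "x \<in> U"
  shows "pd (pd f i) j x = pd (pd f j) i x"
proof -
  have d: "f differentiable (at y)" "pd f i differentiable (at y)" if "y \<in> U" for y i
    using that assms smooth_on_differentiable smooth_on_pd by blast+
  have *: "pd (pd f i) j x $ k = pd (pd (\<lambda>x. f x $ k) i) j x" for i j k
    using pd_cong[OF assms(1,3), of "pd (\<lambda>x. f x $ k) i" "\<lambda>y. pd f i y $ k"]
    by (simp add: pd_nth d assms(3))
  show ?thesis
    unfolding vec_eq_iff * 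
    using pd_commute_real[OF assms(1) _ assms(3)] smooth_on_nth[OF assms(1,2)] by blast
qed

section \<open>Differentiation along vector fields\<close>

definition dirD :: "(real^'n \<Rightarrow> real^'n) \<Rightarrow> (real^'n \<Rightarrow> 'b::real_normed_vector) \<Rightarrow> real^'n \<Rightarrow> 'b" where
  "dirD X f x = (\<Sum>i\<in>UNIV. X x $ i *\<^sub>R pd f i x)"

lemma smooth_on_dirD [smooth_intros]:
  "open U \<Longrightarrow> smooth_on U X \<Longrightarrow> smooth_on U f \<Longrightarrow> smooth_on U (dirD X f)"
  unfolding dirD_def by (intro smooth_intros smooth_on_pd)

lemma dirD_cong:
  assumes "open U" "x \<in> U" "\<And>y. y \<in> U \<Longrightarrow> f y = g y"
  shows "dirD X f x = dirD X g x"
  unfolding dirD_def using pd_cong[OF assms] by simp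

lemma dirD_const [simp]: "dirD X (\<lambda>x. c) x = 0"
  by (simp add: dirD_def pd_def)

lemma dirD_add:
  "f differentiable (at x) \<Longrightarrow> g differentiable (at x) \<Longrightarrow>
    dirD X (\<lambda>x. f x + g x) x = dirD X f x + dirD X g x"
  by (simp add: dirD_def pd_add scaleR_add_right sum.distrib)

lemma dirD_bilinear:
  assumes "bounded_bilinear B" "f differentiable (at x)" "g differentiable (at x)"
  shows "dirD X (\<lambda>x. B (f x) (g x)) x = B (dirD X f x) (g x) + B (f x) (dirD X g x)"
proof -
  interpret bounded_bilinear B by fact
  show ?thesis
    by (simp add: dirD_def pd_bilinear[OF assms] scaleR_add_right sum.distrib sum_left sum_right
        scaleR_left scaleR_right)
qed

lemma dirD_linear:
  assumes "bounded_linear L" "f differentiable (at x)"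
  shows "dirD X (\<lambda>x. L (f x)) x = L (dirD X f x)"
proof -
  interpret bounded_linear L by fact
  show ?thesis by (simp add: dirD_def pd_linear[OF assms] sum scaleR)
qed

lemma dirD_minus: "f differentiable (at x) \<Longrightarrow> dirD X (\<lambda>x. - f x) x = - dirD X f x"
  by (rule dirD_linear[OF bounded_linear_minus[OF bounded_linear_ident]])

lemma dirD_diff:
  "f differentiable (at x) \<Longrightarrow> g differentiable (at x) \<Longrightarrow>
    dirD X (\<lambda>x. f x - g x) x = dirD X f x - dirD X g x"
  using dirD_add[of f x "\<lambda>x. - g x" X] by (simp add: dirD_minus)

lemma dirD_scaleR:
  "f differentiable (at x) \<Longrightarrow> g differentiable (at x) \<Longrightarrow>
    dirD X (\<lambda>x. f x *\<^sub>R g x) x = dirD X f x *\<^sub>R g x + f x *\<^sub>R dirD X g x"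
  by (rule dirD_bilinear[OF bounded_bilinear_scaleR])

lemma dirD_mult:
  fixes f g :: "real^'n \<Rightarrow> real"
  shows "f differentiable (at x) \<Longrightarrow> g differentiable (at x) \<Longrightarrow>
    dirD X (\<lambda>x. f x * g x) x = dirD X f x * g x + f x * dirD X g x"
  by (rule dirD_bilinear[OF bounded_bilinear_mult])

lemma dirD_inner:
  "f differentiable (at x) \<Longrightarrow> g differentiable (at x) \<Longrightarrow>
    dirD X (\<lambda>x. f x \<bullet> g x) x = dirD X f x \<bullet> g x + f x \<bullet> dirD X g x"
  by (rule dirD_bilinear[OF bounded_bilinear_inner])

lemma dirD_nth: "f differentiable (at x) \<Longrightarrow> dirD X (\<lambda>x. f x $ k) x = dirD X f x $ k"
  by (rule dirD_linear[OF bounded_linear_vec_nth])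

lemma dirD_divide:
  fixes f g :: "real^'n \<Rightarrow> real"
  assumes "f differentiable (at x)" "g differentiable (at x)" "g x \<noteq> 0"
  shows "dirD X (\<lambda>x. f x / g x) x = (dirD X f x * g x - f x * dirD X g x) / (g x)\<^sup>2"
proof -
  have "dirD X (\<lambda>x. inverse (g x)) x = - dirD X g x / (g x)\<^sup>2"
    using assms(2,3) by (simp add: dirD_def pd_inverse sum_negf divide_inverse sum_distrib_left power2_eq_square mult_ac)
  moreover have "dirD X (\<lambda>x. f x * inverse (g x)) x = dirD X f x * inverse (g x) + f x * dirD X (\<lambda>x. inverse (g x)) x"
    using assms by (intro dirD_mult) auto
  ultimately have "dirD X (\<lambda>x. f x * inverse (g x)) x = dirD X f x * inverse (g x) - f x * (dirD X g x / (g x)\<^sup>2)"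
    by simp
  also have "\<dots> = (dirD X f x * g x - f x * dirD X g x) / (g x)\<^sup>2"
    using assms(3) by (simp add: power2_eq_square field_simps)
  finally show ?thesis by (simp only: divide_inverse)
qed

lemma dirD_sum:
  assumes "\<And>a. a \<in> A \<Longrightarrow> f a differentiable (at x)"
  shows "dirD X (\<lambda>x. \<Sum>a\<in>A. f a x) x = (\<Sum>a\<in>A. dirD X (f a) x)"
  using assms by (induction A rule: infinite_finite_induct) (auto simp: dirD_add)

lemma dirD_direction_combination:
  "dirD (\<lambda>x. \<Sum>a\<in>A. c a x *\<^sub>R X a x) f x = (\<Sum>a\<in>A. c a x *\<^sub>R dirD (X a) f x)"
proof -
  have "dirD (\<lambda>x. \<Sum>a\<in>A. c a x *\<^sub>R X a x) f x = (\<Sum>i\<in>UNIV. \<Sum>a\<in>A. (c a x * X a x $ i) *\<^sub>R pd f i x)"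
    by (simp add: dirD_def scaleR_sum_left)
  also have "\<dots> = (\<Sum>a\<in>A. c a x *\<^sub>R dirD (X a) f x)"
    by (subst sum.swap) (simp add: dirD_def scaleR_sum_right)
  finally show ?thesis .
qed

text \<open>Only the value of the direction at \<open>x\<close> matters. Thus a field may be
  replaced by a combination of frame fields whose coefficients are frozen at
  \<open>x\<close>.\<close>

lemma dirD_direction_cong: "X x = Y x \<Longrightarrow> dirD X f x = dirD Y f x"
  by (simp add: dirD_def)

lemma dirD_dirD:
  fixes f :: "real^'n \<Rightarrow> 'b::real_normed_vector"
  assumes "open U" "smooth_on U Y" "smooth_on U f" "x \<in> U"
  shows "dirD X (dirD Y f) x = (\<Sum>i\<in>UNIV. \<Sum>j\<in>UNIV. (X x $ i * Y x $ j) *\<^sub>R pd (pd f j) i x) + dirD (dirD X Y) f x"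
proof -
  have d: "Y differentiable (at x)" "pd f j differentiable (at x)" "(\<lambda>x. Y x $ j) differentiable (at x)" for j
    using assms smooth_on_differentiable smooth_on_pd smooth_on_nth by blast+
  have "dirD X (dirD Y f) x = dirD X (\<lambda>x. \<Sum>j\<in>UNIV. Y x $ j *\<^sub>R pd f j x) x"
    by (rule arg_cong[where f = "\<lambda>g. dirD X g x"]) (simp add: fun_eq_iff dirD_def)
  also have "\<dots> = (\<Sum>j\<in>UNIV. dirD X Y x $ j *\<^sub>R pd f j x + Y x $ j *\<^sub>R dirD X (pd f j) x)"
    using d by (subst dirD_sum) (auto simp: dirD_scaleR dirD_nth intro!: differentiable_scaleR)
  also have "\<dots> = (\<Sum>j\<in>UNIV. \<Sum>i\<in>UNIV. (X x $ i * Y x $ j) *\<^sub>R pd (pd f j) i x) + dirD (dirD X Y) f x"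
    by (simp add: sum.distrib dirD_def[of X "pd f _"] dirD_def[of "dirD X Y"] scaleR_sum_right mult.commute add.commute)
  also have "(\<Sum>j\<in>UNIV. \<Sum>i\<in>UNIV. (X x $ i * Y x $ j) *\<^sub>R pd (pd f j) i x) = (\<Sum>i\<in>UNIV. \<Sum>j\<in>UNIV. (X x $ i * Y x $ j) *\<^sub>R pd (pd f j) i x)"
    by (rule sum.swap)
  finally show ?thesis .
qed

text \<open>The second order terms cancel by the symmetry of mixed partials; what remains is the
  derivative along the Lie bracket, written through the flat derivatives of the fields.\<close>

lemma dirD_commute:
  fixes f :: "real^'n \<Rightarrow> real^'m"
  assumes "open U" "smooth_on U X" "smooth_on U Y" "smooth_on U f" "x \<in> U"
  shows "dirD X (dirD Y f) x - dirD Y (dirD X f) x = dirD (\<lambda>x. dirD X Y x - dirD Y X x) f x"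
proof -
  have "(\<Sum>i\<in>UNIV. \<Sum>j\<in>UNIV. (X x $ i * Y x $ j) *\<^sub>R pd (pd f j) i x)
      = (\<Sum>i\<in>UNIV. \<Sum>j\<in>UNIV. (Y x $ i * X x $ j) *\<^sub>R pd (pd f j) i x)"
    by (subst sum.swap) (simp add: mult.commute pd_commute[OF assms(1,4,5)])
  then show ?thesis
    unfolding dirD_dirD[OF assms(1,3,4,5)] dirD_dirD[OF assms(1,2,4,5)]
    by (simp add: dirD_def scaleR_diff_left sum_subtractf)
qed

lemma dirD_compose:
  fixes f :: "real^'m \<Rightarrow> 'b::real_normed_vector" and g :: "real^'n \<Rightarrow> real^'m"
  assumes "g differentiable (at x)" "f differentiable (at (g x))"
  shows "dirD X (\<lambda>x. f (g x)) x = (\<Sum>j\<in>UNIV. (dirD X g x $ j) *\<^sub>R pd f j (g x))"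
proof -
  have "dirD X (\<lambda>x. f (g x)) x = (\<Sum>i\<in>UNIV. \<Sum>j\<in>UNIV. (X x $ i * pd g i x $ j) *\<^sub>R pd f j (g x))"
    by (simp add: dirD_def pd_compose[OF assms] scaleR_sum_right)
  also have "\<dots> = (\<Sum>j\<in>UNIV. (dirD X g x $ j) *\<^sub>R pd f j (g x))"
    by (subst sum.swap) (simp add: dirD_def scaleR_sum_left)
  finally show ?thesis .
qed

lemma matrix_vector_mult_columns:
  "(\<chi> i j. c j $ i) *v u = (\<Sum>j\<in>UNIV. u $ j *\<^sub>R (c j :: real^'m))"
  by (simp add: vec_eq_iff matrix_vector_mult_def mult.commute)

lemma pd_local_inverse:
  fixes \<Psi> \<Phi> :: "real^'n \<Rightarrow> real^'n"
  assumes "open V" "y \<in> V" "\<And>y. y \<in> V \<Longrightarrow> \<Psi> (\<Phi> y) = y"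
    "\<Phi> differentiable (at y)" "\<Psi> differentiable (at (\<Phi> y))"
  shows "(\<chi> i j. pd \<Psi> j (\<Phi> y) $ i) *v pd \<Phi> k y = axis k 1"
proof -
  have "pd (\<lambda>y. \<Psi> (\<Phi> y)) k y = pd (\<lambda>y. y) k y"
    using assms(1-3) by (rule pd_cong)
  then show ?thesis
    by (simp add: pd_compose[OF assms(4,5)] matrix_vector_mult_columns pd_def[of "\<lambda>y. y"])
qed

text \<open>Bootstrapping: each \<open>pd \<Phi> k\<close> is a smooth function \<open>R k\<close>,
  a column of the inverse Jacobian, evaluated at \<open>\<Phi>\<close>. Hence differentiability of
  order \<open>n\<close> for \<open>\<Phi>\<close> gives order \<open>n + 1\<close>.\<close>

lemma smooth_on_local_inverse:
  fixes \<Psi> \<Phi> :: "real^'n \<Rightarrow> real^'n"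
  assumes "open U" "smooth_on U \<Psi>" "\<And>x. x \<in> U \<Longrightarrow> det (\<chi> i j. pd \<Psi> j x $ i) \<noteq> 0"
    and "open V" "\<Phi> ` V \<subseteq> U" "\<And>y. y \<in> V \<Longrightarrow> \<Psi> (\<Phi> y) = y" "\<Phi> differentiable_on V"
  shows "smooth_on V \<Phi>"
proof -
  define M where "M x = (\<chi> i j. pd \<Psi> j x $ i)" for x
  define R where "R k x = (\<chi> l. det (\<chi> i j. if j = l then axis k 1 $ i else M x $ i $ j) / det (M x))" for k x
  have M: "det (M x) \<noteq> 0" if "x \<in> U" for x
    using assms(3)[OF that] by (simp add: M_def)
  have R: "M x *v R k x = axis k 1" if "x \<in> U" for x k
    using cramer[OF M[OF that]] by (simp add: R_def)
  have sm: "smooth_on U (R k)" for k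
  proof (rule smooth_on_linear_system[OF assms(1) _ _ M R])
    show "smooth_on U (\<lambda>x. M x $ i $ j)" for i j
      unfolding M_def using smooth_on_nth[OF assms(1) smooth_on_pd[OF assms(2)]] by simp
  qed (auto intro: smooth_intros)
  have d: "\<Phi> differentiable (at y)" "\<Phi> y \<in> U" if "y \<in> V" for y
    using that assms(4,5,7) differentiable_on_eq_differentiable_at by blast+
  have pd\<Phi>: "pd \<Phi> k y = R k (\<Phi> y)" if y: "y \<in> V" for y k
  proof -
    have "M (\<Phi> y) *v pd \<Phi> k y = axis k 1"
      unfolding M_def using pd_local_inverse[OF assms(4) y assms(6) d(1)[OF y]]
        smooth_on_differentiable[OF assms(2,1) d(2)[OF y]] by simp
    then show ?thesis
      using cramer[OF M[OF d(2)[OF y]]] by (simp add: R_def)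
  qed
  have "diff_upto n V \<Phi>" for n
  proof (induction n)
    case (Suc n)
    have "diff_upto n U (R k)" for k
      using sm smooth_on_iff_diff_upto by blast
    then have "diff_upto n V (\<lambda>y. R k (\<Phi> y))" for k
      using diff_upto_compose[OF assms(4,1,5) Suc.IH] by blast
    then have "diff_upto n V (pd \<Phi> k)" for k
      by (rule diff_upto_cong[OF assms(4), rotated]) (simp add: pd\<Phi>)
    with assms(7) show ?case by simp
  qed simp
  then show ?thesis by (simp add: smooth_on_iff_diff_upto)
qed

theorem smooth_inverse_function_theorem:
  fixes \<Psi> :: "real^'n \<Rightarrow> real^'n"
  assumes "open U" "smooth_on U \<Psi>" "\<And>x. x \<in> U \<Longrightarrow> det (\<chi> i j. pd \<Psi> j x $ i) \<noteq> 0" "p \<in> U"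
  obtains U' V \<Phi> where "open U'" "p \<in> U'" "U' \<subseteq> U" "open V" "\<Psi> ` U' = V" "\<Phi> ` V = U'"
    "\<And>x. x \<in> U' \<Longrightarrow> \<Phi> (\<Psi> x) = x" "\<And>y. y \<in> V \<Longrightarrow> \<Psi> (\<Phi> y) = y" "smooth_on V \<Phi>"
proof -
  define M where "M x = (\<chi> i j. pd \<Psi> j x $ i)" for x
  define f' where "f' x = Blinfun ((*v) (M x))" for x
  have f': "blinfun_apply (f' x) = (*v) (M x)" for x
    unfolding f'_def by (simp add: bounded_linear_Blinfun_apply)
  have der: "(\<Psi> has_derivative blinfun_apply (f' x)) (at x)" if "x \<in> U" for x
    using has_derivative_pd[OF smooth_on_differentiable[OF assms(2,1) that]]
    unfolding f' M_def matrix_vector_mult_columns .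
  have cont: "continuous_on U f'"
  proof (rule continuous_on_blinfun_componentwise)
    fix u :: "real^'n"
    show "continuous_on U (\<lambda>x. blinfun_apply (f' x) u)"
      unfolding f' M_def matrix_vector_mult_columns
      using smooth_on_continuous_on[OF smooth_on_pd[OF assms(2)]] by (intro continuous_intros)
  qed
  obtain B where B: "B ** M p = mat 1"
    using assms(3,4) unfolding invertible_det_nz[symmetric] invertible_def M_def by blast
  have inv: "Blinfun ((*v) B) o\<^sub>L f' p = id_blinfun"
    by (rule blinfun_eqI) (simp add: f' bounded_linear_Blinfun_apply matrix_vector_mul_assoc B)
  obtain U' V \<Phi> g' where *: "open U'" "U' \<subseteq> U" "p \<in> U'" "open V" "\<Psi> p \<in> V" "homeomorphism U' V \<Psi> \<Phi>"
    "\<And>y. y \<in> V \<Longrightarrow> (\<Phi> has_derivative (g' y)) (at y)"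
    using inverse_function_theorem[OF assms(1) der cont assms(4) inv] by metis
  have "smooth_on V \<Phi>"
    using *(2,4,6,7) unfolding homeomorphism_def
    by (intro smooth_on_local_inverse[OF assms(1,2,3)])
       (auto simp: differentiable_on_eq_differentiable_at intro: differentiableI)
  with * show ?thesis
    unfolding homeomorphism_def by (intro that) auto
qed

section \<open>The structure equations of an equiaffine hypersurface\<close>

lemma frame_mat3_mult:
  "frame_mat3 \<phi> \<xi> x *v u = (u $ 1) *\<^sub>R pd \<phi> 1 x + (u $ 2) *\<^sub>R pd \<phi> 2 x + (u $ 3) *\<^sub>R pd \<phi> 3 x + (u $ 4) *\<^sub>R \<xi> x"
  by (simp add: vec_eq_iff frame_mat3_def matrix_vector_mult_def sum_4 mult.commute)

lemma det_nz_iff_kernel: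
  fixes A :: "real^'n^'n"
  shows "det A \<noteq> 0 \<longleftrightarrow> (\<forall>u. A *v u = 0 \<longrightarrow> u = 0)"
  unfolding invertible_det_nz[symmetric] invertible_left_inverse matrix_left_invertible_ker by blast

lemma bij_matrix_unique:
  fixes A :: "real^'n^'n"
  assumes "det A \<noteq> 0" "A *v u = A *v v" shows "u = v"
proof -
  have "A *v (u - v) = 0" using assms(2) by (simp add: matrix_vector_mult_diff_distrib)
  with assms(1) show ?thesis unfolding det_nz_iff_kernel by (metis right_minus_eq)
qed

text \<open>Multiplication by \<open>h x\<close> undoes the \<open>matrix_inv\<close> in the
  definition; the right side is the Christoffel symbol of the first kind.\<close>

lemma lc_christoffel_metric:
  assumes "det (h x) \<noteq> 0"
  shows "(h x *v lc_christoffel h x i j) $ l =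
    (pd (\<lambda>y. h y $ j $ l) i x + pd (\<lambda>y. h y $ i $ l) j x - pd (\<lambda>y. h y $ i $ j) l x) / 2"
proof -
  define c :: "real^3" where "c = (\<chi> l. (pd (\<lambda>y. h y $ j $ l) i x + pd (\<lambda>y. h y $ i $ l) j x - pd (\<lambda>y. h y $ i $ j) l x) / 2)"
  have "invertible (h x)" using assms invertible_det_nz by blast
  then have "h x ** matrix_inv (h x) = mat 1"
    unfolding invertible_def matrix_inv_def by (metis (mono_tags, lifting) someI_ex)
  moreover have "lc_christoffel h x i j = matrix_inv (h x) *v c"
    by (simp add: lc_christoffel_def c_def matrix_vector_mult_def vec_eq_iff sum_distrib_left)
  ultimately have "h x *v lc_christoffel h x i j = c"
    by (simp add: matrix_vector_mul_assoc)
  then show ?thesis by (simp add: c_def)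
qed

lemma hmet_add_left: "hmet h x (u + v) w = hmet h x u w + hmet h x v w"
  by (simp add: hmet_def inner_add_left)

lemma hmet_add_right: "hmet h x w (u + v) = hmet h x w u + hmet h x w v"
  by (simp add: hmet_def matrix_vector_right_distrib inner_add_right)

lemma hmet_scaleR_left: "hmet h x (c *\<^sub>R u) w = c * hmet h x u w"
  by (simp add: hmet_def)

lemma hmet_diff_left: "hmet h x (u - v) w = hmet h x u w - hmet h x v w"
  by (simp add: hmet_def inner_diff_left)

lemma hmet_minus_left: "hmet h x (- u) w = - hmet h x u w"
  by (simp add: hmet_def)

lemma hmet_sum_left: "hmet h x (\<Sum>a\<in>A. f a) w = (\<Sum>a\<in>A. hmet h x (f a) w)"
  by (simp add: hmet_def inner_sum_left)

lemma sum_scaleR_frame: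
  "(\<Sum>m\<in>A. b m *\<^sub>R ((\<Sum>l\<in>B. W m l *\<^sub>R F l) + t m *\<^sub>R z))
    = (\<Sum>l\<in>B. (\<Sum>m\<in>A. b m * W m l) *\<^sub>R F l) + (\<Sum>m\<in>A. b m * t m) *\<^sub>R (z :: 'a::real_vector)"
proof -
  have "(\<Sum>m\<in>A. \<Sum>l\<in>B. (b m * W m l) *\<^sub>R F l) = (\<Sum>l\<in>B. (\<Sum>m\<in>A. b m * W m l) *\<^sub>R F l)"
    by (subst sum.swap) (simp add: scaleR_sum_left)
  then show ?thesis
    by (simp add: scaleR_add_right sum.distrib scaleR_sum_right scaleR_sum_left)
qed

lemma sum_scaleR_frame_diff:
  assumes "(\<Sum>l\<in>A. a l *\<^sub>R F l) + a0 *\<^sub>R z - ((\<Sum>l\<in>A. b l *\<^sub>R F l) + b0 *\<^sub>R z)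
    = (\<Sum>l\<in>A. c l *\<^sub>R F l) + c0 *\<^sub>R (z :: 'a::real_vector)"
  shows "(\<Sum>l\<in>A. (a l - b l - c l) *\<^sub>R F l) + (a0 - b0 - c0) *\<^sub>R z = 0"
  using assms by (simp add: scaleR_diff_left sum_subtractf sum.distrib algebra_simps)

locale equiaffine =
  fixes U :: "(real^3) set" and \<phi> \<xi> :: "real^3 \<Rightarrow> real^4"
    and h :: "real^3 \<Rightarrow> real^3^3" and \<Gamma> :: "real^3 \<Rightarrow> 3 \<Rightarrow> 3 \<Rightarrow> real^3"
  assumes bl: "blaschke3 U \<phi> \<xi> h \<Gamma>"
begin

lemma U: "open U"
  and smooth_\<phi>: "smooth_on U \<phi>" and smooth_\<xi>: "smooth_on U \<xi>"
  and frame_det: "x \<in> U \<Longrightarrow> det (frame_mat3 \<phi> \<xi> x) \<noteq> 0"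
  and gauss_formula: "x \<in> U \<Longrightarrow>
    pd (pd \<phi> j) i x = (\<Sum>k\<in>UNIV. (\<Gamma> x i j $ k) *\<^sub>R pd \<phi> k x) + (h x $ i $ j) *\<^sub>R \<xi> x"
  and h_det: "x \<in> U \<Longrightarrow> det (h x) \<noteq> 0"
  using bl unfolding blaschke3_def by blast+

lemma coordinate_frame_independent:
  assumes "x \<in> U" "(\<Sum>k\<in>UNIV. (u $ k) *\<^sub>R pd \<phi> k x) + d *\<^sub>R \<xi> x = (\<Sum>k\<in>UNIV. (v $ k) *\<^sub>R pd \<phi> k x) + e *\<^sub>R \<xi> x"
  shows "u = v \<and> d = e"
proof -
  define s where "s u d = (\<chi> i. if i = 1 then u $ 1 else if i = 2 then u $ 2 else if i = 3 then u $ 3 else d :: real^4)"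
    for u :: "real^3" and d :: real
  have "frame_mat3 \<phi> \<xi> x *v s u d = frame_mat3 \<phi> \<xi> x *v s v e"
    using assms(2) by (simp add: frame_mat3_mult s_def sum_3)
  then have "s u d = s v e"
    using bij_matrix_unique[OF frame_det[OF assms(1)]] by blast
  then show ?thesis
    by (auto simp: s_def vec_eq_iff forall_3 forall_4)
qed

text \<open>Second partials of \<open>\<phi>\<close> commute, and the Gauss formula can be compared
  coefficient by coefficient.\<close>

lemma h_sym: "x \<in> U \<Longrightarrow> h x $ i $ j = h x $ j $ i"
  and \<Gamma>_sym: "x \<in> U \<Longrightarrow> \<Gamma> x i j = \<Gamma> x j i"
  using coordinate_frame_independent[of x "\<Gamma> x i j" "h x $ i $ j" "\<Gamma> x j i" "h x $ j $ i"]
    pd_commute[OF U smooth_\<phi>, of x i j] gauss_formula[of x i j] gauss_formula[of x j i] by auto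

text \<open>The Gauss formula is a linear system with matrix \<open>frame_mat3\<close>; the entry of
  \<open>h\<close> is the fourth component of its solution.\<close>

lemma h_smooth: "smooth_on U (\<lambda>x. h x $ i $ j)"
proof -
  define c where "c x = (\<chi> m. if m = 1 then \<Gamma> x i j $ 1 else if m = 2 then \<Gamma> x i j $ 2
      else if m = 3 then \<Gamma> x i j $ 3 else h x $ i $ j :: real^4)" for x
  have "smooth_on U c"
  proof (rule smooth_on_linear_system[OF U])
    show "smooth_on U (\<lambda>x. frame_mat3 \<phi> \<xi> x $ r $ m)" for r m
    proof -
      consider "m = 1" | "m = 2" | "m = 3" | "m = 4"
        using exhaust_4 by blast
      then show ?thesis
        by cases (simp_all add: frame_mat3_def smooth_on_nth[OF U] smooth_on_pd smooth_\<phi> smooth_\<xi>)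
    qed
    show "smooth_on U (\<lambda>x. pd (pd \<phi> j) i x $ r)" for r
      by (intro smooth_on_nth[OF U] smooth_on_pd smooth_\<phi>)
    show "frame_mat3 \<phi> \<xi> x *v c x = pd (pd \<phi> j) i x" if "x \<in> U" for x
      using that by (simp add: frame_mat3_mult c_def gauss_formula sum_3)
  qed (rule frame_det)
  then have "smooth_on U (\<lambda>x. c x $ 4)" by (rule smooth_on_nth[OF U])
  then show ?thesis by (simp add: c_def)
qed

lemma hmet_sym: "x \<in> U \<Longrightarrow> hmet h x u v = hmet h x v u"
  using h_sym[of x] by (simp add: hmet_def inner_vec_def matrix_vector_mult_def sum_3 algebra_simps)

text \<open>Metric compatibility in coordinates: of the six derivative terms of the two lowered
  Christoffel symbols, four cancel by the symmetry of \<open>h\<close>.\<close>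

lemma pd_h:
  assumes "x \<in> U"
  shows "pd (\<lambda>y. h y $ j $ l) i x = (h x *v lc_christoffel h x i j) $ l + (h x *v lc_christoffel h x i l) $ j"
proof -
  have "pd (\<lambda>y. h y $ a $ b) i x = pd (\<lambda>y. h y $ b $ a) i x" for a b i
    by (rule pd_cong[OF U assms]) (rule h_sym)
  from this[of j l i] this[of l i j] this[of l j i] this[of i j l] this[of i l j] show ?thesis
    unfolding lc_christoffel_metric[of h x, OF h_det[OF assms]] by (simp add: field_simps)
qed

lemma lc_sym:
  assumes "x \<in> U" shows "lc_christoffel h x i j = lc_christoffel h x j i"
proof -
  have "pd (\<lambda>y. h y $ i $ j) l x = pd (\<lambda>y. h y $ j $ i) l x" for l
    by (rule pd_cong[OF U assms]) (rule h_sym)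
  then show ?thesis by (simp add: lc_christoffel_def add.commute)
qed

lemma lc_cov_torsion_free:
  assumes "x \<in> U"
  shows "lc_cov h X Y x - lc_cov h Y X x = dirD X Y x - dirD Y X x"
proof -
  have "(\<Sum>i\<in>UNIV. \<Sum>j\<in>UNIV. (X x $ i * Y x $ j) *\<^sub>R lc_christoffel h x i j)
     = (\<Sum>i\<in>UNIV. \<Sum>j\<in>UNIV. (Y x $ i * X x $ j) *\<^sub>R lc_christoffel h x i j)"
    by (subst sum.swap) (simp add: lc_sym[OF assms] mult.commute)
  then show ?thesis by (simp add: lc_cov_def dirD_def)
qed

lemma Kbil_sym:
  assumes "x \<in> U"
  shows "Kbil h \<Gamma> x u v = Kbil h \<Gamma> x v u"
  unfolding Kbil_def
  by (subst sum.swap) (simp add: Kcomp_def lc_sym[OF assms] \<Gamma>_sym[OF assms] mult.commute)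

lemma lc_cov_metric:
  assumes "x \<in> U" "smooth_on U Y" "smooth_on U Z"
  shows "dirD X (\<lambda>x. hmet h x (Y x) (Z x)) x = hmet h x (lc_cov h X Y x) (Z x) + hmet h x (Y x) (lc_cov h X Z x)"
proof -
  have dY: "(\<lambda>x. Y x $ j) differentiable (at x)" and dZ: "(\<lambda>x. Z x $ j) differentiable (at x)"
    and dh: "(\<lambda>x. h x $ j $ l) differentiable (at x)" and Y: "Y differentiable (at x)" and Z: "Z differentiable (at x)" for j l
    using assms smooth_on_differentiable[OF _ U] smooth_on_nth[OF U] h_smooth by blast+
  define P where "P i j l = (h x *v lc_christoffel h x i j) $ l" for i j l
  have Dh: "dirD X (\<lambda>x. h x $ j $ l) x = (\<Sum>i\<in>UNIV. X x $ i * (P i j l + P i l j))" for j l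
    by (simp add: dirD_def pd_h[OF assms(1)] P_def)
  have eq: "hmet h x (Y x) (Z x) = (\<Sum>j\<in>UNIV. \<Sum>l\<in>UNIV. Y x $ j * (h x $ j $ l * Z x $ l))" for x
    by (simp add: hmet_def inner_vec_def matrix_vector_mult_def sum_distrib_left)
  have "dirD X (\<lambda>x. hmet h x (Y x) (Z x)) x
      = (\<Sum>j\<in>UNIV. \<Sum>l\<in>UNIV. dirD X Y x $ j * (h x $ j $ l * Z x $ l)
          + Y x $ j * (dirD X (\<lambda>x. h x $ j $ l) x * Z x $ l + h x $ j $ l * dirD X Z x $ l))"
    unfolding eq
    by (simp add: dirD_sum dirD_mult dY dZ dh dirD_nth Y Z)
  also have "\<dots> = hmet h x (dirD X Y x) (Z x) + hmet h x (Y x) (dirD X Z x)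
      + (\<Sum>j\<in>UNIV. \<Sum>l\<in>UNIV. Y x $ j * (dirD X (\<lambda>x. h x $ j $ l) x * Z x $ l))"
    by (simp add: hmet_def inner_vec_def matrix_vector_mult_def sum_distrib_left sum.distrib algebra_simps)
  also have "(\<Sum>j\<in>UNIV. \<Sum>l\<in>UNIV. Y x $ j * (dirD X (\<lambda>x. h x $ j $ l) x * Z x $ l))
      = (\<Sum>i\<in>UNIV. \<Sum>j\<in>UNIV. X x $ i * Y x $ j * (\<Sum>l\<in>UNIV. P i j l * Z x $ l))
      + (\<Sum>i\<in>UNIV. \<Sum>l\<in>UNIV. X x $ i * Z x $ l * (\<Sum>j\<in>UNIV. P i l j * Y x $ j))"
    unfolding Dh by (simp add: sum_3 algebra_simps)
  also have "(\<Sum>i\<in>UNIV. \<Sum>j\<in>UNIV. X x $ i * Y x $ j * (\<Sum>l\<in>UNIV. P i j l * Z x $ l))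
      = hmet h x (\<Sum>i\<in>UNIV. \<Sum>j\<in>UNIV. (X x $ i * Y x $ j) *\<^sub>R lc_christoffel h x i j) (Z x)"
    unfolding hmet_sum_left hmet_scaleR_left
    using hmet_sym[OF assms(1), of _ "Z x"]
    by (simp add: hmet_def inner_vec_def P_def mult.commute)
  also have "(\<Sum>i\<in>UNIV. \<Sum>l\<in>UNIV. X x $ i * Z x $ l * (\<Sum>j\<in>UNIV. P i l j * Y x $ j))
      = hmet h x (Y x) (\<Sum>i\<in>UNIV. \<Sum>j\<in>UNIV. (X x $ i * Z x $ j) *\<^sub>R lc_christoffel h x i j)"
    unfolding hmet_sym[OF assms(1), of "Y x"] hmet_sum_left hmet_scaleR_left
    using hmet_sym[OF assms(1), of _ "Y x"]
    by (simp add: hmet_def inner_vec_def P_def mult.commute)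
  finally show ?thesis
    by (simp add: lc_cov_def dirD_def[of X Y] dirD_def[of X Z] hmet_add_left hmet_add_right)
qed

text \<open>The Gauss formula for vector fields. Since \<open>Kcomp\<close> is
  \<open>\<Gamma>\<close> minus the Levi-Civita symbols, adding \<open>Kbil\<close> to
  \<open>lc_cov\<close> gives the induced connection.\<close>

lemma dirD_dirD_\<phi>:
  assumes "x \<in> U" "smooth_on U Y"
  shows "dirD X (dirD Y \<phi>) x
    = dirD (\<lambda>x. lc_cov h X Y x + Kbil h \<Gamma> x (X x) (Y x)) \<phi> x + hmet h x (X x) (Y x) *\<^sub>R \<xi> x"
proof -
  let ?S = "\<lambda>g. \<Sum>i\<in>UNIV. \<Sum>j\<in>UNIV. (X x $ i * Y x $ j) *\<^sub>R g i j"
  have "(\<Sum>i\<in>UNIV. \<Sum>j\<in>UNIV. (X x $ i * Y x $ j) *\<^sub>R pd (pd \<phi> j) i x)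
    = ?S (\<lambda>i j. \<Sum>k\<in>UNIV. (\<Gamma> x i j $ k) *\<^sub>R pd \<phi> k x) + hmet h x (X x) (Y x) *\<^sub>R \<xi> x"
    by (simp add: gauss_formula[OF assms(1)] scaleR_add_right sum.distrib hmet_def inner_vec_def
        matrix_vector_mult_def sum_distrib_left scaleR_sum_left mult_ac)
  moreover have "?S (\<lambda>i j. \<Sum>k\<in>UNIV. (\<Gamma> x i j $ k) *\<^sub>R pd \<phi> k x) = (\<Sum>k\<in>UNIV. (?S (\<Gamma> x) $ k) *\<^sub>R pd \<phi> k x)"
    by (simp add: sum_3 algebra_simps)
  moreover have "dirD (\<lambda>x. lc_cov h X Y x + Kbil h \<Gamma> x (X x) (Y x)) \<phi> x
      = (\<Sum>k\<in>UNIV. (?S (\<Gamma> x) $ k) *\<^sub>R pd \<phi> k x) + dirD (dirD X Y) \<phi> x"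
  proof -
    have "lc_cov h X Y x + Kbil h \<Gamma> x (X x) (Y x) = ?S (\<Gamma> x) + dirD X Y x"
      by (simp add: lc_cov_def dirD_def Kbil_def Kcomp_def scaleR_diff_right sum_subtractf)
    then show ?thesis
      by (simp only: dirD_def[of "\<lambda>x. lc_cov h X Y x + Kbil h \<Gamma> x (X x) (Y x)"] dirD_def[of "dirD X Y"]
          vector_add_component scaleR_add_left sum.distrib)
  qed
  ultimately show ?thesis
    using dirD_dirD[OF U assms(2) smooth_\<phi> assms(1), of X] by simp
qed

end

section \<open>Orthonormal moving frames and their integrability conditions\<close>

locale orthonormal_frame = equiaffine +
  fixes e :: "3 \<Rightarrow> real^3 \<Rightarrow> real^3" and s :: "3 \<Rightarrow> real" and H :: real
  assumes e_smooth: "smooth_on U (e i)"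
    and s_cases: "s i = 1 \<or> s i = -1"
    and ortho: "x \<in> U \<Longrightarrow> hmet h x (e i x) (e j x) = (if i = j then s i else 0)"
    and d\<xi>: "x \<in> U \<Longrightarrow> pd \<xi> i x = - H *\<^sub>R pd \<phi> i x"
begin

definition E :: "3 \<Rightarrow> real^3 \<Rightarrow> real^4" where "E i = dirD (e i) \<phi>"

text \<open>Levi-Civita connection coefficients with lowered last index, so that metric
  compatibility becomes antisymmetry in \<open>j\<close> and \<open>k\<close>.\<close>

definition L :: "3 \<Rightarrow> 3 \<Rightarrow> 3 \<Rightarrow> real^3 \<Rightarrow> real" where
  "L i j k x = hmet h x (lc_cov h (e i) (e j) x) (e k x)"

text \<open>Frame components of the induced connection, Levi-Civita part plus difference tensor;
  \<open>s k\<close> raises the last index.\<close>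

definition w :: "3 \<Rightarrow> 3 \<Rightarrow> 3 \<Rightarrow> real^3 \<Rightarrow> real" where
  "w i j k x = s k * (L i j k x + hmet h x (Kbil h \<Gamma> x (e i x) (e j x)) (e k x))"

abbreviation \<epsilon> :: "3 \<Rightarrow> 3 \<Rightarrow> real" where "\<epsilon> i j \<equiv> (if i = j then s i else 0)"

lemma s_mult_self [simp]: "s i * s i = 1" "s i * (s i * c) = c"
  using s_cases[of i] by auto

lemma frame_coefficient:
  assumes "x \<in> U" "u = (\<Sum>k\<in>UNIV. c k *\<^sub>R e k x)"
  shows "hmet h x u (e j x) = s j * c j"
proof -
  have "hmet h x u (e j x) = (\<Sum>k\<in>UNIV. if k = j then s j * c j else 0)"
    unfolding assms(2) hmet_sum_left hmet_scaleR_left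
    by (rule sum.cong) (auto simp: ortho[OF assms(1)])
  then show ?thesis by simp
qed

text \<open>Pairing a vanishing combination with \<open>e j\<close> kills its coefficients, so the
  frame is a basis. The same pairing reads off the coefficients, each sign \<open>s k\<close> being
  its own inverse.\<close>

lemma frame_expand:
  assumes "x \<in> U"
  shows "u = (\<Sum>k\<in>UNIV. (s k * hmet h x u (e k x)) *\<^sub>R e k x)"
proof -
  define F :: "real^3^3" where "F = (\<chi> i j. e j x $ i)"
  have F: "F *v c = (\<Sum>k\<in>UNIV. c $ k *\<^sub>R e k x)" for c
    unfolding F_def by (rule matrix_vector_mult_columns)
  have "det F \<noteq> 0"
    unfolding det_nz_iff_kernel
  proof (intro allI impI)
    fix c assume "F *v c = 0"
    then have "s j * c $ j = 0" for j
      using frame_coefficient[OF assms F, of c] by (simp add: hmet_def)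
    then show "c = 0"
      using s_cases by (metis mult_eq_0_iff one_neq_neg_one vec_eq_iff zero_index zero_neq_neg_one zero_neq_one)
  qed
  then obtain c where c: "F *v c = u"
    using cramer by blast
  have "s j * hmet h x u (e j x) = c $ j" for j
    using frame_coefficient[OF assms F, of c j] unfolding c by simp
  then show ?thesis using c F by simp
qed

lemma E_combination: "(\<Sum>k\<in>UNIV. c k *\<^sub>R E k x) = dirD (\<lambda>x. \<Sum>k\<in>UNIV. c k *\<^sub>R e k x) \<phi> x"
  unfolding E_def by (rule dirD_direction_combination[symmetric])

lemma E_independent:
  assumes "x \<in> U" "(\<Sum>k\<in>UNIV. c k *\<^sub>R E k x) + d *\<^sub>R \<xi> x = 0"
  shows "c k = 0" "d = 0"
proof -
  have "(\<Sum>k\<in>UNIV. ((\<Sum>k\<in>UNIV. c k *\<^sub>R e k x) $ k) *\<^sub>R pd \<phi> k x) + d *\<^sub>R \<xi> x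
      = (\<Sum>k\<in>UNIV. (0 $ k) *\<^sub>R pd \<phi> k x) + 0 *\<^sub>R \<xi> x"
    using assms(2) unfolding E_combination dirD_def by simp
  then have *: "(\<Sum>k\<in>UNIV. c k *\<^sub>R e k x) = 0 \<and> d = 0"
    by (rule coordinate_frame_independent[OF assms(1)])
  then show "d = 0" by blast
  have "s k * c k = 0"
    using frame_coefficient[OF assms(1) refl, of c k] * by (simp add: hmet_def)
  then show "c k = 0" using s_cases[of k] by auto
qed

lemma structure_equation:
  assumes "x \<in> U"
  shows "dirD (e i) (E j) x = (\<Sum>k\<in>UNIV. w i j k x *\<^sub>R E k x) + \<epsilon> i j *\<^sub>R \<xi> x"
proof -
  have "dirD (e i) (E j) x = dirD (\<lambda>x. lc_cov h (e i) (e j) x + Kbil h \<Gamma> x (e i x) (e j x)) \<phi> x + \<epsilon> i j *\<^sub>R \<xi> x"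
    unfolding E_def by (subst dirD_dirD_\<phi>[OF assms e_smooth]) (simp only: ortho[OF assms])
  also have "dirD (\<lambda>x. lc_cov h (e i) (e j) x + Kbil h \<Gamma> x (e i x) (e j x)) \<phi> x
      = dirD (\<lambda>y. \<Sum>k\<in>UNIV. w i j k x *\<^sub>R e k y) \<phi> x"
    by (rule dirD_direction_cong, subst frame_expand[OF assms])
      (simp add: w_def L_def hmet_add_left)
  finally show ?thesis
    unfolding E_combination .
qed

lemma L_antisym:
  assumes "x \<in> U" shows "L i j k x = - L i k j x"
proof -
  have "dirD (e i) (\<lambda>x. hmet h x (e j x) (e k x)) x = dirD (e i) (\<lambda>x. \<epsilon> j k) x"
    by (rule dirD_cong[OF U assms]) (simp add: ortho)
  then show ?thesis
    using lc_cov_metric[OF assms e_smooth e_smooth, of "e i" j k] hmet_sym[OF assms]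
    by (simp add: L_def)
qed

text \<open>The Levi-Civita connection is torsion free, and the symmetric tensor \<open>K\<close>
  cancels in \<open>w i j k - w j i k\<close>, so the induced coefficients describe the bracket as
  well.\<close>

lemma bracket:
  assumes "x \<in> U"
  shows "dirD (e i) (e j) x - dirD (e j) (e i) x = (\<Sum>k\<in>UNIV. (w i j k x - w j i k x) *\<^sub>R e k x)"
proof -
  have "dirD (e i) (e j) x - dirD (e j) (e i) x = lc_cov h (e i) (e j) x - lc_cov h (e j) (e i) x"
    using lc_cov_torsion_free[OF assms] by simp
  also have "\<dots> = (\<Sum>k\<in>UNIV. (s k * hmet h x (lc_cov h (e i) (e j) x - lc_cov h (e j) (e i) x) (e k x)) *\<^sub>R e k x)"
    by (rule frame_expand[OF assms])
  also have "\<dots> = (\<Sum>k\<in>UNIV. (w i j k x - w j i k x) *\<^sub>R e k x)"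
    using Kbil_sym[OF assms, of "e i x" "e j x"]
    by (simp add: w_def L_def hmet_diff_left algebra_simps)
  finally show ?thesis .
qed

lemma E_smooth: "smooth_on U (E i)"
  unfolding E_def by (rule smooth_on_dirD[OF U e_smooth smooth_\<phi>])

text \<open>The structure equation, read as a linear system for its coefficients, has an invertible
  matrix because the fields \<open>E k\<close> and \<open>\<xi>\<close> are independent.\<close>

lemma w_smooth: "smooth_on U (w i j k)"
proof -
  define M where "M x = (\<chi> r c. if c = 1 then E 1 x $ r else if c = 2 then E 2 x $ r
      else if c = 3 then E 3 x $ r else \<xi> x $ r :: real^4^4)" for x
  define c where "c x = (\<chi> m. if m = 1 then w i j 1 x else if m = 2 then w i j 2 x
      else if m = 3 then w i j 3 x else \<epsilon> i j :: real^4)" for x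
  have M: "M x *v u = (u $ 1) *\<^sub>R E 1 x + (u $ 2) *\<^sub>R E 2 x + (u $ 3) *\<^sub>R E 3 x + (u $ 4) *\<^sub>R \<xi> x" for x u
    by (simp add: vec_eq_iff M_def matrix_vector_mult_def sum_4 mult.commute)
  have "smooth_on U c"
  proof (rule smooth_on_linear_system[OF U])
    show "smooth_on U (\<lambda>x. M x $ r $ m)" for r m
    proof -
      consider "m = 1" | "m = 2" | "m = 3" | "m = 4"
        using exhaust_4 by blast
      then show ?thesis
        by cases (simp_all add: M_def smooth_on_nth[OF U] E_smooth smooth_\<xi>)
    qed
    show "smooth_on U (\<lambda>x. dirD (e i) (E j) x $ r)" for r
      by (intro smooth_on_nth[OF U] smooth_on_dirD[OF U] E_smooth e_smooth)
    show "M x *v c x = dirD (e i) (E j) x" if "x \<in> U" for x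
      unfolding M structure_equation[OF that] by (simp add: c_def sum_3)
    show "det (M x) \<noteq> 0" if "x \<in> U" for x
      unfolding det_nz_iff_kernel M
    proof (intro allI impI)
      fix u :: "real^4"
      assume "(u $ 1) *\<^sub>R E 1 x + (u $ 2) *\<^sub>R E 2 x + (u $ 3) *\<^sub>R E 3 x + (u $ 4) *\<^sub>R \<xi> x = 0"
      then have "(\<Sum>k\<in>UNIV. (if k = 1 then u $ 1 else if k = 2 then u $ 2 else u $ 3) *\<^sub>R E k x) + u $ 4 *\<^sub>R \<xi> x = 0"
        by (simp add: sum_3)
      from E_independent(1)[OF that this, of 1] E_independent(1)[OF that this, of 2]
        E_independent(1)[OF that this, of 3] E_independent(2)[OF that this]
      show "u = 0" by (simp add: vec_eq_iff forall_4)
    qed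
  qed
  then have "smooth_on U (\<lambda>x. c x $ 1)" "smooth_on U (\<lambda>x. c x $ 2)" "smooth_on U (\<lambda>x. c x $ 3)"
    by (auto intro: smooth_on_nth[OF U])
  moreover have "k = 1 \<or> k = 2 \<or> k = 3" by (rule exhaust_3)
  ultimately show ?thesis
    by (auto simp: c_def)
qed

lemma dirD_\<xi>: "x \<in> U \<Longrightarrow> dirD (e i) \<xi> x = - H *\<^sub>R E i x"
  by (simp add: dirD_def E_def d\<xi> scaleR_sum_right sum_negf mult.commute)

lemma second_derivative_E:
  assumes "x \<in> U"
  shows "dirD (e i) (dirD (e j) (E k)) x =
    (\<Sum>l\<in>UNIV. (dirD (e i) (w j k l) x + (\<Sum>m\<in>UNIV. w j k m x * w i m l x) - H * (if i = l then \<epsilon> j k else 0)) *\<^sub>R E l x)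
    + (\<Sum>m\<in>UNIV. w j k m x * \<epsilon> i m) *\<^sub>R \<xi> x"
proof -
  have d: "E m differentiable (at x)" "w j k m differentiable (at x)" "\<xi> differentiable (at x)" for m
    by (auto intro: smooth_on_differentiable[OF _ U assms] E_smooth w_smooth smooth_\<xi>)
  have "dirD (e i) (dirD (e j) (E k)) x
      = dirD (e i) (\<lambda>x. (\<Sum>m\<in>UNIV. w j k m x *\<^sub>R E m x) + \<epsilon> j k *\<^sub>R \<xi> x) x"
    by (rule dirD_cong[OF U assms]) (rule structure_equation)
  also have "\<dots> = (\<Sum>m\<in>UNIV. dirD (e i) (w j k m) x *\<^sub>R E m x + w j k m x *\<^sub>R dirD (e i) (E m) x) + \<epsilon> j k *\<^sub>R dirD (e i) \<xi> x"
    using d by (simp add: dirD_add dirD_sum dirD_scaleR)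
  also have "\<dots> = (\<Sum>l\<in>UNIV. (dirD (e i) (w j k l) x + (\<Sum>m\<in>UNIV. w j k m x * w i m l x)) *\<^sub>R E l x)
      + (\<Sum>m\<in>UNIV. w j k m x * \<epsilon> i m) *\<^sub>R \<xi> x - (H * \<epsilon> j k) *\<^sub>R E i x"
    unfolding structure_equation[OF assms] dirD_\<xi>[OF assms] sum.distrib sum_scaleR_frame
    by (simp add: sum.distrib scaleR_add_left mult.commute)
  also have "(H * \<epsilon> j k) *\<^sub>R E i x = (\<Sum>l\<in>UNIV. (H * (if i = l then \<epsilon> j k else 0)) *\<^sub>R E l x)"
    by (simp add: if_distrib[of "\<lambda>c. H * c"] if_distrib[of "\<lambda>c. c *\<^sub>R _"] cong: if_cong)
  finally show ?thesis
    by (simp add: scaleR_diff_left sum_subtractf)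
qed

text \<open>The commutator of \<open>e i\<close> and \<open>e j\<close> on \<open>E k\<close> is
  computed from second derivatives and again along the bracket; the coefficients of
  \<open>E l\<close> are compared. \<open>H\<close> enters through the derivative of
  \<open>\<xi>\<close>, the shape operator being \<open>H\<close> times the identity.\<close>

theorem gauss_codazzi:
  assumes "x \<in> U"
  shows "dirD (e i) (w j k l) x - dirD (e j) (w i k l) x
    + (\<Sum>m\<in>UNIV. w j k m x * w i m l x - w i k m x * w j m l x)
    - H * ((if i = l then \<epsilon> j k else 0) - (if j = l then \<epsilon> i k else 0))
    - (\<Sum>m\<in>UNIV. (w i j m x - w j i m x) * w m k l x) = 0"
proof -
  let ?G = "\<lambda>i j l. dirD (e i) (w j k l) x + (\<Sum>m\<in>UNIV. w j k m x * w i m l x) - H * (if i = l then \<epsilon> j k else 0)"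
  let ?g = "\<lambda>i j. \<Sum>m\<in>UNIV. w j k m x * \<epsilon> i m"
  let ?B = "\<lambda>l. \<Sum>m\<in>UNIV. (w i j m x - w j i m x) * w m k l x"
  let ?b = "\<Sum>m\<in>UNIV. (w i j m x - w j i m x) * \<epsilon> m k"
  have "dirD (e i) (dirD (e j) (E k)) x - dirD (e j) (dirD (e i) (E k)) x
      = dirD (\<lambda>x. dirD (e i) (e j) x - dirD (e j) (e i) x) (E k) x"
    by (rule dirD_commute[OF U e_smooth e_smooth E_smooth assms])
  also have "\<dots> = dirD (\<lambda>y. \<Sum>m\<in>UNIV. (w i j m x - w j i m x) *\<^sub>R e m y) (E k) x"
    by (rule dirD_direction_cong) (rule bracket[OF assms])
  also have "\<dots> = (\<Sum>m\<in>UNIV. (w i j m x - w j i m x) *\<^sub>R dirD (e m) (E k) x)"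
    by (rule dirD_direction_combination)
  also have "\<dots> = (\<Sum>l\<in>UNIV. ?B l *\<^sub>R E l x) + ?b *\<^sub>R \<xi> x"
    unfolding structure_equation[OF assms] sum_scaleR_frame ..
  finally have "(\<Sum>l\<in>UNIV. (?G i j l - ?G j i l - ?B l) *\<^sub>R E l x) + (?g i j - ?g j i - ?b) *\<^sub>R \<xi> x = 0"
    unfolding second_derivative_E[OF assms] by (rule sum_scaleR_frame_diff)
  from E_independent(1)[OF assms this, of l] show ?thesis
    by (simp add: sum_subtractf right_diff_distrib)
qed

end

section \<open>The Gauss and Codazzi equations in the symmetric case\<close>

text \<open>The frame is ordered as T, V, W, with T timelike; \<open>a\<close> and \<open>b\<close>
  stand for a_4 and a_6.\<close>

locale symmetric_hypersphere = orthonormal_frame +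
  fixes a b :: "real^3 \<Rightarrow> real"
  assumes s_eq: "s 1 = -1" "s 2 = 1" "s 3 = 1"
    and K_eq: "x \<in> U \<Longrightarrow> Kbil h \<Gamma> x (e 1 x) (e 1 x) = (-2 * a x) *\<^sub>R e 1 x"
      "x \<in> U \<Longrightarrow> Kbil h \<Gamma> x (e 1 x) (e 2 x) = a x *\<^sub>R e 2 x"
      "x \<in> U \<Longrightarrow> Kbil h \<Gamma> x (e 1 x) (e 3 x) = a x *\<^sub>R e 3 x"
      "x \<in> U \<Longrightarrow> Kbil h \<Gamma> x (e 2 x) (e 2 x) = (- a x) *\<^sub>R e 1 x + b x *\<^sub>R e 2 x"
      "x \<in> U \<Longrightarrow> Kbil h \<Gamma> x (e 2 x) (e 3 x) = (- b x) *\<^sub>R e 3 x"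
      "x \<in> U \<Longrightarrow> Kbil h \<Gamma> x (e 3 x) (e 3 x) = (- a x) *\<^sub>R e 1 x - b x *\<^sub>R e 2 x"
    and a_pos: "x \<in> U \<Longrightarrow> a x > 0" and b_nonneg: "x \<in> U \<Longrightarrow> b x \<ge> 0"
    and H_eq: "x \<in> U \<Longrightarrow> H = (L 2 1 2 x)\<^sup>2 - (a x)\<^sup>2"
begin

text \<open>\<open>p 2\<close> is the paper's \<open>\<alpha>\<^sub>2\<^sub>2\<close>.\<close>

definition p :: "3 \<Rightarrow> real^3 \<Rightarrow> real" where "p i = L i 1 2"
definition q :: "3 \<Rightarrow> real^3 \<Rightarrow> real" where "q i = L i 1 3"
definition r :: "3 \<Rightarrow> real^3 \<Rightarrow> real" where "r i = L i 2 3"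

text \<open>Antisymmetry leaves three functions \<open>p i\<close>, \<open>q i\<close>,
  \<open>r i\<close> for each direction \<open>i\<close>, nine in all.\<close>

lemma L_table:
  assumes "x \<in> U"
  shows "L i 1 2 x = p i x" "L i 1 3 x = q i x" "L i 2 3 x = r i x"
    "L i 2 1 x = - p i x" "L i 3 1 x = - q i x" "L i 3 2 x = - r i x" "L i j j x = 0"
  using L_antisym[OF assms, of i 2 1] L_antisym[OF assms, of i 3 1] L_antisym[OF assms, of i 3 2]
    L_antisym[OF assms, of i j j]
  by (auto simp: p_def q_def r_def)

text \<open>A last index 1 carries the sign of T. Hence \<open>p\<close> and \<open>q\<close> enter
  \<open>w i j k\<close> and \<open>w i k j\<close> with equal signs and \<open>a\<close> with
  opposite ones when one of \<open>j\<close>, \<open>k\<close> is 1, whereas for the pair 2, 3 it is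
  \<open>r\<close> that changes sign and \<open>b\<close> that does not.\<close>

lemma w_table:
  assumes "x \<in> U"
  shows "w 1 1 1 x = - 2 * a x"
    and "w 1 1 2 x = p 1 x"
    and "w 1 1 3 x = q 1 x"
    and "w 1 2 1 x = p 1 x"
    and "w 1 2 2 x = a x"
    and "w 1 2 3 x = r 1 x"
    and "w 1 3 1 x = q 1 x"
    and "w 1 3 2 x = - r 1 x"
    and "w 1 3 3 x = a x"
    and "w 2 1 1 x = 0"
    and "w 2 1 2 x = a x + p 2 x"
    and "w 2 1 3 x = q 2 x"
    and "w 2 2 1 x = - a x + p 2 x"
    and "w 2 2 2 x = b x"
    and "w 2 2 3 x = r 2 x"
    and "w 2 3 1 x = q 2 x"
    and "w 2 3 2 x = - r 2 x"
    and "w 2 3 3 x = - b x"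
    and "w 3 1 1 x = 0"
    and "w 3 1 2 x = p 3 x"
    and "w 3 1 3 x = a x + q 3 x"
    and "w 3 2 1 x = p 3 x"
    and "w 3 2 2 x = 0"
    and "w 3 2 3 x = - b x + r 3 x"
    and "w 3 3 1 x = - a x + q 3 x"
    and "w 3 3 2 x = - b x - r 3 x"
    and "w 3 3 3 x = 0"
  using Kbil_sym[OF assms, of "e 2 x" "e 1 x"] Kbil_sym[OF assms, of "e 3 x" "e 1 x"] Kbil_sym[OF assms, of "e 3 x" "e 2 x"]
  by (simp_all add: w_def L_table[OF assms] s_eq K_eq[OF assms] hmet_add_left hmet_diff_left hmet_scaleR_left
      hmet_minus_left ortho[OF assms])

lemma a_smooth: "smooth_on U a"
proof (rule smooth_on_cong[OF U])
  show "smooth_on U (\<lambda>x. w 1 1 1 x / (-2))"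
    by (intro smooth_intros U w_smooth) auto
qed (simp add: w_table)

lemma b_smooth: "smooth_on U b"
  by (rule smooth_on_cong[OF U _ w_smooth[of 2 2 2]]) (simp add: w_table)

lemma p_smooth: "smooth_on U (p i)"
proof -
  have "smooth_on U (p 1)" by (rule smooth_on_cong[OF U _ w_smooth[of 1 1 2]]) (simp add: w_table)
  moreover have "smooth_on U (p 2)"
    by (rule smooth_on_cong[OF U _ smooth_on_diff[OF U w_smooth[of 2 1 2] a_smooth]]) (simp add: w_table)
  moreover have "smooth_on U (p 3)" by (rule smooth_on_cong[OF U _ w_smooth[of 3 1 2]]) (simp add: w_table)
  ultimately show ?thesis using exhaust_3[of i] by auto
qed

lemma q_smooth: "smooth_on U (q i)"
proof -
  have "smooth_on U (q 1)" by (rule smooth_on_cong[OF U _ w_smooth[of 1 1 3]]) (simp add: w_table)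
  moreover have "smooth_on U (q 3)"
    by (rule smooth_on_cong[OF U _ smooth_on_diff[OF U w_smooth[of 3 1 3] a_smooth]]) (simp add: w_table)
  moreover have "smooth_on U (q 2)" by (rule smooth_on_cong[OF U _ w_smooth[of 2 1 3]]) (simp add: w_table)
  ultimately show ?thesis using exhaust_3[of i] by auto
qed

lemma r_smooth: "smooth_on U (r i)"
proof -
  have "smooth_on U (r 1)" by (rule smooth_on_cong[OF U _ w_smooth[of 1 2 3]]) (simp add: w_table)
  moreover have "smooth_on U (r 3)"
    by (rule smooth_on_cong[OF U _ smooth_on_add[OF U w_smooth[of 3 2 3] b_smooth]]) (simp add: w_table)
  moreover have "smooth_on U (r 2)" by (rule smooth_on_cong[OF U _ w_smooth[of 2 2 3]]) (simp add: w_table)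
  ultimately show ?thesis using exhaust_3[of i] by auto
qed

lemma differentiable_at:
  assumes "x \<in> U"
  shows "a differentiable (at x)" "b differentiable (at x)" "p i differentiable (at x)"
    "q i differentiable (at x)" "r i differentiable (at x)"
  by (auto intro: smooth_on_differentiable[OF _ U assms] a_smooth b_smooth p_smooth q_smooth r_smooth)

lemma dirD_w_table:
  assumes "x \<in> U"
  shows "dirD X (w 1 1 1) x = - 2 * dirD X a x"
    and "dirD X (w 1 1 2) x = dirD X (p 1) x"
    and "dirD X (w 1 1 3) x = dirD X (q 1) x"
    and "dirD X (w 1 2 1) x = dirD X (p 1) x"
    and "dirD X (w 1 2 2) x = dirD X a x"
    and "dirD X (w 1 2 3) x = dirD X (r 1) x"
    and "dirD X (w 1 3 1) x = dirD X (q 1) x"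
    and "dirD X (w 1 3 2) x = - dirD X (r 1) x"
    and "dirD X (w 1 3 3) x = dirD X a x"
    and "dirD X (w 2 1 1) x = 0"
    and "dirD X (w 2 1 2) x = dirD X a x + dirD X (p 2) x"
    and "dirD X (w 2 1 3) x = dirD X (q 2) x"
    and "dirD X (w 2 2 1) x = - dirD X a x + dirD X (p 2) x"
    and "dirD X (w 2 2 2) x = dirD X b x"
    and "dirD X (w 2 2 3) x = dirD X (r 2) x"
    and "dirD X (w 2 3 1) x = dirD X (q 2) x"
    and "dirD X (w 2 3 2) x = - dirD X (r 2) x"
    and "dirD X (w 2 3 3) x = - dirD X b x"
    and "dirD X (w 3 1 1) x = 0"
    and "dirD X (w 3 1 2) x = dirD X (p 3) x"
    and "dirD X (w 3 1 3) x = dirD X a x + dirD X (q 3) x"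
    and "dirD X (w 3 2 1) x = dirD X (p 3) x"
    and "dirD X (w 3 2 2) x = 0"
    and "dirD X (w 3 2 3) x = - dirD X b x + dirD X (r 3) x"
    and "dirD X (w 3 3 1) x = - dirD X a x + dirD X (q 3) x"
    and "dirD X (w 3 3 2) x = - dirD X b x - dirD X (r 3) x"
    and "dirD X (w 3 3 3) x = 0"
  using differentiable_at[OF assms]
  by - (rule trans, rule dirD_cong[OF U assms], erule w_table,
      simp add: dirD_diff dirD_add dirD_minus dirD_mult differentiable_diff differentiable_minus)+

text \<open>The digits in these names are the indices \<open>i j\<close> and \<open>k l\<close> of
  \<open>gauss_codazzi\<close>. For \<open>k\<close> different from \<open>l\<close>, the equations
  for \<open>k l\<close> and \<open>l k\<close> are combined: one combination differentiates at most
  \<open>a\<close> and \<open>b\<close> (Codazzi), the other only \<open>p\<close>,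
  \<open>q\<close>, \<open>r\<close> (Gauss). For \<open>k = l\<close> only the Codazzi part is
  present.\<close>

lemma codazzi_12_11:
  assumes "x \<in> U"
  shows "- dirD (e 2) a x - 2 * a x * p 1 x = 0"
  using gauss_codazzi[OF assms, of 1 2 1 1]
  by (simp add: sum_3 w_table[OF assms] dirD_w_table[OF assms] s_eq algebra_simps)

lemma codazzi_12_12:
  assumes "x \<in> U"
  shows "dirD (e 1) a x + 4 * a x * p 2 x - b x * p 1 x = 0"
  using gauss_codazzi[OF assms, of 1 2 1 2] gauss_codazzi[OF assms, of 1 2 2 1]
  by (simp add: sum_3 w_table[OF assms] dirD_w_table[OF assms] s_eq algebra_simps)

lemma gauss_12_12:
  assumes "x \<in> U"
  shows "dirD (e 1) (p 2) x - dirD (e 2) (p 1) x - H + 3 * a x * a x - p 1 x * p 1 x + p 2 x * p 2 x + p 3 x * q 2 x - p 3 x * r 1 x + q 1 x * r 2 x - q 2 x * r 1 x = 0"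
  using gauss_codazzi[OF assms, of 1 2 1 2] gauss_codazzi[OF assms, of 1 2 2 1]
  by (simp add: sum_3 w_table[OF assms] dirD_w_table[OF assms] s_eq algebra_simps)

lemma codazzi_12_13:
  assumes "x \<in> U"
  shows "4 * a x * q 2 x + b x * q 1 x = 0"
  using gauss_codazzi[OF assms, of 1 2 1 3] gauss_codazzi[OF assms, of 1 2 3 1]
  by (simp add: sum_3 w_table[OF assms] dirD_w_table[OF assms] s_eq algebra_simps)

lemma gauss_12_13:
  assumes "x \<in> U"
  shows "dirD (e 1) (q 2) x - dirD (e 2) (q 1) x - p 1 x * q 1 x - p 1 x * r 2 x + p 2 x * q 2 x + p 2 x * r 1 x + q 2 x * q 3 x - q 3 x * r 1 x = 0"
  using gauss_codazzi[OF assms, of 1 2 1 3] gauss_codazzi[OF assms, of 1 2 3 1]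
  by (simp add: sum_3 w_table[OF assms] dirD_w_table[OF assms] s_eq algebra_simps)

lemma codazzi_12_23:
  assumes "x \<in> U"
  shows "- a x * q 1 x - b x * q 2 x + 3 * b x * r 1 x = 0"
  using gauss_codazzi[OF assms, of 1 2 2 3] gauss_codazzi[OF assms, of 1 2 3 2]
  by (simp add: sum_3 w_table[OF assms] dirD_w_table[OF assms] s_eq algebra_simps)

lemma gauss_12_23:
  assumes "x \<in> U"
  shows "dirD (e 1) (r 2) x - dirD (e 2) (r 1) x - p 1 x * q 2 x - p 1 x * r 1 x + p 2 x * q 1 x + p 2 x * r 2 x + q 2 x * r 3 x - r 1 x * r 3 x = 0"
  using gauss_codazzi[OF assms, of 1 2 2 3] gauss_codazzi[OF assms, of 1 2 3 2]
  by (simp add: sum_3 w_table[OF assms] dirD_w_table[OF assms] s_eq algebra_simps)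

lemma codazzi_13_11:
  assumes "x \<in> U"
  shows "- dirD (e 3) a x - 2 * a x * q 1 x = 0"
  using gauss_codazzi[OF assms, of 1 3 1 1]
  by (simp add: sum_3 w_table[OF assms] dirD_w_table[OF assms] s_eq algebra_simps)

lemma gauss_13_12:
  assumes "x \<in> U"
  shows "dirD (e 1) (p 3) x - dirD (e 3) (p 1) x - p 1 x * q 1 x + p 2 x * p 3 x + p 2 x * r 1 x + p 3 x * q 3 x + q 1 x * r 3 x - q 3 x * r 1 x = 0"
  using gauss_codazzi[OF assms, of 1 3 1 2] gauss_codazzi[OF assms, of 1 3 2 1]
  by (simp add: sum_3 w_table[OF assms] dirD_w_table[OF assms] s_eq algebra_simps)

lemma codazzi_13_13:
  assumes "x \<in> U"
  shows "dirD (e 1) a x + 4 * a x * q 3 x + b x * p 1 x = 0"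
  using gauss_codazzi[OF assms, of 1 3 1 3] gauss_codazzi[OF assms, of 1 3 3 1]
  by (simp add: sum_3 w_table[OF assms] dirD_w_table[OF assms] s_eq algebra_simps)

lemma codazzi_13_23:
  assumes "x \<in> U"
  shows "- dirD (e 1) b x - a x * p 1 x - b x * q 3 x = 0"
  using gauss_codazzi[OF assms, of 1 3 2 3] gauss_codazzi[OF assms, of 1 3 3 2]
  by (simp add: sum_3 w_table[OF assms] dirD_w_table[OF assms] s_eq algebra_simps)

lemma gauss_13_23:
  assumes "x \<in> U"
  shows "dirD (e 1) (r 3) x - dirD (e 3) (r 1) x - p 1 x * q 3 x + p 3 x * q 1 x + p 3 x * r 2 x - q 1 x * r 1 x + q 3 x * r 3 x + r 1 x * r 2 x = 0"
  using gauss_codazzi[OF assms, of 1 3 2 3] gauss_codazzi[OF assms, of 1 3 3 2]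
  by (simp add: sum_3 w_table[OF assms] dirD_w_table[OF assms] s_eq algebra_simps)

text \<open>Equivalently, the bracket of V and W has no T component, since that component is
  \<open>w 2 3 1 - w 3 2 1\<close>. The distribution spanned by V and W is therefore
  integrable.\<close>

lemma p3_eq_q2:
  assumes "x \<in> U"
  shows "p 3 x = q 2 x"
  using gauss_codazzi[OF assms, of 2 3 1 1] a_pos[OF assms]
  by (simp add: sum_3 w_table[OF assms] dirD_w_table[OF assms] s_eq algebra_simps)

lemma codazzi_23_12:
  assumes "x \<in> U"
  shows "- dirD (e 3) a x + b x * p 3 x + b x * q 2 x = 0"
  using gauss_codazzi[OF assms, of 2 3 1 2] gauss_codazzi[OF assms, of 2 3 2 1]
  by (simp add: sum_3 w_table[OF assms] dirD_w_table[OF assms] s_eq algebra_simps)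

lemma gauss_23_12:
  assumes "x \<in> U"
  shows "dirD (e 2) (p 3) x - dirD (e 3) (p 2) x + p 1 x * p 3 x - p 1 x * q 2 x + p 2 x * r 2 x + p 3 x * r 3 x + q 2 x * r 3 x - q 3 x * r 2 x = 0"
  using gauss_codazzi[OF assms, of 2 3 1 2] gauss_codazzi[OF assms, of 2 3 2 1]
  by (simp add: sum_3 w_table[OF assms] dirD_w_table[OF assms] s_eq algebra_simps)

lemma codazzi_23_13:
  assumes "x \<in> U"
  shows "dirD (e 2) a x + b x * p 2 x - b x * q 3 x = 0"
  using gauss_codazzi[OF assms, of 2 3 1 3] gauss_codazzi[OF assms, of 2 3 3 1]
  by (simp add: sum_3 w_table[OF assms] dirD_w_table[OF assms] s_eq algebra_simps)

lemma gauss_23_13: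
  assumes "x \<in> U"
  shows "dirD (e 2) (q 3) x - dirD (e 3) (q 2) x - p 2 x * r 3 x + p 3 x * q 1 x + p 3 x * r 2 x - q 1 x * q 2 x + q 2 x * r 2 x + q 3 x * r 3 x = 0"
  using gauss_codazzi[OF assms, of 2 3 1 3] gauss_codazzi[OF assms, of 2 3 3 1]
  by (simp add: sum_3 w_table[OF assms] dirD_w_table[OF assms] s_eq algebra_simps)

lemma codazzi_23_22:
  assumes "x \<in> U"
  shows "- dirD (e 3) b x + 3 * a x * p 3 x - a x * q 2 x + 3 * b x * r 2 x = 0"
  using gauss_codazzi[OF assms, of 2 3 2 2]
  by (simp add: sum_3 w_table[OF assms] dirD_w_table[OF assms] s_eq algebra_simps)

lemma codazzi_23_23:
  assumes "x \<in> U"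
  shows "- dirD (e 2) b x - a x * p 2 x + a x * q 3 x - 3 * b x * r 3 x = 0"
  using gauss_codazzi[OF assms, of 2 3 2 3] gauss_codazzi[OF assms, of 2 3 3 2]
  by (simp add: sum_3 w_table[OF assms] dirD_w_table[OF assms] s_eq algebra_simps)

text \<open>After elimination of the derivatives of \<open>a\<close>, the Codazzi equations form two
  homogeneous linear systems, one in \<open>p 1\<close> and \<open>p 2 - q 3\<close>, the other in
  \<open>q 1\<close> and \<open>q 2\<close>. Both degenerate exactly when
  \<open>b * b = 4 * a * a\<close>, that is \<open>b = 2 * a\<close>, as \<open>b + 2 * a\<close> is
  positive.\<close>

lemma p1_q1_alternative:
  assumes "x \<in> U"
  shows "p 1 x = 0 \<and> q 1 x = 0 \<or> b x = 2 * a x"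
proof -
  note eqs = codazzi_12_11[OF assms] codazzi_12_12[OF assms] codazzi_12_13[OF assms] codazzi_13_11[OF assms]
    codazzi_13_13[OF assms] codazzi_23_12[OF assms] codazzi_23_13[OF assms] p3_eq_q2[OF assms]
  have 1: "2 * (a x * (p 2 x - q 3 x)) = b x * p 1 x" "b x * (p 2 x - q 3 x) = 2 * (a x * p 1 x)"
    "4 * (a x * q 2 x) = - (b x * q 1 x)" "b x * q 2 x = - (a x * q 1 x)"
    using eqs by (simp_all add: algebra_simps)
  have "(b x * b x - 4 * a x * a x) * p 1 x = 0" "(b x * b x - 4 * a x * a x) * q 1 x = 0"
    using 1 by algebra+
  moreover have "b x * b x - 4 * a x * a x = (b x - 2 * a x) * (b x + 2 * a x)"
    by (simp add: algebra_simps)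
  moreover have "b x + 2 * a x > 0"
    using a_pos[OF assms] b_nonneg[OF assms] by simp
  ultimately show ?thesis by auto
qed

text \<open>The Codazzi equations leave the possibility \<open>b = 2 a\<close> open; it is excluded by
  differentiating the hypothesis on \<open>H\<close> and comparing with the Gauss equations.\<close>
lemma p1_q1_zero:
  assumes "x \<in> U"
  shows "p 1 x = 0 \<and> q 1 x = 0"
proof (rule ccontr)
  assume nz: "\<not> (p 1 x = 0 \<and> q 1 x = 0)"
  \<comment> \<open>On this open set \<open>b = 2 * a\<close> holds identically, so the relation may
    be differentiated.\<close>
  define Om where "Om = {x \<in> U. (p 1 x)\<^sup>2 + (q 1 x)\<^sup>2 \<in> - {0}}"
  have "continuous_on U (\<lambda>x. (p 1 x)\<^sup>2 + (q 1 x)\<^sup>2)"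
    by (intro continuous_intros smooth_on_continuous_on p_smooth q_smooth)
  then have Om: "open Om"
    unfolding Om_def by (rule continuous_open_preimage[OF _ U, unfolded vimage_def Int_def mem_Collect_eq]) auto
  have x: "x \<in> Om" using assms nz by (auto simp: Om_def sum_power2_eq_zero_iff)
  have OmU: "y \<in> U" if "y \<in> Om" for y using that by (simp add: Om_def)
  have b: "b y = 2 * a y" if "y \<in> Om" for y
    using p1_q1_alternative[of y] that by (auto simp: Om_def)
  have Db: "dirD (e i) b y = 2 * dirD (e i) a y" if "y \<in> Om" for y i
  proof -
    have "dirD (e i) b y = dirD (e i) (\<lambda>y. 2 * a y) y"
      by (rule dirD_cong[OF Om that b])
    then show ?thesis
      using differentiable_at[OF OmU[OF that]] by (simp add: dirD_mult)
  qed
  \<comment> \<open>In the degenerate case the Codazzi equations express every other coefficient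
    through \<open>p 1\<close> and \<open>q 1\<close>, and \<open>a\<close> is constant along
    T.\<close>
  have q3: "q 3 y = - p 1 y / 2" and p2: "p 2 y = p 1 y / 2" and D1a: "dirD (e 1) a y = 0"
    and q2: "q 2 y = - q 1 y / 2" and r1: "r 1 y = 0" and r2: "r 2 y = - q 1 y / 2" and r3: "r 3 y = p 1 y / 2"
    if y: "y \<in> Om" for y
  proof -
    note [simp] = b[OF y] Db[OF y]
    note yU = OmU[OF y]
    have a: "a y \<noteq> 0" using a_pos[OF yU] by simp
    have "a y * (q 3 y + p 1 y / 2) = 0"
      using codazzi_13_23[OF yU] codazzi_13_13[OF yU] by (simp add: algebra_simps)
    with a show q3: "q 3 y = - p 1 y / 2" by simp
    then show D1a: "dirD (e 1) a y = 0"
      using codazzi_13_13[OF yU] by (simp add: algebra_simps)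
    have "a y * (p 2 y - p 1 y / 2) = 0"
      using codazzi_12_12[OF yU] D1a by (simp add: algebra_simps)
    with a show p2: "p 2 y = p 1 y / 2" by simp
    have "a y * (q 2 y + q 1 y / 2) = 0"
      using codazzi_12_13[OF yU] by (simp add: algebra_simps)
    with a show q2: "q 2 y = - q 1 y / 2" by simp
    have "a y * r 1 y = 0"
      using codazzi_12_23[OF yU] q2 by (simp add: algebra_simps)
    with a show "r 1 y = 0" by simp
    have "a y * (2 * r 3 y - p 1 y) = 0"
    proof -
      have "p 1 y = 2 * p 2 y" "p 1 y = - 2 * q 3 y" using p2 q3 by simp_all
      with codazzi_23_23[OF yU] codazzi_12_11[OF yU] b[OF y] Db[OF y, of 2] show ?thesis by algebra
    qed
    with a show "r 3 y = p 1 y / 2" by simp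
    have "a y * (r 2 y + q 1 y / 2) = 0"
      using codazzi_23_22[OF yU] codazzi_13_11[OF yU] q2 p3_eq_q2[OF yU] by (simp add: algebra_simps)
    with a show "r 2 y = - q 1 y / 2" by simp
  qed
  have half: "dirD (e i) f x = c / 2 * dirD (e i) g x"
    if "\<And>y. y \<in> Om \<Longrightarrow> f y = c * g y / 2" "g differentiable (at x)" for i c and f g :: "real^3 \<Rightarrow> real"
  proof -
    have "dirD (e i) f x = dirD (e i) (\<lambda>y. (c / 2) * g y) x"
      by (rule dirD_cong[OF Om x]) (simp add: that)
    then show ?thesis using that(2) by (simp only: dirD_mult differentiable_const dirD_const mult_zero_left add_0)
  qed
  define P Q where "P = p 1 x" and "Q = q 1 x"
  note d = differentiable_at[OF assms]
  have D: "dirD (e i) (p 2) x = dirD (e i) (p 1) x / 2" "dirD (e i) (q 3) x = - dirD (e i) (p 1) x / 2"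
    "dirD (e i) (r 3) x = dirD (e i) (p 1) x / 2" "dirD (e i) (q 2) x = - dirD (e i) (q 1) x / 2"
    "dirD (e i) (r 2) x = - dirD (e i) (q 1) x / 2" "dirD (e i) (p 3) x = - dirD (e i) (q 1) x / 2"
    "dirD (e i) (r 1) x = 0" for i
    using half[of "p 2" 1 "p 1" i] half[of "q 3" "-1" "p 1" i] half[of "r 3" 1 "p 1" i]
      half[of "q 2" "-1" "q 1" i] half[of "r 2" "-1" "q 1" i] half[of "p 3" "-1" "q 1" i]
      half[of "r 1" 0 "q 1" i] p2 q3 r3 q2 r2 r1 p3_eq_q2[OF OmU] d
    by auto
  note vals = p2[OF x] q3[OF x] r3[OF x] q2[OF x] r2[OF x] r1[OF x] p3_eq_q2[OF assms] D P_def[symmetric] Q_def[symmetric]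
  \<comment> \<open>The derivative of \<open>H = p 2 * p 2 - a * a\<close> along the frame, with
    \<open>p 2 = p 1 / 2\<close> inserted.\<close>
  have DH: "P * dirD (e i) (p 1) x = 4 * a x * dirD (e i) a x" for i
  proof -
    have "dirD (e i) (\<lambda>x. p 2 x * p 2 x - a x * a x) x = dirD (e i) (\<lambda>x. H) x"
      by (rule dirD_cong[OF U assms]) (simp add: H_eq p_def power2_eq_square)
    then show ?thesis
      using d by (simp add: dirD_diff dirD_mult vals algebra_simps)
  qed
  have H: "H = P\<^sup>2 / 4 - (a x)\<^sup>2"
    using H_eq[OF assms] p2[OF x] by (simp add: p_def[symmetric] P_def power_divide)
  have D1q: "dirD (e 1) (q 1) x = P * Q"
    using gauss_12_23[OF assms] by (simp add: vals algebra_simps)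
  have D2q: "dirD (e 2) (q 1) x = - (P * Q)"
    using gauss_12_13[OF assms] D1q by (simp add: vals algebra_simps)
  have D3p: "dirD (e 3) (p 1) x = - (P * Q)"
    using gauss_13_12[OF assms] D1q by (simp add: vals algebra_simps)
  have D1p: "dirD (e 1) (p 1) x = (Q * Q - P * P) / 2"
    using gauss_13_23[OF assms] by (simp add: vals algebra_simps)
  have D2p: "2 * dirD (e 2) (p 1) x = dirD (e 1) (p 1) x - 2 * H + 6 * (a x)\<^sup>2 - 3 / 2 * P\<^sup>2 - Q\<^sup>2 / 2"
    using gauss_12_12[OF assms] by (simp add: vals algebra_simps power2_eq_square)
  have a: "a x > 0" by (rule a_pos[OF assms])
  have D2a: "dirD (e 2) a x = - 2 * (a x * P)" and D3a: "dirD (e 3) a x = - 2 * (a x * Q)"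
    using codazzi_12_11[OF assms] codazzi_13_11[OF assms] by (simp_all add: vals)
  have e1: "P * (Q * Q - P * P) = 0"
    using DH[of 1] D1p D1a[OF x] by simp
  have e2: "P * dirD (e 2) (p 1) x = - 8 * (a x)\<^sup>2 * P"
    using DH[of 2] D2a by (simp add: power2_eq_square)
  have e3: "Q * (P * P - 8 * (a x)\<^sup>2) = 0"
    using DH[of 3] D3a D3p by (simp add: power2_eq_square algebra_simps)
  \<comment> \<open>If P is nonzero, the T and W derivatives of the hypothesis force Q^2 = P^2 = 8
    a^2, hence H = a^2. The V derivative then requires \<open>dirD (e 2) (p 1) x\<close> to be -8
    a^2, while the Gauss equation gives -6 a^2.\<close>
  show False
  proof (cases "P = 0")
    case True
    with e3 a have "Q = 0" by simp
    with True nz show False by (simp add: P_def Q_def)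
  next
    case False
    with e1 have QP: "Q * Q = P * P" by simp
    with False have "Q \<noteq> 0" by auto
    with e3 have P8: "P * P = 8 * (a x)\<^sup>2" by simp
    have "P * (dirD (e 2) (p 1) x + 8 * (a x)\<^sup>2) = 0" using e2 by algebra
    with False have "dirD (e 2) (p 1) x + 8 * (a x)\<^sup>2 = 0" by simp
    with D2p D1p H QP P8 have "(a x)\<^sup>2 = 0"
      by (simp add: power2_eq_square)
    with a show False by simp
  qed
qed

text \<open>Geometrically, T is geodesic for the Levi-Civita connection, and the covariant
  derivative of T along any vector in the plane of V and W is \<alpha> times that vector: the leaves
  are umbilic.\<close>

lemma coefficients:
  assumes "x \<in> U"
  shows "p 1 x = 0" "q 1 x = 0" "q 2 x = 0" "p 3 x = 0" "q 3 x = p 2 x"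
proof -
  show z: "p 1 x = 0" "q 1 x = 0" "q 2 x = 0" "p 3 x = 0"
    using p1_q1_zero[OF assms] codazzi_12_13[OF assms] p3_eq_q2[OF assms] a_pos[OF assms] by auto
  have "a x * q 3 x = a x * p 2 x"
    using codazzi_12_12[OF assms] codazzi_13_13[OF assms] z by algebra
  then show "q 3 x = p 2 x" using a_pos[OF assms] by simp
qed

lemma dirD_a:
  assumes "x \<in> U"
  shows "dirD (e 1) a x = - 4 * a x * p 2 x" "dirD (e 2) a x = 0" "dirD (e 3) a x = 0"
  using codazzi_12_12[OF assms] codazzi_12_11[OF assms] codazzi_13_11[OF assms]
  by (simp_all add: coefficients[OF assms])

text \<open>The Gauss equation in the plane of T and V now reads T\<alpha> = H - 3 a^2 - \<alpha>^2,
  and the hypothesis on \<open>H\<close> reduces it to -4 a^2. The other two derivatives come from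
  the plane of V and W, where the \<open>r\<close> terms cancel because
  \<open>q 3 = p 2\<close>.\<close>

lemma dirD_p2:
  assumes "x \<in> U"
  shows "dirD (e 1) (p 2) x = - 4 * (a x)\<^sup>2" "dirD (e 2) (p 2) x = 0" "dirD (e 3) (p 2) x = 0"
proof -
  have D: "dirD (e i) (p 1) x = 0" "dirD (e i) (q 1) x = 0" "dirD (e i) (q 2) x = 0"
    "dirD (e i) (p 3) x = 0" "dirD (e i) (q 3) x = dirD (e i) (p 2) x" for i
    using dirD_cong[OF U assms, of "p 1" "\<lambda>x. 0" "e i"] dirD_cong[OF U assms, of "q 1" "\<lambda>x. 0" "e i"]
      dirD_cong[OF U assms, of "q 2" "\<lambda>x. 0" "e i"] dirD_cong[OF U assms, of "p 3" "\<lambda>x. 0" "e i"]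
      dirD_cong[OF U assms, of "q 3" "p 2" "e i"] coefficients by auto
  have H: "H = (p 2 x)\<^sup>2 - (a x)\<^sup>2"
    using H_eq[OF assms] by (simp add: p_def)
  show "dirD (e 1) (p 2) x = - 4 * (a x)\<^sup>2" "dirD (e 2) (p 2) x = 0" "dirD (e 3) (p 2) x = 0"
    using gauss_12_12[OF assms] gauss_23_12[OF assms] gauss_23_13[OF assms]
    by (simp_all add: D coefficients[OF assms] H power2_eq_square algebra_simps)
qed

end

section \<open>The linear normal form\<close>

context orthonormal_frame
begin

lemma pd_frame:
  assumes "x \<in> U"
  shows "pd f i x = (\<Sum>k\<in>UNIV. (s k * hmet h x (axis i 1) (e k x)) *\<^sub>R dirD (e k) f x)"
proof -
  have "pd f i x = dirD (\<lambda>_. axis i 1) f x"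
    unfolding dirD_def by (rule sum_axis_scaleR[symmetric])
  also have "\<dots> = dirD (\<lambda>y. \<Sum>k\<in>UNIV. (s k * hmet h x (axis i 1) (e k x)) *\<^sub>R e k y) f x"
    by (rule dirD_direction_cong) (rule frame_expand[OF assms])
  finally show ?thesis by (simp only: dirD_direction_combination)
qed

lemma frame_constant:
  assumes "ball c d \<subseteq> U" "\<And>x. x \<in> ball c d \<Longrightarrow> f differentiable (at x)"
    and "\<And>x k. x \<in> ball c d \<Longrightarrow> dirD (e k) f x = 0" "x \<in> ball c d" "y \<in> ball c d"
  shows "f x = f y"
proof -
  have "(f has_derivative (\<lambda>_. 0)) (at z within ball c d)" if z: "z \<in> ball c d" for z
  proof -
    have "pd f i z = 0" for i
      using pd_frame[of z f i] assms(1,3) z by (simp add: subset_iff)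
    then show ?thesis
      using has_derivative_at_withinI[OF has_derivative_pd[OF assms(2)[OF z]]] by simp
  qed
  then show ?thesis
    using has_derivative_zero_constant[OF convex_ball, of c d f] assms(4,5) by metis
qed

text \<open>A field proportional to all its derivatives has constant direction: its component
  \<open>g\<close> along \<open>F c\<close> obeys the same equation, so \<open>F\<close> divided by
  \<open>g\<close> is constant. The radius shrinks to keep \<open>g\<close> within 1 of
  \<open>g c = 1\<close>, hence positive.\<close>

lemma recurrent_field:
  fixes F :: "real^3 \<Rightarrow> real^4"
  assumes "0 < d" "ball c d \<subseteq> U" "smooth_on (ball c d) F" "F c \<noteq> 0"
    and rec: "\<And>x k. x \<in> ball c d \<Longrightarrow> dirD (e k) F x = \<theta> k x *\<^sub>R F x"
  obtains d' g where "0 < d'" "d' \<le> d" "smooth_on (ball c d) g" "g c = 1"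
    "\<And>x. x \<in> ball c d' \<Longrightarrow> 0 < g x" "\<And>x. x \<in> ball c d' \<Longrightarrow> F x = g x *\<^sub>R F c"
proof -
  define g where "g x = (F x \<bullet> F c) / (F c \<bullet> F c)" for x
  have Fc: "F c \<bullet> F c \<noteq> 0" using assms(4) by simp
  have g: "smooth_on (ball c d) g"
    unfolding g_def using Fc by (intro smooth_intros open_ball assms(3)) auto
  have c: "c \<in> ball c d" using assms(1) by auto
  have gc: "g c = 1" using Fc by (simp add: g_def)
  have "isCont g c"
    using smooth_on_differentiable[OF g open_ball c] differentiable_imp_continuous_within by blast
  then obtain d1 where d1: "0 < d1" "\<And>x. dist x c < d1 \<Longrightarrow> dist (g x) (g c) < 1"
    unfolding continuous_at_eps_delta dist_norm by (metis zero_less_one)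
  define d' where "d' = min d d1"
  have pos: "0 < g x" if "x \<in> ball c d'" for x
    using d1(2)[of x] that gc by (auto simp: d'_def dist_commute dist_real_def)
  have sub: "ball c d' \<subseteq> ball c d" by (auto simp: d'_def)
  have dif: "F differentiable (at x)" "g differentiable (at x)" if "x \<in> ball c d'" for x
    using that sub smooth_on_differentiable[OF _ open_ball] assms(3) g by blast+
  have dg: "dirD (e k) g x = \<theta> k x * g x" if "x \<in> ball c d'" for x k
  proof -
    have "dirD (e k) (\<lambda>x. F x \<bullet> F c) x = dirD (e k) F x \<bullet> F c"
      using dif[OF that] by (simp add: dirD_inner)
    then show ?thesis
      unfolding g_def using dif[OF that] Fc rec[of x k] that sub
      by (subst dirD_divide) (auto simp: power2_eq_square)
  qed
  show ?thesis
  proof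
    show "0 < d'" "d' \<le> d" using assms(1) d1(1) by (auto simp: d'_def)
    show "smooth_on (ball c d) g" "g c = 1" by fact+
    show "0 < g x" if "x \<in> ball c d'" for x using pos that .
    show "F x = g x *\<^sub>R F c" if x: "x \<in> ball c d'" for x
    proof -
      have "inverse (g x) *\<^sub>R F x = inverse (g c) *\<^sub>R F c"
      proof (rule frame_constant[where d = d' and c = c and x = x and y = c and f = "\<lambda>x. inverse (g x) *\<^sub>R F x"])
        show "ball c d' \<subseteq> U" using sub assms(2) by blast
        show "(\<lambda>x. inverse (g x) *\<^sub>R F x) differentiable (at y)" if "y \<in> ball c d'" for y
          using dif[OF that] pos[OF that] by auto
        show "dirD (e k) (\<lambda>x. inverse (g x) *\<^sub>R F x) y = 0" if y: "y \<in> ball c d'" for y k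
        proof -
          have "dirD (e k) (\<lambda>x. inverse (g x)) y = dirD (e k) (\<lambda>x. 1 / g x) y"
            by (simp add: inverse_eq_divide)
          also have "\<dots> = - \<theta> k y / g y"
            using dif[OF y] pos[OF y] by (subst dirD_divide) (auto simp: dg[OF y] power2_eq_square)
          finally have "dirD (e k) (\<lambda>x. inverse (g x)) y = - \<theta> k y / g y" .
          moreover have "dirD (e k) F y = \<theta> k y *\<^sub>R F y" using rec y sub by blast
          ultimately show ?thesis
            using dif[OF y] pos[OF y] by (subst dirD_scaleR) (auto simp: divide_inverse)
        qed
      qed (use x \<open>0 < d'\<close> in auto)
      then have "g x *\<^sub>R inverse (g x) *\<^sub>R F x = g x *\<^sub>R F c" by (simp add: gc)
      then show ?thesis using pos[OF x] by simp
    qed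
  qed
qed

end

context symmetric_hypersphere
begin

text \<open>In the equations for the repeated derivatives along V and along W, the part outside the
  span of \<open>E 2\<close> and \<open>E 3\<close> is the same vector
  \<open>(p 2 x - a x) *\<^sub>R E 1 x + \<xi> x\<close>; in the mixed ones it vanishes.\<close>

lemma reduced_structure:
  assumes "x \<in> U"
  shows "dirD (e 1) (E 1) x = (- 2 * a x) *\<^sub>R E 1 x - \<xi> x"
    "dirD (e 1) (E 2) x = a x *\<^sub>R E 2 x + r 1 x *\<^sub>R E 3 x"
    "dirD (e 1) (E 3) x = (- r 1 x) *\<^sub>R E 2 x + a x *\<^sub>R E 3 x"
    "dirD (e 2) (E 1) x = (p 2 x + a x) *\<^sub>R E 2 x"
    "dirD (e 3) (E 1) x = (p 2 x + a x) *\<^sub>R E 3 x"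
    "dirD (e 2) (E 2) x = (p 2 x - a x) *\<^sub>R E 1 x + b x *\<^sub>R E 2 x + r 2 x *\<^sub>R E 3 x + \<xi> x"
    "dirD (e 2) (E 3) x = (- r 2 x) *\<^sub>R E 2 x - b x *\<^sub>R E 3 x"
    "dirD (e 3) (E 2) x = (r 3 x - b x) *\<^sub>R E 3 x"
    "dirD (e 3) (E 3) x = (p 2 x - a x) *\<^sub>R E 1 x - (r 3 x + b x) *\<^sub>R E 2 x + \<xi> x"
  by (simp_all add: structure_equation[OF assms] sum_3 w_table[OF assms] coefficients[OF assms] s_eq algebra_simps)

lemma H_factor: "x \<in> U \<Longrightarrow> H = (p 2 x - a x) * (p 2 x + a x)"
  using H_eq[of x] by (simp add: p_def power2_eq_square algebra_simps)

theorem affine_normal_form: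
  assumes c: "c \<in> U" and "H \<noteq> 0"
  obtains A :: "real^4^4" and v d y g where "0 < d" "ball c d \<subseteq> U" "invertible A"
    "y = (\<lambda>x. A *v \<phi> x + v)" "smooth_on (ball c d) y" "smooth_on (ball c d) g"
    "\<And>x. x \<in> ball c d \<Longrightarrow> 0 < y x $ 4"
    "\<And>x. x \<in> ball c d \<Longrightarrow> dirD (e 1) y x = g x *\<^sub>R axis 3 1 + (p 2 x + a x) *\<^sub>R y x"
    "\<And>x. x \<in> ball c d \<Longrightarrow> dirD (e 2) y x $ 4 = 0" "\<And>x. x \<in> ball c d \<Longrightarrow> dirD (e 3) y x $ 4 = 0"
    "\<And>x. x \<in> ball c d \<Longrightarrow> dirD (e 2) g x = 0" "\<And>x. x \<in> ball c d \<Longrightarrow> dirD (e 3) g x = 0"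
    "\<And>x. x \<in> ball c d \<Longrightarrow> dirD (e 2) (dirD (e 2) y) x
      = (p 2 x - a x) *\<^sub>R dirD (e 1) y x + b x *\<^sub>R dirD (e 2) y x + r 2 x *\<^sub>R dirD (e 3) y x - H *\<^sub>R y x"
    "\<And>x. x \<in> ball c d \<Longrightarrow> dirD (e 2) (dirD (e 3) y) x = (- r 2 x) *\<^sub>R dirD (e 2) y x - b x *\<^sub>R dirD (e 3) y x"
    "\<And>x. x \<in> ball c d \<Longrightarrow> dirD (e 3) (dirD (e 2) y) x = (r 3 x - b x) *\<^sub>R dirD (e 3) y x"
    "\<And>x. x \<in> ball c d \<Longrightarrow> dirD (e 3) (dirD (e 3) y) x
      = (p 2 x - a x) *\<^sub>R dirD (e 1) y x - (r 3 x + b x) *\<^sub>R dirD (e 2) y x - H *\<^sub>R y x"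
    "y c = axis 4 1" "dirD (e 2) y c = axis 1 1" "dirD (e 3) y c = axis 2 1" "(p 2 c - a c) * g c = 1"
proof -
  obtain d0 where d0: "0 < d0" "ball c d0 \<subseteq> U"
    using U c openE by blast
  have c0: "c \<in> ball c d0" using d0(1) by simp
  note dif = smooth_on_differentiable[OF _ U]
  \<comment> \<open>The centre of the hypersphere: \<open>\<xi> + H \<phi>\<close> is constant, so
    all affine normals pass through this point.\<close>
  define v0 where "v0 = \<phi> c + (1 / H) *\<^sub>R \<xi> c"
  define Y where "Y x = \<phi> x - v0" for x
  have Ysm: "smooth_on U Y"
    unfolding Y_def by (intro smooth_intros U smooth_\<phi>)
  have dY: "dirD (e k) Y x = E k x" if "x \<in> U" for x k
    unfolding Y_def E_def using dif[OF smooth_\<phi> that] by (subst dirD_diff) auto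
  have "\<xi> x + H *\<^sub>R \<phi> x = \<xi> c + H *\<^sub>R \<phi> c" if "x \<in> ball c d0" for x
  proof (rule frame_constant[OF d0(2) _ _ that c0])
    fix y k assume "y \<in> ball c d0"
    then have y: "y \<in> U" using d0 by blast
    show "(\<lambda>x. \<xi> x + H *\<^sub>R \<phi> x) differentiable (at y)"
      using dif[OF smooth_\<phi> y] dif[OF smooth_\<xi> y] by auto
    show "dirD (e k) (\<lambda>x. \<xi> x + H *\<^sub>R \<phi> x) y = 0"
      using dif[OF smooth_\<phi> y] dif[OF smooth_\<xi> y] dirD_\<xi>[OF y, of k]
      by (simp add: dirD_add dirD_scaleR E_def)
  qed
  then have \<xi>: "\<xi> x = - H *\<^sub>R Y x" if "x \<in> ball c d0" for x
    using that \<open>H \<noteq> 0\<close> unfolding Y_def v0_def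
    by (simp add: scaleR_diff_right scaleR_add_right algebra_simps eq_diff_eq)
  have \<alpha>: "p 2 x + a x \<noteq> 0" "p 2 x - a x \<noteq> 0" if "x \<in> U" for x
    using H_factor[OF that] \<open>H \<noteq> 0\<close> by auto
  have \<alpha>_sm: "smooth_on U (\<lambda>x. p 2 x + a x)"
    by (intro smooth_intros U p_smooth a_smooth)
  define F where "F x = E 1 x - (p 2 x + a x) *\<^sub>R Y x" for x
  have F_sm: "smooth_on U F"
    unfolding F_def by (intro smooth_intros U E_smooth \<alpha>_sm Ysm)
  have dF: "dirD (e k) F x = dirD (e k) (E 1) x - (dirD (e k) (p 2) x + dirD (e k) a x) *\<^sub>R Y x - (p 2 x + a x) *\<^sub>R E k x"
    if "x \<in> U" for x k
    unfolding F_def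
    using dif[OF E_smooth that] dif[OF \<alpha>_sm that] dif[OF Ysm that] differentiable_at[OF that]
    by (simp add: dirD_diff dirD_scaleR dirD_add dY[OF that] algebra_simps)
  have dF1: "dirD (e 1) F x = (- (p 2 x + 3 * a x)) *\<^sub>R F x" if "x \<in> ball c d0" for x
  proof -
    have x: "x \<in> U" using that d0 by blast
    \<comment> \<open>Here the hypothesis on \<open>H\<close> acts: it makes the coefficient of
      \<open>Y\<close> the right multiple of the coefficient of \<open>E 1\<close>, so that the T
      derivative of \<open>F\<close> is again proportional to \<open>F\<close>.\<close>
    have "H - dirD (e 1) (p 2) x - dirD (e 1) a x = (p 2 x + 3 * a x) * (p 2 x + a x)"
      by (simp add: H_factor[OF x] dirD_a[OF x] dirD_p2[OF x] power2_eq_square algebra_simps)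
    moreover have "dirD (e 1) F x = (- (p 2 x + 3 * a x)) *\<^sub>R E 1 x + (H - dirD (e 1) (p 2) x - dirD (e 1) a x) *\<^sub>R Y x"
    proof -
      have "(a x * 3) *\<^sub>R E 1 x = a x *\<^sub>R E 1 x + (a x * 2) *\<^sub>R E 1 x"
        by (simp flip: scaleR_add_left)
      then show ?thesis
        by (simp add: dF[OF x] reduced_structure(1)[OF x] \<xi>[OF that] algebra_simps)
    qed
    ultimately show ?thesis
      by (simp only: F_def[of x] scaleR_diff_right scaleR_scaleR mult_minus_left scaleR_minus_left diff_minus_eq_add)
  qed
  have dF2: "dirD (e 2) F x = 0" and dF3: "dirD (e 3) F x = 0" if "x \<in> U" for x
    by (simp_all add: dF[OF that] reduced_structure[OF that] dirD_a[OF that] dirD_p2[OF that])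
  define M :: "real^3 \<Rightarrow> real^4^4" where
    "M x = (\<chi> i j. if i = 1 then E 2 x $ j else if i = 2 then E 3 x $ j else if i = 3 then F x $ j else Y x $ j)" for x
  have M: "M x *v u = w \<longleftrightarrow> u \<bullet> E 2 x = w $ 1 \<and> u \<bullet> E 3 x = w $ 2 \<and> u \<bullet> F x = w $ 3 \<and> u \<bullet> Y x = w $ 4" for x u w
    by (simp add: vec_eq_iff forall_4 M_def matrix_vector_mult_def inner_vec_def mult.commute)
  have indep: "u $ 1 = 0 \<and> u $ 2 = 0 \<and> u $ 3 = 0 \<and> u $ 4 = 0"
    if x: "x \<in> ball c d0" and "u $ 1 *\<^sub>R E 2 x + u $ 2 *\<^sub>R E 3 x + u $ 3 *\<^sub>R F x + u $ 4 *\<^sub>R Y x = 0" for x and u :: "real^4"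
  proof -
    have xU: "x \<in> U" using x d0 by blast
    have \<xi>Y: "(- (u $ 4 - u $ 3 * (p 2 x + a x)) / H) *\<^sub>R \<xi> x = (u $ 4 - u $ 3 * (p 2 x + a x)) *\<^sub>R Y x"
      using \<open>H \<noteq> 0\<close> by (simp add: \<xi>[OF x] flip: scaleR_minus_left)
    have "(\<Sum>k\<in>UNIV. (if k = 1 then u $ 3 else if k = 2 then u $ 1 else u $ 2) *\<^sub>R E k x)
        + (- (u $ 4 - u $ 3 * (p 2 x + a x)) / H) *\<^sub>R \<xi> x = 0"
      unfolding \<xi>Y using that(2) by (simp add: sum_3 F_def algebra_simps)
    from E_independent(1)[OF xU this, of 1] E_independent(1)[OF xU this, of 2]
      E_independent(1)[OF xU this, of 3] E_independent(2)[OF xU this]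
    show ?thesis using \<open>H \<noteq> 0\<close> by simp
  qed
  have det_tM: "det (transpose (M x)) \<noteq> 0" if "x \<in> ball c d0" for x
    unfolding det_nz_iff_kernel
  proof (intro allI impI)
    fix u assume "transpose (M x) *v u = 0"
    moreover have "transpose (M x) *v u = u $ 1 *\<^sub>R E 2 x + u $ 2 *\<^sub>R E 3 x + u $ 3 *\<^sub>R F x + u $ 4 *\<^sub>R Y x"
      by (simp add: vec_eq_iff M_def transpose_def matrix_vector_mult_def sum_4 mult.commute)
    ultimately show "u = 0" using indep[OF that, of u] by (simp add: vec_eq_iff forall_4)
  qed
  then have det_M: "det (M x) \<noteq> 0" if "x \<in> ball c d0" for x
    using that by (simp add: det_transpose)
  \<comment> \<open>The covector dual to \<open>Y\<close>: it annihilates \<open>E 2\<close>,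
    \<open>E 3\<close> and \<open>F\<close> and takes the value 1 on \<open>Y\<close>.\<close>
  define om where "om x = (\<chi> k. det (\<chi> i j. if j = k then (axis 4 1 :: real^4) $ i else M x $ i $ j) / det (M x))" for x
  have Mom: "M x *v om x = axis 4 1" if "x \<in> ball c d0" for x
    using cramer[OF det_M[OF that]] by (simp add: om_def)
  have om: "om x \<bullet> E 2 x = 0" "om x \<bullet> E 3 x = 0" "om x \<bullet> F x = 0" "om x \<bullet> Y x = 1" if "x \<in> ball c d0" for x
    using Mom[OF that] unfolding M by (simp_all add: axis_def)
  have om1: "om x \<bullet> E 1 x = p 2 x + a x" if "x \<in> ball c d0" for x
    using om(3,4)[OF that] by (simp add: F_def inner_diff_right)
  have om_sm: "smooth_on (ball c d0) om"
  proof (rule smooth_on_linear_system[OF open_ball _ _ det_M Mom])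
    fix i j :: 4
    have sm: "smooth_on (ball c d0) (\<lambda>x. Z x $ j)" if "smooth_on U Z" for Z :: "real^3 \<Rightarrow> real^4"
      by (rule smooth_on_nth[OF open_ball smooth_on_subset[OF that d0(2)]])
    show "smooth_on (ball c d0) (\<lambda>x. M x $ i $ j)"
      unfolding M_def using sm[OF E_smooth] sm[OF F_sm] sm[OF Ysm]
      by (cases "i = 1"; cases "i = 2"; cases "i = 3") auto
    show "smooth_on (ball c d0) (\<lambda>x. axis 4 1 $ i)" by (rule smooth_on_const)
  qed
  have dom_inner: "dirD (e k) om x \<bullet> Z x = - (om x \<bullet> dirD (e k) Z x)"
    if "smooth_on U Z" "\<And>x. x \<in> ball c d0 \<Longrightarrow> om x \<bullet> Z x = const" "x \<in> ball c d0" for Z k const x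
  proof -
    have "dirD (e k) (\<lambda>x. om x \<bullet> Z x) x = dirD (e k) (\<lambda>x. const) x"
      by (rule dirD_cong[OF open_ball that(3,2)])
    moreover have "Z differentiable (at x)" "om differentiable (at x)"
      using dif[OF that(1)] smooth_on_differentiable[OF om_sm open_ball] that(3) d0(2) by blast+
    ultimately show ?thesis by (simp add: dirD_inner)
  qed
  \<comment> \<open>The kernel of \<open>om x\<close> is spanned by \<open>E 2\<close>,
    \<open>E 3\<close>, \<open>F\<close>. That \<open>om\<close> only changes by a factor says that
    this 3-space is parallel; the V and W equations close up because (p 2 - a) E 1 + \<xi> = (p 2 -
    a) F.\<close>
  have dom: "dirD (e k) om x = (if k = 1 then - (p 2 x + a x) else 0) *\<^sub>R om x" if x: "x \<in> ball c d0" for x k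
  proof (rule bij_matrix_unique[OF det_M[OF x]])
    have xU: "x \<in> U" using x d0 by blast
    note R = reduced_structure[OF xU] \<xi>[OF x] om[OF x] om1[OF x] H_factor[OF xU] dF2[OF xU] dF3[OF xU] dF1[OF x]
      dY[OF xU]
    have "dirD (e k) om x \<bullet> E 2 x = 0" "dirD (e k) om x \<bullet> E 3 x = 0" "dirD (e k) om x \<bullet> F x = 0"
      "dirD (e k) om x \<bullet> Y x = (if k = 1 then - (p 2 x + a x) else 0)"
      using dom_inner[OF E_smooth om(1) x, of k] dom_inner[OF E_smooth om(2) x, of k]
        dom_inner[OF F_sm om(3) x, of k] dom_inner[OF Ysm om(4) x, of k] exhaust_3[of k] R
      by (auto simp: inner_add_right inner_diff_right)
    then show "M x *v dirD (e k) om x = M x *v ((if k = 1 then - (p 2 x + a x) else 0) *\<^sub>R om x)"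
      unfolding matrix_vector_mult_scaleR Mom[OF x] M by (simp add: axis_def)
  qed
  have Fc: "F c \<noteq> 0"
    using indep[OF c0, of "axis 3 1"] by (auto simp: axis_def)
  have "dirD (e k) F x = (if k = 1 then - (p 2 x + 3 * a x) else 0) *\<^sub>R F x" if "x \<in> ball c d0" for x k
  proof -
    have "x \<in> U" using that d0 by blast
    then show ?thesis using dF1[OF that] dF2 dF3 exhaust_3[of k] by auto
  qed
  then obtain d1 g1 where g1: "0 < d1" "d1 \<le> d0" "smooth_on (ball c d0) g1" "g1 c = 1"
    "\<And>x. x \<in> ball c d1 \<Longrightarrow> F x = g1 x *\<^sub>R F c"
    using recurrent_field[OF d0 smooth_on_subset[OF F_sm d0(2)] Fc, where \<theta> = "\<lambda>k x. if k = 1 then - (p 2 x + 3 * a x) else 0"] by metis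
  have "om c \<noteq> 0" using om(4)[OF c0] by auto
  then obtain d2 g2 where g2: "0 < d2" "d2 \<le> d0" "\<And>x. x \<in> ball c d2 \<Longrightarrow> 0 < g2 x"
    "\<And>x. x \<in> ball c d2 \<Longrightarrow> om x = g2 x *\<^sub>R om c"
    using recurrent_field[OF d0 om_sm _ dom] by metis
  define d where "d = min d1 d2"
  have d: "0 < d" "ball c d \<subseteq> ball c d0" "ball c d \<subseteq> ball c d1" "ball c d \<subseteq> ball c d2" "ball c d \<subseteq> U"
    using g1(1,2) g2(1,2) d0(2) by (auto simp: d_def)
  \<comment> \<open>The new basis at \<open>c\<close>. Scaling \<open>F c\<close> by
    \<open>p 2 c - a c\<close> makes the transversal part of VVy and WWy at \<open>c\<close> exactly
    the third basis vector, which later normalises the Hessian determinant to one.\<close>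
  define C :: "real^4^4" where "C = (\<chi> i j. if j = 1 then E 2 c $ i else if j = 2 then E 3 c $ i
      else if j = 3 then (p 2 c - a c) * F c $ i else Y c $ i)"
  have C: "C *v u = u $ 1 *\<^sub>R E 2 c + u $ 2 *\<^sub>R E 3 c + ((p 2 c - a c) * u $ 3) *\<^sub>R F c + u $ 4 *\<^sub>R Y c" for u
    by (simp add: vec_eq_iff C_def matrix_vector_mult_def sum_4 algebra_simps)
  have "det C \<noteq> 0"
    unfolding det_nz_iff_kernel
  proof (intro allI impI)
    fix u assume "C *v u = 0"
    then have "u $ 1 = 0 \<and> u $ 2 = 0 \<and> (p 2 c - a c) * u $ 3 = 0 \<and> u $ 4 = 0"
      using indep[OF c0, of "\<chi> i. if i = 3 then (p 2 c - a c) * u $ 3 else u $ i"] by (simp add: C)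
    then show "u = 0" using \<alpha>(2)[OF c] by (simp add: vec_eq_iff forall_4)
  qed
  then obtain A where AC: "A ** C = mat 1" "C ** A = mat 1"
    unfolding invertible_det_nz[symmetric] invertible_def by blast
  have A: "A *v (C *v u) = u" "C *v (A *v u) = u" for u
    by (simp_all add: matrix_vector_mul_assoc AC)
  have Acol: "A *v E 2 c = axis 1 1" "A *v E 3 c = axis 2 1" "A *v ((p 2 c - a c) *\<^sub>R F c) = axis 3 1" "A *v Y c = axis 4 1"
    using A(1)[of "axis 1 1"] A(1)[of "axis 2 1"] A(1)[of "axis 3 1"] A(1)[of "axis 4 1"]
    by (simp_all add: C axis_def)
  have A4: "(A *v z) $ 4 = om c \<bullet> z" for z
  proof -
    have "om c \<bullet> z = om c \<bullet> (C *v (A *v z))" by (simp add: A)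
    also have "\<dots> = (A *v z) $ 4"
      using om[OF c0] by (simp add: C inner_add_right)
    finally show ?thesis by simp
  qed
  have A_minus: "A *v (- z) = - (A *v z)" for z
    using matrix_vector_mult_scaleR[of A "-1" z] by simp
  have bl: "bounded_linear ((*v) A)" by (rule matrix_vector_mul_bounded_linear)
  define y where "y x = A *v \<phi> x + (- (A *v v0))" for x
  have y: "y x = A *v Y x" for x
    by (simp add: y_def Y_def matrix_vector_mult_diff_distrib)
  then have y': "y = (\<lambda>x. A *v Y x)" by blast
  have dy: "dirD (e k) y x = A *v E k x" if "x \<in> U" for x k
    unfolding y' using dirD_linear[OF bl dif[OF Ysm that]] dY[OF that] by simp
  have ddy: "dirD (e j) (dirD (e k) y) x = A *v dirD (e j) (E k) x" if "x \<in> U" for x j k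
    using dirD_cong[OF U that dy[where k = k], where X = "e j"] dirD_linear[OF bl dif[OF E_smooth that]] by simp
  define g where "g x = g1 x / (p 2 c - a c)" for x
  have g1_dif: "g1 differentiable (at x)" if "x \<in> ball c d" for x
    using smooth_on_differentiable[OF g1(3) open_ball] that d(2) by blast
  have dg: "dirD (e k) g x = 0" if x: "x \<in> ball c d" and "dirD (e k) F x = 0" for x k
  proof -
    have "dirD (e k) F x = dirD (e k) (\<lambda>x. g1 x *\<^sub>R F c) x"
      by (rule dirD_cong[OF open_ball x]) (use g1(5) d(3) in blast)
    with that(2) Fc have "dirD (e k) g1 x = 0"
      using g1_dif[OF x] by (simp add: dirD_scaleR)
    then show ?thesis
      unfolding g_def using g1_dif[OF x] \<alpha>(2)[OF c] by (subst dirD_divide) auto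
  qed
  \<comment> \<open>Up to a positive factor the fixed covector \<open>om c\<close> is
    \<open>om x\<close>, so relations known for \<open>om x\<close> carry over to the fourth
    coordinate of \<open>y\<close>.\<close>
  have omc: "om c \<bullet> z = (om x \<bullet> z) / g2 x" if "x \<in> ball c d" for x z
    using g2(3,4)[of x] that d(4) by auto
  show ?thesis
  proof (rule that[of d A y "- (A *v v0)" g])
    show "0 < d" "ball c d \<subseteq> U" by fact+
    show "invertible A" unfolding invertible_def using AC by blast
    show "y = (\<lambda>x. A *v \<phi> x + - (A *v v0))" by (simp add: y_def fun_eq_iff)
    show "smooth_on (ball c d) y"
      unfolding y' by (rule smooth_on_linear[OF bl open_ball smooth_on_subset[OF Ysm d(5)]])
    show "smooth_on (ball c d) g"
      unfolding g_def using \<alpha>(2)[OF c] smooth_on_subset[OF g1(3) d(2)] by (intro smooth_intros open_ball) auto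
    show "y c = axis 4 1" "dirD (e 2) y c = axis 1 1" "dirD (e 3) y c = axis 2 1"
      by (simp_all add: y dy[OF c] Acol)
    show "(p 2 c - a c) * g c = 1"
      using \<alpha>(2)[OF c] by (simp add: g_def g1(4))
    fix x assume x: "x \<in> ball c d"
    then have xU: "x \<in> U" and x0: "x \<in> ball c d0" using d by blast+
    show "0 < y x $ 4"
      unfolding y A4 omc[OF x] om(4)[OF x0] using g2(3) x d(4) by auto
    have "F x = g x *\<^sub>R ((p 2 c - a c) *\<^sub>R F c)"
      using g1(5)[of x] x d(3) \<alpha>(2)[OF c] by (auto simp: g_def)
    then have "A *v F x = g x *\<^sub>R axis 3 1"
      by (simp only: matrix_vector_mult_scaleR[of A "g x"] Acol)
    moreover have "E 1 x = F x + (p 2 x + a x) *\<^sub>R Y x" by (simp add: F_def)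
    ultimately show "dirD (e 1) y x = g x *\<^sub>R axis 3 1 + (p 2 x + a x) *\<^sub>R y x"
      by (simp add: dy[OF xU] y matrix_vector_right_distrib matrix_vector_mult_scaleR)
    show "dirD (e 2) y x $ 4 = 0" "dirD (e 3) y x $ 4 = 0"
      unfolding dy[OF xU] A4 omc[OF x] using om[OF x0] by simp_all
    show "dirD (e 2) g x = 0" "dirD (e 3) g x = 0"
      by (rule dg[OF x dF2[OF xU]], rule dg[OF x dF3[OF xU]])
    show "dirD (e 2) (dirD (e 2) y) x
        = (p 2 x - a x) *\<^sub>R dirD (e 1) y x + b x *\<^sub>R dirD (e 2) y x + r 2 x *\<^sub>R dirD (e 3) y x - H *\<^sub>R y x"
      "dirD (e 2) (dirD (e 3) y) x = (- r 2 x) *\<^sub>R dirD (e 2) y x - b x *\<^sub>R dirD (e 3) y x"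
      "dirD (e 3) (dirD (e 2) y) x = (r 3 x - b x) *\<^sub>R dirD (e 3) y x"
      "dirD (e 3) (dirD (e 3) y) x
        = (p 2 x - a x) *\<^sub>R dirD (e 1) y x - (r 3 x + b x) *\<^sub>R dirD (e 2) y x - H *\<^sub>R y x"
      by (simp_all add: ddy[OF xU] dy[OF xU] y reduced_structure[OF xU] \<xi>[OF x0] matrix_vector_right_distrib
          matrix_vector_mult_diff_distrib matrix_vector_mult_scaleR A_minus)
  qed
qed

end

section \<open>Adapted coordinates and the improper affine sphere\<close>

text \<open>Along a coordinate line the iterated \<open>cderiv\<close> are the iterated partials in
  that direction; the equality is kept on all of the open set \<open>I\<close> so that it can be
  differentiated again.\<close>

lemma smooth_curve_on_line:
  fixes F :: "real^'n \<Rightarrow> 'b::real_normed_vector"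
  assumes "open I" "open W" "smooth_on W F" "\<And>s. s \<in> I \<Longrightarrow> z + s *\<^sub>R axis i 1 \<in> W"
  shows "smooth_curve_on I (\<lambda>s. F (z + s *\<^sub>R axis i 1))"
proof -
  let ?L = "\<lambda>s. z + s *\<^sub>R axis i 1"
  define P where "P k = ((\<lambda>G. pd G i) ^^ k) F" for k
  have P: "smooth_on W (P k)" for k
    by (induction k) (auto simp: P_def assms(3) smooth_on_pd)
  have vd: "((\<lambda>s. P k (?L s)) has_vector_derivative P (Suc k) (?L s)) (at s)" if "s \<in> I" for s k
    using has_vector_derivative_line[OF smooth_on_differentiable[OF P assms(2) assms(4)[OF that]]]
    by (simp add: P_def)
  have eq: "(cderiv ^^ k) (\<lambda>s. F (?L s)) s = P k (?L s)" if "s \<in> I" for s k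
    using that
  proof (induction k arbitrary: s)
    case (Suc k)
    have "((cderiv ^^ k) (\<lambda>s. F (?L s)) has_vector_derivative P (Suc k) (?L s)) (at s)"
      by (rule has_vector_derivative_transform_within_open[OF vd assms(1)]) (use Suc in auto)
    from vector_derivative_at[OF this] show ?case
      by (simp only: funpow.simps o_apply cderiv_def[of "(cderiv ^^ k) (\<lambda>s. F (?L s))"])
  qed (simp add: P_def)
  show ?thesis
    unfolding smooth_curve_on_def differentiable_on_eq_differentiable_at[OF assms(1)]
  proof (intro allI ballI)
    fix k s assume s: "s \<in> I"
    have "((cderiv ^^ k) (\<lambda>s. F (?L s)) has_vector_derivative P (Suc k) (?L s)) (at s)"
      by (rule has_vector_derivative_transform_within_open[OF vd assms(1)]) (use s eq in auto)
    then show "(cderiv ^^ k) (\<lambda>s. F (?L s)) differentiable at s"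
      unfolding has_vector_derivative_def by (rule differentiableI)
  qed
qed

section \<open>Slices and product domains\<close>

definition slice :: "real \<Rightarrow> real^2 \<Rightarrow> real^3" where
  "slice s y = (\<chi> i. if i = 1 then s else if i = 2 then y $ 1 else y $ 2)"

lemma slice_nth [simp]: "slice s y $ 1 = s" "slice s y $ 2 = y $ 1" "slice s y $ 3 = y $ 2"
  by (simp_all add: slice_def)

lemma slice_line: "slice s y = slice 0 y + s *\<^sub>R axis 1 1"
  by (simp add: vec_eq_iff forall_3 axis_def)

lemma slice_in_prod_dom [simp]: "slice s y \<in> prod_dom I N \<longleftrightarrow> s \<in> I \<and> y \<in> N"
proof -
  have "(\<chi> i. if i = 1 then slice s y $ 2 else slice s y $ 3) = y"
    by (simp add: vec_eq_iff forall_2)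
  then show ?thesis by (simp add: prod_dom_def)
qed

lemma prod_dom_slice:
  assumes "x \<in> prod_dom I N"
  obtains s y where "x = slice s y" "s \<in> I" "y \<in> N" "y = (\<chi> i. if i = 1 then x $ 2 else x $ 3)"
proof
  show "x = slice (x $ 1) (\<chi> i. if i = 1 then x $ 2 else x $ 3)"
    by (simp add: vec_eq_iff forall_3)
qed (use assms in \<open>auto simp: prod_dom_def\<close>)

lemma has_derivative_slice: "(slice s has_derivative slice 0) (at y)"
proof -
  have "linear (slice 0)"
    by (rule linearI) (simp_all add: vec_eq_iff forall_3)
  then have "((\<lambda>y. slice 0 y + s *\<^sub>R axis 1 1) has_derivative slice 0) (at y)"
    by (auto intro!: derivative_eq_intros linear_imp_has_derivative)
  then show ?thesis by (simp only: slice_line[symmetric])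
qed

lemma pd_slice_map: "pd (slice s) 1 y = axis 2 1" "pd (slice s) 2 y = axis 3 1"
  by (simp_all add: pd_eqI[OF has_derivative_slice] vec_eq_iff forall_3 axis_def)

lemma smooth_on_slice: "smooth_on N (slice s)"
proof -
  have "smooth_on UNIV (\<lambda>y. slice s y $ i)" for i
    using exhaust_3[of i] by (auto intro!: smooth_intros simp: slice_def)
  then have "smooth_on UNIV (slice s)" by (intro smooth_on_vec) auto
  then show ?thesis using smooth_on_subset by blast
qed

lemma pd_slice:
  assumes "F differentiable (at (slice s y))"
  shows "pd (\<lambda>y. F (slice s y)) 1 y = pd F 2 (slice s y)" "pd (\<lambda>y. F (slice s y)) 2 y = pd F 3 (slice s y)"
proof -
  have "slice s differentiable (at y)" using has_derivative_slice by (rule differentiableI)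
  from pd_compose[OF this assms]
  show "pd (\<lambda>y. F (slice s y)) 1 y = pd F 2 (slice s y)" "pd (\<lambda>y. F (slice s y)) 2 y = pd F 3 (slice s y)"
    by (simp_all add: pd_slice_map sum_axis_scaleR)
qed

lemma open_prod_dom:
  assumes "open I" "open N"
  shows "open (prod_dom I N)"
proof -
  let ?T = "\<lambda>x :: real^3. (\<chi> i. if i = 1 then x $ 2 else x $ 3) :: real^2"
  have "continuous_on UNIV (\<lambda>x :: real^3. x $ 1)" by (intro continuous_intros)
  then have "open ((\<lambda>x :: real^3. x $ 1) -` I)"
    using assms(1) by (rule open_vimage[rotated])
  moreover have "smooth_on UNIV (\<lambda>x. ?T x $ i)" for i
    by (cases "i = 1") (auto intro!: smooth_intros)
  then have "smooth_on UNIV ?T" by (intro smooth_on_vec) auto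
  then have "open (?T -` N)"
    using assms(2) open_vimage smooth_on_continuous_on by blast
  moreover have "prod_dom I N = (\<lambda>x. x $ 1) -` I \<inter> ?T -` N"
    by (auto simp: prod_dom_def)
  ultimately show ?thesis by auto
qed

lemma prod_dom_box:
  assumes "open V" "slice s0 y0 \<in> V"
  obtains I N where "open I" "is_interval I" "open N" "convex N" "s0 \<in> I" "y0 \<in> N" "prod_dom I N \<subseteq> V"
proof -
  obtain d where d: "0 < d" "ball (slice s0 y0) d \<subseteq> V"
    using assms openE by blast
  \<comment> \<open>A third of the radius for each of the three coordinates: the sum of the
    deviations stays below \<open>d\<close>.\<close>
  define I where "I = {s0 - d / 3<..<s0 + d / 3}"
  define N where "N = ball y0 (d / 3)"
  have "prod_dom I N \<subseteq> V"
  proof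
    fix x assume "x \<in> prod_dom I N"
    then obtain s y where x: "x = slice s y" "s \<in> I" "y \<in> N" by (rule prod_dom_slice)
    have y: "\<bar>y $ i - y0 $ i\<bar> < d / 3" for i
      using component_le_norm_cart[of "y - y0" i] x(3) by (simp add: N_def dist_norm norm_minus_commute)
    have "norm (x - slice s0 y0) \<le> (\<Sum>i\<in>UNIV. \<bar>(x - slice s0 y0) $ i\<bar>)"
      by (rule norm_le_l1_cart)
    also have "\<dots> < d"
    proof -
      have "\<bar>s - s0\<bar> < d / 3" using x(2) by (auto simp: I_def abs_if)
      then show ?thesis using y[of 1] y[of 2] by (simp add: sum_3 x(1))
    qed
    finally show "x \<in> V" using d(2) by (auto simp: dist_norm norm_minus_commute)
  qed
  moreover have "open I" "is_interval I" "open N" "convex N" "s0 \<in> I" "y0 \<in> N"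
    using d(1) by (auto simp: I_def N_def is_interval_oo)
  ultimately show ?thesis by (rule that[rotated -1])
qed

lemma pd_zero_constant:
  fixes f :: "real^'n \<Rightarrow> 'b::real_normed_vector"
  assumes "open N" "convex N" "smooth_on N f" "\<And>y i. y \<in> N \<Longrightarrow> pd f i y = 0" "y \<in> N" "y' \<in> N"
  shows "f y = f y'"
proof -
  have "(f has_derivative (\<lambda>_. 0)) (at x within N)" if "x \<in> N" for x
    using has_derivative_at_withinI[OF has_derivative_pd[OF smooth_on_differentiable[OF assms(3,1) that]]]
    by (simp add: assms(4)[OF that])
  then show ?thesis
    using has_derivative_zero_constant[OF assms(2), of f] assms(5,6) by metis
qed

section \<open>Graphs as improper affine spheres and as paraboloids\<close>

lemma graph_map_nth: "graph_map f y $ 1 = y $ 1" "graph_map f y $ 2 = y $ 2" "graph_map f y $ 3 = f y"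
  by (simp_all add: graph_map_def)

lemma pd_coordinate: "pd (\<lambda>y. y $ j) i y = (if i = j then 1 else 0 :: real)"
  using pd_nth[of "\<lambda>y. y" y j i] by (simp add: pd_def axis_def)

lemma smooth_on_graph_map:
  assumes "open N" "smooth_on N f"
  shows "smooth_on N (graph_map f)"
proof (rule smooth_on_vec[OF assms(1)])
  fix i :: 3
  show "smooth_on N (\<lambda>y. graph_map f y $ i)"
    using exhaust_3[of i] assms smooth_on_nth[OF assms(1) smooth_on_ident] by (auto simp: graph_map_nth)
qed

lemma pd_graph_map:
  assumes "f differentiable (at y)" "graph_map f differentiable (at y)"
  shows "pd (graph_map f) i y = (\<chi> r. if r = 3 then pd f i y else if r = 1 then (if i = 1 then 1 else 0) else (if i = 2 then 1 else 0))"
proof -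
  have "pd (graph_map f) i y $ 1 = (if i = 1 then 1 else 0)" "pd (graph_map f) i y $ 2 = (if i = 2 then 1 else 0)"
    "pd (graph_map f) i y $ 3 = pd f i y"
    using pd_nth[OF assms(2), of 1 i] pd_nth[OF assms(2), of 2 i] pd_nth[OF assms(2), of 3 i]
    by (simp_all add: graph_map_nth pd_coordinate)
  then show ?thesis by (simp add: vec_eq_iff forall_3)
qed

text \<open>With the constant transversal field \<open>e3\<close>, second derivatives of a graph are
  multiples of \<open>e3\<close>: the induced connection has zero coefficients, the affine metric is
  the Hessian, and the frame determinant is 1. The volume condition thus becomes Hessian determinant
  one.\<close>

lemma graph_improper_affine_sphere:
  fixes f :: "real^2 \<Rightarrow> real"
  assumes N: "open N" and f: "smooth_on N f"
    and pos: "\<And>y. y \<in> N \<Longrightarrow> 0 < pd (pd f 1) 1 y"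
    and hess: "\<And>y. y \<in> N \<Longrightarrow> pd (pd f 1) 1 y * pd (pd f 2) 2 y - (pd (pd f 1) 2 y)\<^sup>2 = 1"
  shows "pos_def_improper_affine_sphere N (graph_map f) (\<lambda>_. e3)"
proof -
  define h :: "real^2 \<Rightarrow> real^2^2" where "h y = (\<chi> i j. pd (pd f j) i y)" for y
  note gs = smooth_on_graph_map[OF N f]
  have d: "f differentiable (at y)" "graph_map f differentiable (at y)" "pd f i differentiable (at y)"
     "pd (graph_map f) i differentiable (at y)" if "y \<in> N" for y i
    using that smooth_on_differentiable[OF _ N] f gs smooth_on_pd by blast+
  note pdg = pd_graph_map[OF d(1,2)]
  have pd2: "pd (pd (graph_map f) j) i y = pd (pd f j) i y *\<^sub>R e3" if y: "y \<in> N" for y i j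
  proof -
    have nth: "pd (pd (graph_map f) j) i y $ r = pd (\<lambda>y. pd (graph_map f) j y $ r) i y" for r
      using pd_nth[OF d(4)[OF y]] by simp
    have c: "pd (\<lambda>y. pd (graph_map f) j y $ r) i y = pd (\<lambda>y. if r = 3 then pd f j y else if r = 1 then (if j = 1 then 1 else 0) else (if j = 2 then 1 else 0)) i y" for r
      by (rule pd_cong[OF N y]) (simp add: pdg)
    show ?thesis
      unfolding vec_eq_iff nth c forall_3 by (simp add: e3_def axis_def pd_def)
  qed
  have sym: "pd (pd f 2) 1 y = pd (pd f 1) 2 y" if "y \<in> N" for y
    by (rule pd_commute_real[OF N f that])
  have det_frame: "det (frame_mat2 (graph_map f) (\<lambda>_. e3) y) = 1" if "y \<in> N" for y
    by (simp add: frame_mat2_def det_3 pdg[OF that that] e3_def axis_def)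
  have det_h: "det (h y) = 1" if "y \<in> N" for y
    using hess[OF that] sym[OF that] by (simp add: h_def det_2 power2_eq_square)
  have "blaschke2 N (graph_map f) (\<lambda>_. e3) h (\<lambda>_ _ _. 0)"
    unfolding blaschke2_def
  proof (intro conjI ballI allI)
    show "pd (pd (graph_map f) j) i y = (\<Sum>k\<in>UNIV. (0 :: real^2) $ k *\<^sub>R pd (graph_map f) k y) + h y $ i $ j *\<^sub>R e3"
      if "y \<in> N" for y i j
      by (simp add: pd2[OF that] h_def)
  qed (use N gs in \<open>simp_all add: det_frame det_h smooth_on_const pd_def[of "\<lambda>_. e3"] span_zero\<close>)
  moreover have "0 < u \<bullet> (h y *v u)" if y: "y \<in> N" and u: "u \<noteq> 0" for y u
  proof -
    define q where "q = u \<bullet> (h y *v u)"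
    let ?a = "pd (pd f 1) 1 y" and ?b = "pd (pd f 1) 2 y" and ?c = "pd (pd f 2) 2 y"
    have q: "q = ?a * (u $ 1)\<^sup>2 + 2 * ?b * (u $ 1 * u $ 2) + ?c * (u $ 2)\<^sup>2"
      by (simp add: q_def h_def inner_vec_def matrix_vector_mult_def sum_2 sym[OF y] power2_eq_square algebra_simps)
    \<comment> \<open>Completing the square, with the Hessian determinant as coefficient of the last
      term.\<close>
    have "?a * q = (?a * u $ 1 + ?b * u $ 2)\<^sup>2 + (?a * ?c - ?b\<^sup>2) * (u $ 2)\<^sup>2"
      by (simp add: q power2_eq_square algebra_simps)
    then have aq: "?a * q = (?a * u $ 1 + ?b * u $ 2)\<^sup>2 + (u $ 2)\<^sup>2"
      by (simp add: hess[OF y])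
    have "?a * q \<noteq> 0"
    proof
      assume "?a * q = 0"
      then have "u $ 2 = 0" "?a * u $ 1 + ?b * u $ 2 = 0"
        unfolding aq by (auto simp: sum_power2_eq_zero_iff)
      with pos[OF y] have "u = 0" by (simp add: vec_eq_iff forall_2)
      with u show False by blast
    qed
    moreover have "0 \<le> ?a * q" unfolding aq by simp
    ultimately have "0 < ?a * q" by linarith
    then show ?thesis
      using pos[OF y] unfolding q_def[symmetric] by (simp add: zero_less_mult_iff)
  qed
  moreover have "pd (\<lambda>_. e3) i y = 0" for i :: 2 and y by (simp add: pd_def)
  ultimately show ?thesis
    unfolding pos_def_improper_affine_sphere_def by blast
qed

lemma graph_on_elliptic_paraboloid:
  fixes f :: "real^2 \<Rightarrow> real"
  assumes N: "open N" "convex N" and f: "smooth_on N f"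
    and hess: "\<And>y. y \<in> N \<Longrightarrow> pd (pd f 1) 1 y = 1" "\<And>y. y \<in> N \<Longrightarrow> pd (pd f 1) 2 y = 0"
      "\<And>y. y \<in> N \<Longrightarrow> pd (pd f 2) 1 y = 0" "\<And>y. y \<in> N \<Longrightarrow> pd (pd f 2) 2 y = 1"
  shows "on_elliptic_paraboloid (graph_map f ` N)"
proof -
  have nth: "((\<lambda>y. y $ i) has_derivative (\<lambda>u. u $ i)) (at y within N)" for i :: 2 and y :: "real^2"
    by (rule bounded_linear_imp_has_derivative[OF bounded_linear_vec_nth])
  have d: "(F has_derivative (\<lambda>u. u $ 1 * pd F 1 y + u $ 2 * pd F 2 y)) (at y within N)"
    if "smooth_on N F" "y \<in> N" for F y
    using has_derivative_at_withinI[OF has_derivative_pd[OF smooth_on_differentiable[OF that(1) N(1) that(2)]]]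
    by (simp add: sum_2)
  have "\<exists>k. \<forall>y\<in>N. pd f i y - y $ i = k" for i
  proof (rule has_derivative_zero_constant[OF N(2)])
    fix y assume y: "y \<in> N"
    show "((\<lambda>y. pd f i y - y $ i) has_derivative (\<lambda>_. 0)) (at y within N)"
      using has_derivative_diff[OF d[OF smooth_on_pd[OF f, of i] y] nth[of i]] exhaust_2[of i] hess[OF y] by auto
  qed
  then obtain k where k: "pd f i y - y $ i = k i" if "y \<in> N" for i y by metis
  define P where "P y = (y $ 1)\<^sup>2 / 2 + (y $ 2)\<^sup>2 / 2 + k 1 * y $ 1 + k 2 * y $ 2" for y :: "real^2"
  have "\<exists>c. \<forall>y\<in>N. f y - P y = c"
  proof (rule has_derivative_zero_constant[OF N(2)])
    fix y assume y: "y \<in> N"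
    have "(P has_derivative (\<lambda>u. (y $ 1 + k 1) * u $ 1 + (y $ 2 + k 2) * u $ 2)) (at y within N)"
      unfolding P_def by (auto intro!: derivative_eq_intros nth simp: algebra_simps)
    then show "((\<lambda>y. f y - P y) has_derivative (\<lambda>_. 0)) (at y within N)"
      using has_derivative_diff[OF d[OF f y]] k[OF y, of 1] k[OF y, of 2] by (fastforce simp: algebra_simps)
  qed
  then obtain c where c: "f y = P y + c" if "y \<in> N" for y by (metis diff_add_cancel add.commute)
  \<comment> \<open>The map clears the factor 1/2 by doubling the third coordinate, and the
    translation completes the squares in the first two.\<close>
  define A :: "real^3^3" where "A = (\<chi> i j. if i = j then (if i = 3 then 2 else 1) else 0)"
  define b :: "real^3" where "b = (\<chi> i. if i = 1 then k 1 else if i = 2 then k 2 else (k 1)\<^sup>2 + (k 2)\<^sup>2 - 2 * c)"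
  have "det A \<noteq> 0" by (simp add: A_def det_3)
  moreover have "let z = A *v x + b in z $ 3 = (z $ 1)\<^sup>2 + (z $ 2)\<^sup>2" if "x \<in> graph_map f ` N" for x
    using that c by (auto simp: A_def b_def Let_def matrix_vector_mult_def sum_3 graph_map_nth P_def
        power2_eq_square algebra_simps)
  ultimately show ?thesis
    unfolding on_elliptic_paraboloid_def invertible_det_nz by blast
qed

text \<open>To be applied to \<open>t = y\<^sub>4\<close>, \<open>z i = y\<^sub>i / y\<^sub>4\<close>, \<open>g = \<lambda> / ((\<alpha> + a) t\<^sup>2)\<close>
  and \<open>G = (\<alpha> - a) \<lambda> / t\<close>.\<close>

locale graph_frame =
  fixes B :: "(real^3) set" and e :: "3 \<Rightarrow> real^3 \<Rightarrow> real^3" and c :: "real^3"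
    and t :: "real^3 \<Rightarrow> real" and z :: "3 \<Rightarrow> real^3 \<Rightarrow> real" and g G b r2 r3 :: "real^3 \<Rightarrow> real"
  assumes B: "open B" and c: "c \<in> B"
    and e_sm: "smooth_on B (e i)" and t_sm: "smooth_on B t" and z_sm: "smooth_on B (z i)"
    and g_sm: "smooth_on B g" and G_sm: "smooth_on B G"
    and D1t: "x \<in> B \<Longrightarrow> dirD (e 1) t x \<noteq> 0"
    and D2t: "x \<in> B \<Longrightarrow> dirD (e 2) t x = 0" and D3t: "x \<in> B \<Longrightarrow> dirD (e 3) t x = 0"
    and D1z: "x \<in> B \<Longrightarrow> dirD (e 1) (z i) x = (if i = 3 then g x * dirD (e 1) t x else 0)"
    and D2g: "x \<in> B \<Longrightarrow> dirD (e 2) g x = 0" and D3g: "x \<in> B \<Longrightarrow> dirD (e 3) g x = 0"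
    and D2G: "x \<in> B \<Longrightarrow> dirD (e 2) G x = 0" and D3G: "x \<in> B \<Longrightarrow> dirD (e 3) G x = 0"
    and D22: "x \<in> B \<Longrightarrow> dirD (e 2) (dirD (e 2) (z i)) x
      = b x * dirD (e 2) (z i) x + r2 x * dirD (e 3) (z i) x + (if i = 3 then G x else 0)"
    and D23: "x \<in> B \<Longrightarrow> dirD (e 2) (dirD (e 3) (z i)) x = - r2 x * dirD (e 2) (z i) x - b x * dirD (e 3) (z i) x"
    and D32: "x \<in> B \<Longrightarrow> dirD (e 3) (dirD (e 2) (z i)) x = (r3 x - b x) * dirD (e 3) (z i) x"
    and D33: "x \<in> B \<Longrightarrow> dirD (e 3) (dirD (e 3) (z i)) x
      = - (r3 x + b x) * dirD (e 2) (z i) x + (if i = 3 then G x else 0)"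
    and Gc: "G c = 1" and frame_c: "dirD (e 2) (z 1) c = 1" "dirD (e 3) (z 1) c = 0"
      "dirD (e 2) (z 2) c = 0" "dirD (e 3) (z 2) c = 1"
begin

abbreviation "dz j i \<equiv> dirD (e j) (z i)"

text \<open>Determinant of the vectors which V and W induce in the (v, w)-plane.\<close>

definition m :: "real^3 \<Rightarrow> real" where "m x = dz 2 1 x * dz 3 2 x - dz 3 1 x * dz 2 2 x"

definition B' :: "(real^3) set" where "B' = {x \<in> B. m x \<noteq> 0}"

definition \<Psi> :: "real^3 \<Rightarrow> real^3" where
  "\<Psi> x = (\<chi> i. if i = 1 then t x else if i = 2 then z 1 x else z 2 x)"

lemma dz_sm: "smooth_on B (dz j i)"
  by (intro smooth_on_dirD B e_sm z_sm)

lemma dif: "x \<in> B \<Longrightarrow> z i differentiable (at x)" "x \<in> B \<Longrightarrow> dz j i differentiable (at x)"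
  using smooth_on_differentiable[OF _ B] z_sm dz_sm by blast+

lemma m_sm: "smooth_on B m"
  unfolding m_def by (intro smooth_intros B dz_sm)

text \<open>Along V and along W the pair of gradient rows is transformed by the coefficient matrices
  of the second order equations, and both matrices have trace zero.\<close>

lemma Dm: "x \<in> B \<Longrightarrow> dirD (e 2) m x = 0" "x \<in> B \<Longrightarrow> dirD (e 3) m x = 0"
  unfolding m_def using dif by (simp_all add: dirD_diff dirD_mult D22 D23 D32 D33 algebra_simps)

lemma mc: "m c = 1" by (simp add: m_def frame_c)

lemma B'_B: "x \<in> B' \<Longrightarrow> x \<in> B" by (simp add: B'_def)

lemma B': "open B'"
proof -
  have "open (B \<inter> m -` (- {0}))"
    by (rule continuous_open_preimage[OF smooth_on_continuous_on[OF m_sm] B]) auto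
  moreover have "B \<inter> m -` (- {0}) = B'" by (auto simp: B'_def)
  ultimately show ?thesis by simp
qed

lemma c_B': "c \<in> B'" using c mc by (simp add: B'_def)

lemma \<Psi>_nth: "\<Psi> x $ 1 = t x" "\<Psi> x $ 2 = z 1 x" "\<Psi> x $ 3 = z 2 x"
  by (simp_all add: \<Psi>_def)

lemma \<Psi>_sm: "smooth_on B \<Psi>"
proof (rule smooth_on_vec[OF B])
  fix i :: 3
  show "smooth_on B (\<lambda>x. \<Psi> x $ i)"
    using exhaust_3[of i] t_sm z_sm by (auto simp: \<Psi>_nth)
qed

lemma \<Psi>_dif: "x \<in> B \<Longrightarrow> \<Psi> differentiable (at x)"
  by (rule smooth_on_differentiable[OF \<Psi>_sm B])

lemma dirD_\<Psi>:
  assumes "x \<in> B"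
  shows "dirD X \<Psi> x $ 1 = dirD X t x" "dirD X \<Psi> x $ 2 = dirD X (z 1) x" "dirD X \<Psi> x $ 3 = dirD X (z 2) x"
  using dirD_nth[OF \<Psi>_dif[OF assms], of X 1] dirD_nth[OF \<Psi>_dif[OF assms], of X 2]
    dirD_nth[OF \<Psi>_dif[OF assms], of X 3] by (simp_all add: \<Psi>_nth)

text \<open>Multiplying the Jacobian by the matrix of the frame gives the derivatives along T, V, W,
  which form a triangular block matrix with blocks \<open>dirD (e 1) t x\<close> and the 2 by 2
  block of determinant \<open>m x\<close>.\<close>

lemma det_\<Psi>:
  assumes x: "x \<in> B'"
  shows "det (\<chi> i j. pd \<Psi> j x $ i) \<noteq> 0"
proof -
  let ?J = "\<chi> i j. pd \<Psi> j x $ i" and ?F = "\<chi> i j. e j x $ i"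
  have eq: "(?J ** ?F) $ i $ j = dirD (e j) \<Psi> x $ i" for i j
    by (simp add: matrix_matrix_mult_def dirD_def mult.commute)
  have "det (?J ** ?F) = dirD (e 1) t x * m x"
    using B'_B[OF x] unfolding det_3 eq
    by (simp add: dirD_\<Psi> D2t D3t D1z m_def algebra_simps)
  then have "det ?J * det ?F \<noteq> 0"
    using D1t[OF B'_B[OF x]] x by (simp add: det_mul B'_def)
  then show ?thesis by auto
qed

theorem graph_normal_form:
  obtains U0 I N f \<Phi> k where "open U0" "c \<in> U0" "U0 \<subseteq> B" "open I" "is_interval I" "open N"
    "smooth_on N f" "smooth_curve_on I (\<lambda>s. (\<chi> i. if i = 1 then s else s * k s) :: real^2)"
    "pos_def_improper_affine_sphere N (graph_map f) (\<lambda>_. e3)"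
    "smooth_on (prod_dom I N) \<Phi>" "smooth_on U0 \<Psi>" "\<Phi> ` prod_dom I N = U0"
    "\<And>y. y \<in> prod_dom I N \<Longrightarrow> \<Psi> (\<Phi> y) = y" "\<And>x. x \<in> U0 \<Longrightarrow> \<Phi> (\<Psi> x) = x"
    "\<And>s y. s \<in> I \<Longrightarrow> y \<in> N \<Longrightarrow> z 3 (\<Phi> (slice s y)) = f y + k s"
    "(\<And>x. x \<in> B \<Longrightarrow> b x = 0) \<Longrightarrow> on_elliptic_paraboloid (graph_map f ` N)"
proof -
  obtain U' V \<Phi> where IFT: "open U'" "c \<in> U'" "U' \<subseteq> B'" "open V" "\<Psi> ` U' = V" "\<Phi> ` V = U'"
    "\<And>x. x \<in> U' \<Longrightarrow> \<Phi> (\<Psi> x) = x" "\<And>y. y \<in> V \<Longrightarrow> \<Psi> (\<Phi> y) = y" "smooth_on V \<Phi>"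
    using smooth_inverse_function_theorem[OF B' smooth_on_subset[OF \<Psi>_sm] det_\<Psi> c_B'] B'_B by blast
  have U'B: "x \<in> B" if "x \<in> U'" for x using that IFT(3) B'_B by blast
  have m_nz: "m x \<noteq> 0" if "x \<in> U'" for x using that IFT(3) by (auto simp: B'_def)
  have \<Phi>U': "\<Phi> y \<in> U'" if "y \<in> V" for y using that IFT(6) by blast
  have \<Psi>V: "\<Psi> x \<in> V" if "x \<in> U'" for x using that IFT(5) by blast
  define s0 y0 where "s0 = t c" and "y0 = (\<chi> i. if i = 1 then z 1 c else z 2 c :: real^2)"
  have \<Psi>c: "\<Psi> c = slice s0 y0"
    by (simp add: vec_eq_iff forall_3 \<Psi>_nth s0_def y0_def)
  obtain I N where IN: "open I" "is_interval I" "open N" "convex N" "s0 \<in> I" "y0 \<in> N" "prod_dom I N \<subseteq> V"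
    using prod_dom_box[OF IFT(4)] \<Psi>V[OF IFT(2)] unfolding \<Psi>c by metis
  have sl: "slice s y \<in> V" if "s \<in> I" "y \<in> N" for s y using that IN(7) by (simp add: subset_iff)
  have chain: "dirD X (\<lambda>x. K (\<Psi> x)) x
      = dirD X t x * pd K 1 (\<Psi> x) + dirD X (z 1) x * pd K 2 (\<Psi> x) + dirD X (z 2) x * pd K 3 (\<Psi> x)"
    if K: "smooth_on V K" and x: "x \<in> U'" for K :: "real^3 \<Rightarrow> real" and X x
    using dirD_compose[OF \<Psi>_dif[OF U'B[OF x]] smooth_on_differentiable[OF K IFT(4) \<Psi>V[OF x]], of X]
    by (simp add: sum_3 dirD_\<Psi>[OF U'B[OF x]])
  have pull_sm: "smooth_on V (\<lambda>y. F (\<Phi> y))" if "smooth_on B F" for F :: "real^3 \<Rightarrow> real"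
    by (rule smooth_on_compose[OF IFT(4) B _ IFT(9) that]) (use \<Phi>U' U'B in auto)
  have pull: "dirD X F x = dirD X (\<lambda>x. F (\<Phi> (\<Psi> x))) x" if "x \<in> U'" for F :: "real^3 \<Rightarrow> real" and X x
    by (rule dirD_cong[OF IFT(1) that]) (simp add: IFT(7))
  \<comment> \<open>Vanishing derivatives along V and W give a homogeneous 2 by 2 system of
    determinant \<open>m\<close> for the partials in \<open>v\<close> and \<open>w\<close>; hence
    both partials vanish and \<open>F\<close> is constant on slices of constant
    \<open>t\<close>.\<close>
  have leaf_const: "F (\<Phi> (slice s y)) = F (\<Phi> (slice s y'))"
    if F: "smooth_on B F" "\<And>x. x \<in> B \<Longrightarrow> dirD (e 2) F x = 0" "\<And>x. x \<in> B \<Longrightarrow> dirD (e 3) F x = 0"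
      and "s \<in> I" "y \<in> N" "y' \<in> N" for F :: "real^3 \<Rightarrow> real" and s y y'
  proof -
    let ?K = "\<lambda>y. F (\<Phi> y)"
    have K: "pd ?K 2 v = 0" "pd ?K 3 v = 0" if v: "v \<in> V" for v
    proof -
      let ?x = "\<Phi> v"
      have x: "?x \<in> U'" and xB: "?x \<in> B" using \<Phi>U'[OF v] U'B by blast+
      have "dz 2 1 ?x * pd ?K 2 v + dz 2 2 ?x * pd ?K 3 v = 0"
        using chain[OF pull_sm[OF F(1)] x, of "e 2"] pull[OF x, of "e 2" F] F(2)[OF xB] D2t[OF xB]
        by (simp add: IFT(8)[OF v])
      moreover have "dz 3 1 ?x * pd ?K 2 v + dz 3 2 ?x * pd ?K 3 v = 0"
        using chain[OF pull_sm[OF F(1)] x, of "e 3"] pull[OF x, of "e 3" F] F(3)[OF xB] D3t[OF xB]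
        by (simp add: IFT(8)[OF v])
      ultimately have "m ?x * pd ?K 2 v = 0" "m ?x * pd ?K 3 v = 0"
        unfolding m_def by algebra+
      then show "pd ?K 2 v = 0" "pd ?K 3 v = 0" using m_nz[OF x] by simp_all
    qed
    have sm: "smooth_on N (\<lambda>y. ?K (slice s y))"
      by (rule smooth_on_compose[OF IN(3) IFT(4) _ smooth_on_slice pull_sm[OF F(1)]]) (use sl that(4) in auto)
    show ?thesis
    proof (rule pd_zero_constant[OF IN(3,4) sm _ that(5,6)])
      fix y and i :: 2 assume y: "y \<in> N"
      have "?K differentiable (at (slice s y))"
        using smooth_on_differentiable[OF pull_sm[OF F(1)] IFT(4)] sl that(4) y by blast
      from pd_slice[OF this] K[OF sl[OF that(4) y]]
      show "pd (\<lambda>y. ?K (slice s y)) i y = 0" using exhaust_2[of i] by auto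
    qed
  qed
  define q where "q y = z 3 (\<Phi> y)" for y
  have q_sm: "smooth_on V q" unfolding q_def by (rule pull_sm[OF z_sm])
  have qi_sm: "smooth_on V (pd q i)" for i by (rule smooth_on_pd[OF q_sm])
  have q1: "pd q 1 v = g (\<Phi> v)" if v: "v \<in> V" for v
  proof -
    let ?x = "\<Phi> v"
    have x: "?x \<in> U'" and xB: "?x \<in> B" using \<Phi>U'[OF v] U'B by blast+
    have "dirD (e 1) (z 3) ?x = dirD (e 1) t ?x * pd q 1 v"
      using chain[OF q_sm x, of "e 1"] pull[OF x, of "e 1" "z 3"] D1z[OF xB, of 1] D1z[OF xB, of 2]
      by (simp add: IFT(8)[OF v] q_def)
    then show ?thesis using D1z[OF xB, of 3] D1t[OF xB] by simp
  qed
  define f where "f y = q (slice s0 y)" for y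
  have f_sm: "smooth_on N f"
    unfolding f_def by (rule smooth_on_compose[OF IN(3) IFT(4) _ smooth_on_slice q_sm]) (use sl IN(5) in auto)
  \<comment> \<open>Normalised to vanish at \<open>s0\<close>, in accordance with \<open>f\<close>
    being \<open>z 3\<close> on the slice \<open>t = s0\<close>.\<close>
  define k where "k s = q (slice s y0) - q (slice s0 y0)" for s
  have split: "q (slice s y) = f y + k s" if s: "s \<in> I" and y: "y \<in> N" for s y
  proof -
    have "\<exists>C. \<forall>s\<in>I. q (slice s y) - q (slice s y0) = C"
    proof (rule has_derivative_zero_constant)
      show "convex I" using IN(2) is_interval_convex by blast
      fix s assume s: "s \<in> I"
      have "((\<lambda>s. q (slice s y)) has_vector_derivative pd q 1 (slice s y)) (at s)" if "y \<in> N" for y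
        using has_vector_derivative_line[OF smooth_on_differentiable[OF q_sm IFT(4)], of "slice 0 y" s 1]
          sl[OF s that] by (simp flip: slice_line)
      from has_vector_derivative_diff[OF this[OF y] this[OF IN(6)]]
      have "((\<lambda>s. q (slice s y) - q (slice s y0)) has_vector_derivative 0) (at s)"
        using leaf_const[OF g_sm D2g D3g s y IN(6)] by (simp add: q1 sl s y IN(6))
      then show "((\<lambda>s. q (slice s y) - q (slice s y0)) has_derivative (\<lambda>_. 0)) (at s within I)"
        by (simp add: has_vector_derivative_def has_derivative_at_withinI)
    qed
    then have "q (slice s y) - q (slice s y0) = q (slice s0 y) - q (slice s0 y0)"
      using s IN(5) by metis
    then show ?thesis by (simp add: f_def k_def)
  qed
  \<comment> \<open>V and W induce a basis orthonormal for the Hessian. If P has these vectors as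
    columns, the Hessian is the inverse of P P^T; since det P = 1, its entries are those of the
    adjugate.\<close>
  have hess: "pd (pd f 1) 1 y = (dz 2 2 x)\<^sup>2 + (dz 3 2 x)\<^sup>2"
    "pd (pd f 1) 2 y = - (dz 2 1 x * dz 2 2 x + dz 3 1 x * dz 3 2 x)"
    "pd (pd f 2) 1 y = - (dz 2 1 x * dz 2 2 x + dz 3 1 x * dz 3 2 x)"
    "pd (pd f 2) 2 y = (dz 2 1 x)\<^sup>2 + (dz 3 1 x)\<^sup>2" "m x = 1"
    if y: "y \<in> N" and x_def: "x = \<Phi> (slice s0 y)" for x y
  proof -
    have v: "slice s0 y \<in> V" using sl IN(5) y by blast
    have x: "x \<in> U'" and xB: "x \<in> B" and \<Psi>x: "\<Psi> x = slice s0 y"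
      using \<Phi>U'[OF v] U'B IFT(8)[OF v] by (auto simp: x_def)
    have c_eq: "\<Phi> (slice s0 y0) = c" using IFT(7)[OF IFT(2)] by (simp add: \<Psi>c)
    show m1: "m x = 1"
      using leaf_const[OF m_sm Dm(1) Dm(2) IN(5) y IN(6)] by (simp add: x_def c_eq mc)
    have G1: "G x = 1"
      using leaf_const[OF G_sm D2G D3G IN(5) y IN(6)] by (simp add: x_def c_eq Gc)
    have first: "dz j 3 u = dz j 1 u * pd q 2 (\<Psi> u) + dz j 2 u * pd q 3 (\<Psi> u)"
      if "u \<in> U'" "j = 2 \<or> j = 3" for j u
      using chain[OF q_sm that(1), of "e j"] pull[OF that(1), of "e j" "z 3"] that(2) D2t[OF U'B[OF that(1)]] D3t[OF U'B[OF that(1)]]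
      by (auto simp: q_def)
    have dq: "(\<lambda>u. pd q i (\<Psi> u)) differentiable (at x)" for i
      using differentiable_chain_at[OF \<Psi>_dif[OF xB] smooth_on_differentiable[OF qi_sm IFT(4) \<Psi>V[OF x]]]
      by (simp add: o_def)
    have second: "dirD (e i) (dz j 3) x = dirD (e i) (dz j 1) x * pd q 2 (slice s0 y)
        + dz j 1 x * (dz i 1 x * pd (pd q 2) 2 (slice s0 y) + dz i 2 x * pd (pd q 2) 3 (slice s0 y))
        + dirD (e i) (dz j 2) x * pd q 3 (slice s0 y)
        + dz j 2 x * (dz i 1 x * pd (pd q 2) 3 (slice s0 y) + dz i 2 x * pd (pd q 3) 3 (slice s0 y))"
      if i: "i = 2 \<or> i = 3" and j: "j = 2 \<or> j = 3" for i j
    proof -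
      have "dirD (e i) (dz j 3) x = dirD (e i) (\<lambda>u. dz j 1 u * pd q 2 (\<Psi> u) + dz j 2 u * pd q 3 (\<Psi> u)) x"
        by (rule dirD_cong[OF IFT(1) x first[OF _ j]])
      also have "\<dots> = dirD (e i) (dz j 1) x * pd q 2 (\<Psi> x) + dz j 1 x * dirD (e i) (\<lambda>u. pd q 2 (\<Psi> u)) x
          + (dirD (e i) (dz j 2) x * pd q 3 (\<Psi> x) + dz j 2 x * dirD (e i) (\<lambda>u. pd q 3 (\<Psi> u)) x)"
        using dif(2)[OF xB] dq by (simp add: dirD_add dirD_mult)
      finally show ?thesis
        using i D2t[OF xB] D3t[OF xB] pd_commute_real[OF IFT(4) q_sm v, of 3 2]
        by (auto simp: chain[OF qi_sm x] \<Psi>x)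
    qed
    let ?v2 = "dz 2 1 x" and ?w2 = "dz 2 2 x" and ?v3 = "dz 3 1 x" and ?w3 = "dz 3 2 x"
    let ?a = "pd (pd q 2) 2 (slice s0 y)" and ?b = "pd (pd q 2) 3 (slice s0 y)" and ?c = "pd (pd q 3) 3 (slice s0 y)"
    \<comment> \<open>The first order terms cancel, because \<open>z 1\<close>, \<open>z 2\<close>
      and \<open>z 3\<close> obey the same second order equation up to the inhomogeneity
      \<open>G\<close>, which occurs for \<open>z 3\<close> alone.\<close>
    have e22: "?v2 * ?v2 * ?a + 2 * ?v2 * ?w2 * ?b + ?w2 * ?w2 * ?c = 1"
      using second[of 2 2] first[OF x, of 2] first[OF x, of 3]
      by (simp add: D22[OF xB] G1 \<Psi>x algebra_simps)
    have e23: "?v2 * ?v3 * ?a + (?v2 * ?w3 + ?w2 * ?v3) * ?b + ?w2 * ?w3 * ?c = 0"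
      using second[of 2 3] first[OF x, of 2] first[OF x, of 3]
      by (simp add: D23[OF xB] \<Psi>x algebra_simps)
    have e33: "?v3 * ?v3 * ?a + 2 * ?v3 * ?w3 * ?b + ?w3 * ?w3 * ?c = 1"
      using second[of 3 3] first[OF x, of 2] first[OF x, of 3]
      by (simp add: D33[OF xB] G1 \<Psi>x algebra_simps)
    have mm: "?v2 * ?w3 - ?v3 * ?w2 = 1" using m1 by (simp add: m_def)
    have "?a = ?w2 * ?w2 + ?w3 * ?w3" "?b = - (?v2 * ?w2 + ?v3 * ?w3)" "?c = ?v2 * ?v2 + ?v3 * ?v3"
      using e22 e23 e33 mm by algebra+
    moreover have "pd (pd f 1) 1 y = ?a" "pd (pd f 1) 2 y = ?b" "pd (pd f 2) 1 y = ?b" "pd (pd f 2) 2 y = ?c"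
    proof -
      have dqi: "q differentiable (at (slice s0 u))" "pd q i differentiable (at (slice s0 u))" if "u \<in> N" for u i
        using smooth_on_differentiable[OF _ IFT(4)] q_sm qi_sm sl[OF IN(5) that] by blast+
      have f1: "pd f 1 u = pd q 2 (slice s0 u)" and f2: "pd f 2 u = pd q 3 (slice s0 u)" if "u \<in> N" for u
        unfolding f_def by (rule pd_slice[OF dqi(1)[OF that]])+
      have "pd (pd f 1) j y = pd (\<lambda>u. pd q 2 (slice s0 u)) j y" "pd (pd f 2) j y = pd (\<lambda>u. pd q 3 (slice s0 u)) j y" for j
        by (rule pd_cong[OF IN(3) y], rule f1 f2, assumption)+
      then show "pd (pd f 1) 1 y = ?a" "pd (pd f 1) 2 y = ?b" "pd (pd f 2) 1 y = ?b" "pd (pd f 2) 2 y = ?c"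
        by (simp_all add: pd_slice[OF dqi(2)[OF y]] pd_commute_real[OF IFT(4) q_sm v, of 3 2])
    qed
    ultimately show "pd (pd f 1) 1 y = (dz 2 2 x)\<^sup>2 + (dz 3 2 x)\<^sup>2"
      "pd (pd f 1) 2 y = - (dz 2 1 x * dz 2 2 x + dz 3 1 x * dz 3 2 x)"
      "pd (pd f 2) 1 y = - (dz 2 1 x * dz 2 2 x + dz 3 1 x * dz 3 2 x)"
      "pd (pd f 2) 2 y = (dz 2 1 x)\<^sup>2 + (dz 3 1 x)\<^sup>2"
      by (simp_all add: power2_eq_square)
  qed
  have sphere: "pos_def_improper_affine_sphere N (graph_map f) (\<lambda>_. e3)"
  proof (rule graph_improper_affine_sphere[OF IN(3) f_sm])
    fix y assume y: "y \<in> N"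
    let ?x = "\<Phi> (slice s0 y)"
    note hy = hess[OF y refl]
    show "0 < pd (pd f 1) 1 y"
      using hy(5) unfolding hy(1) by (auto simp: m_def sum_power2_gt_zero_iff)
    have "dz 2 1 ?x * dz 3 2 ?x - dz 3 1 ?x * dz 2 2 ?x = 1" using hy(5) by (simp add: m_def)
    then show "pd (pd f 1) 1 y * pd (pd f 2) 2 y - (pd (pd f 1) 2 y)\<^sup>2 = 1"
      unfolding hy by algebra
  qed
  have paraboloid: "on_elliptic_paraboloid (graph_map f ` N)" if b0: "\<And>x. x \<in> B \<Longrightarrow> b x = 0"
  proof -
    have c_eq: "\<Phi> (slice s0 y0) = c" using IFT(7)[OF IFT(2)] by (simp add: \<Psi>c)
    \<comment> \<open>For \<open>b = 0\<close> the pair \<open>dz 2 i\<close>, \<open>dz 3 i\<close>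
      is turned by an infinitesimal rotation, with rate \<open>r2\<close> along V and
      \<open>r3\<close> along W, so the entries of P P^T are constant on the slice. The index 3 is
      excluded because of the inhomogeneity \<open>G\<close>.\<close>
    have quad: "dz 2 i (\<Phi> (slice s0 y)) * dz 2 j (\<Phi> (slice s0 y)) + dz 3 i (\<Phi> (slice s0 y)) * dz 3 j (\<Phi> (slice s0 y))
        = dz 2 i c * dz 2 j c + dz 3 i c * dz 3 j c" if ij: "i \<noteq> 3" "j \<noteq> 3" and y: "y \<in> N" for i j y
    proof -
      let ?F = "\<lambda>x. dz 2 i x * dz 2 j x + dz 3 i x * dz 3 j x"
      have sm: "smooth_on B ?F" by (intro smooth_intros B dz_sm)
      have "dirD (e 2) ?F x = 0" "dirD (e 3) ?F x = 0" if x: "x \<in> B" for x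
        using dif(2)[OF x] ij by (simp_all add: dirD_add dirD_mult D22[OF x] D23[OF x] D32[OF x] D33[OF x] b0[OF x] algebra_simps)
      from leaf_const[OF sm this IN(5) y IN(6)] show ?thesis by (simp add: c_eq)
    qed
    show ?thesis
      by (rule graph_on_elliptic_paraboloid[OF IN(3,4) f_sm])
        (simp_all add: hess[OF _ refl] quad power2_eq_square frame_c)
  qed
  define U0 where "U0 = \<Phi> ` prod_dom I N"
  have oD: "open (prod_dom I N)" by (rule open_prod_dom[OF IN(1,3)])
  have "open (U' \<inter> \<Psi> -` prod_dom I N)"
    by (rule continuous_open_preimage[OF _ IFT(1) oD])
      (use smooth_on_continuous_on[OF \<Psi>_sm] U'B in \<open>auto intro: continuous_on_subset\<close>)
  moreover have "U' \<inter> \<Psi> -` prod_dom I N = U0"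
  proof -
    have "\<Phi> y \<in> U' \<and> \<Psi> (\<Phi> y) = y" if "y \<in> prod_dom I N" for y
      using that IN(7) \<Phi>U' IFT(8) by blast
    then show ?thesis
      unfolding U0_def using IFT(7) by (auto simp: image_iff) metis
  qed
  ultimately have U0: "open U0" "U0 \<subseteq> U'" by auto
  show ?thesis
  proof (rule that[of U0 I N f k \<Phi>])
    show "c \<in> U0"
      unfolding U0_def using IFT(7)[OF IFT(2)] IN(5,6) by (metis \<Psi>c image_eqI slice_in_prod_dom)
    show "U0 \<subseteq> B" using U0(2) U'B by blast
    then show "smooth_on U0 \<Psi>" by (rule smooth_on_subset[OF \<Psi>_sm])
    show "smooth_on (prod_dom I N) \<Phi>" by (rule smooth_on_subset[OF IFT(9) IN(7)])
    show "\<Psi> (\<Phi> y) = y" if "y \<in> prod_dom I N" for y using that IN(7) IFT(8) by blast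
    show "\<Phi> (\<Psi> x) = x" if "x \<in> U0" for x using that U0(2) IFT(7) by blast
    show "z 3 (\<Phi> (slice s y)) = f y + k s" if "s \<in> I" "y \<in> N" for s y
      using split[OF that] by (simp add: q_def)
    \<comment> \<open>The second component is \<open>s * k s\<close> because the third affine
      coordinate is \<open>t\<close> times \<open>z 3\<close>. The curve is the restriction of a
      smooth map on \<open>V\<close> to the line through \<open>y0\<close>.\<close>
    show "smooth_curve_on I (\<lambda>s. (\<chi> i. if i = 1 then s else s * k s) :: real^2)"
    proof -
      let ?F = "\<lambda>x. (\<chi> i. if i = 1 then x $ 1 else x $ 1 * (q x - q (slice s0 y0))) :: real^2"
      have sm: "smooth_on V ?F"
      proof (rule smooth_on_vec[OF IFT(4)])
        fix i :: 2
        show "smooth_on V (\<lambda>x. ?F x $ i)"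
          by (cases "i = 1")
            (auto intro!: smooth_on_mult smooth_on_diff smooth_on_const smooth_on_nth[OF IFT(4) smooth_on_ident] IFT(4) q_sm)
      qed
      have "smooth_curve_on I (\<lambda>s. ?F (slice 0 y0 + s *\<^sub>R axis 1 1))"
        by (rule smooth_curve_on_line[OF IN(1) IFT(4) sm]) (use sl IN(6) in \<open>simp flip: slice_line\<close>)
      then show ?thesis
        unfolding slice_line[symmetric] slice_nth k_def[symmetric] .
    qed
  qed (use U0 IN f_sm sphere paraboloid U0_def in auto)
qed

end

section \<open>The local model\<close>

context symmetric_hypersphere
begin

theorem local_model:
  assumes c: "c \<in> U" and "H \<noteq> 0"
  shows "\<exists>U0 I N f \<gamma> \<Phi> \<Psi> (A :: real^4^4) v.
           open U0 \<and> c \<in> U0 \<and> U0 \<subseteq> U \<and>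
           open I \<and> is_interval I \<and> open N \<and>
           smooth_on N f \<and> smooth_curve_on I \<gamma> \<and>
           pos_def_improper_affine_sphere N (graph_map f) (\<lambda>_. e3) \<and>
           smooth_on (prod_dom I N) \<Phi> \<and> smooth_on U0 \<Psi> \<and>
           \<Phi> ` prod_dom I N = U0 \<and>
           (\<forall>y\<in>prod_dom I N. \<Psi> (\<Phi> y) = y) \<and> (\<forall>x\<in>U0. \<Phi> (\<Psi> x) = x) \<and>
           invertible A \<and>
           (\<forall>y\<in>prod_dom I N. A *v \<phi> (\<Phi> y) + v = model_map \<gamma> f y) \<and>
           ((\<forall>x\<in>U. b x = 0) \<longrightarrow> on_elliptic_paraboloid (graph_map f ` N))"
proof (rule affine_normal_form[OF assms])
  fix A :: "real^4^4" and v d y g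
  assume nf: "0 < d" "ball c d \<subseteq> U" "invertible A"
    "y = (\<lambda>x. A *v \<phi> x + v)" "smooth_on (ball c d) y" "smooth_on (ball c d) g"
    "\<And>x. x \<in> ball c d \<Longrightarrow> 0 < y x $ 4"
    "\<And>x. x \<in> ball c d \<Longrightarrow> dirD (e 1) y x = g x *\<^sub>R axis 3 1 + (p 2 x + a x) *\<^sub>R y x"
    "\<And>x. x \<in> ball c d \<Longrightarrow> dirD (e 2) y x $ 4 = 0" "\<And>x. x \<in> ball c d \<Longrightarrow> dirD (e 3) y x $ 4 = 0"
    "\<And>x. x \<in> ball c d \<Longrightarrow> dirD (e 2) g x = 0" "\<And>x. x \<in> ball c d \<Longrightarrow> dirD (e 3) g x = 0"
    "\<And>x. x \<in> ball c d \<Longrightarrow> dirD (e 2) (dirD (e 2) y) x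
      = (p 2 x - a x) *\<^sub>R dirD (e 1) y x + b x *\<^sub>R dirD (e 2) y x + r 2 x *\<^sub>R dirD (e 3) y x - H *\<^sub>R y x"
    "\<And>x. x \<in> ball c d \<Longrightarrow> dirD (e 2) (dirD (e 3) y) x = (- r 2 x) *\<^sub>R dirD (e 2) y x - b x *\<^sub>R dirD (e 3) y x"
    "\<And>x. x \<in> ball c d \<Longrightarrow> dirD (e 3) (dirD (e 2) y) x = (r 3 x - b x) *\<^sub>R dirD (e 3) y x"
    "\<And>x. x \<in> ball c d \<Longrightarrow> dirD (e 3) (dirD (e 3) y) x
      = (p 2 x - a x) *\<^sub>R dirD (e 1) y x - (r 3 x + b x) *\<^sub>R dirD (e 2) y x - H *\<^sub>R y x"
    "y c = axis 4 1" "dirD (e 2) y c = axis 1 1" "dirD (e 3) y c = axis 2 1" "(p 2 c - a c) * g c = 1"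
  let ?B = "ball c d"
  note oB = open_ball[of c d]
  have BU: "x \<in> U" if "x \<in> ?B" for x using that nf(2) by blast
  \<comment> \<open>Embeds the indices 1, 2, 3 into the index type of the ambient 4-space.\<close>
  define \<kappa> :: "3 \<Rightarrow> 4" where "\<kappa> i = (if i = 1 then 1 else if i = 2 then 2 else 3)" for i
  define t where "t x = y x $ 4" for x
  define z where "z i x = y x $ \<kappa> i / t x" for i x
  define G where "G x = (p 2 x - a x) * g x / t x" for x
  \<comment> \<open>The derivative of \<open>z 3\<close> with respect to \<open>t\<close>: along T,
    \<open>z 3\<close> changes at rate \<open>g / t\<close> and \<open>t\<close> at rate
    \<open>(p 2 + a) * t\<close>.\<close>
  define gg where "gg x = g x / ((p 2 x + a x) * (t x * t x))" for x
  have sm: "smooth_on ?B f" if "smooth_on U f" for f :: "real^3 \<Rightarrow> 'z::real_normed_vector"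
    by (rule smooth_on_subset[OF that nf(2)])
  have t_sm: "smooth_on ?B t" unfolding t_def by (rule smooth_on_nth[OF oB nf(5)])
  have t_pos: "0 < t x" if "x \<in> ?B" for x using nf(7)[OF that] by (simp add: t_def)
  have t_nz: "t x \<noteq> 0" if "x \<in> ?B" for x using t_pos[OF that] by simp
  have \<alpha>_nz: "p 2 x + a x \<noteq> 0" if "x \<in> ?B" for x using H_factor[OF BU[OF that]] \<open>H \<noteq> 0\<close> by auto
  note dif = smooth_on_differentiable[OF _ oB]
  have y_dif: "y differentiable (at x)" "g differentiable (at x)" "t differentiable (at x)"
    "dirD (e j) y differentiable (at x)" "(\<lambda>x. y x $ i) differentiable (at x)"
    "(\<lambda>x. dirD (e j) y x $ i) differentiable (at x)" if "x \<in> ?B" for x i j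
    using dif[OF _ that] nf(5,6) t_sm smooth_on_dirD[OF oB sm[OF e_smooth] nf(5)]
      smooth_on_nth[OF oB nf(5)] smooth_on_nth[OF oB smooth_on_dirD[OF oB sm[OF e_smooth] nf(5)]]
    by blast+
  have dt: "dirD (e 1) t x = (p 2 x + a x) * t x" "dirD (e 2) t x = 0" "dirD (e 3) t x = 0" if x: "x \<in> ?B" for x
    unfolding t_def using dirD_nth[OF y_dif(1)[OF x], of _ 4] nf(8-10)[OF x] by (simp_all add: axis_def)
  have \<kappa>3: "axis 3 1 $ \<kappa> i = (if i = 3 then 1 else 0 :: real)" for i
    using exhaust_3[of i] by (auto simp: \<kappa>_def axis_def)
  have dz: "dirD X (z i) x = (dirD X y x $ \<kappa> i * t x - y x $ \<kappa> i * dirD X t x) / (t x)\<^sup>2" if x: "x \<in> ?B" for X i x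
    unfolding z_def using y_dif[OF x] t_nz[OF x] by (simp add: dirD_divide dirD_nth)
  have dz': "dirD (e j) (z i) x = dirD (e j) y x $ \<kappa> i / t x" if x: "x \<in> ?B" and j: "j = 2 \<or> j = 3" for j i x
    using dz[OF x, of "e j" i] dt(2,3)[OF x] j t_nz[OF x] by (auto simp: power2_eq_square)
  have ddz: "dirD (e k) (dirD (e j) (z i)) x = dirD (e k) (dirD (e j) y) x $ \<kappa> i / t x"
    if x: "x \<in> ?B" and j: "j = 2 \<or> j = 3" and k: "k = 2 \<or> k = 3" for j i k x
  proof -
    have "dirD (e k) (dirD (e j) (z i)) x = dirD (e k) (\<lambda>x. dirD (e j) y x $ \<kappa> i / t x) x"
      by (rule dirD_cong[OF oB x dz'[OF _ j]])
    also have "\<dots> = (dirD (e k) (dirD (e j) y) x $ \<kappa> i * t x - dirD (e j) y x $ \<kappa> i * dirD (e k) t x) / (t x)\<^sup>2"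
      using y_dif[OF x] t_nz[OF x] by (simp add: dirD_divide dirD_nth)
    finally show ?thesis using dt(2,3)[OF x] k t_nz[OF x] by (auto simp: power2_eq_square)
  qed
  interpret gf: graph_frame ?B e c t z gg G b "r 2" "r 3"
  proof unfold_locales
    show "open ?B" "c \<in> ?B" using nf(1) by auto
    show "smooth_on ?B (e i)" for i by (rule sm[OF e_smooth])
    show "smooth_on ?B t" by fact
    show "smooth_on ?B (z i)" for i
      unfolding z_def using t_nz by (intro smooth_on_divide smooth_on_nth oB nf(5) t_sm) auto
    show "smooth_on ?B gg"
      unfolding gg_def using t_nz \<alpha>_nz
      by (intro smooth_on_divide smooth_on_mult smooth_on_add oB nf(6) t_sm sm p_smooth a_smooth) auto
    show "smooth_on ?B G"
      unfolding G_def using t_nz by (intro smooth_on_divide smooth_on_mult smooth_on_diff oB nf(6) t_sm sm p_smooth a_smooth) auto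
    show "G c = 1" by (simp add: G_def nf(17,20) t_def)
    have c: "c \<in> ?B" using nf(1) by simp
    show "dirD (e 2) (z 1) c = 1" "dirD (e 3) (z 1) c = 0" "dirD (e 2) (z 2) c = 0" "dirD (e 3) (z 2) c = 1"
      by (simp_all add: dz'[OF c] t_def nf(17-19) \<kappa>_def axis_def)
    fix x assume x: "x \<in> ?B"
    note xU = BU[OF x]
    show "dirD (e 1) t x \<noteq> 0" "dirD (e 2) t x = 0" "dirD (e 3) t x = 0"
      using \<alpha>_nz[OF x] t_nz[OF x] by (simp_all add: dt[OF x])
    show "dirD (e 1) (z i) x = (if i = 3 then gg x * dirD (e 1) t x else 0)" for i
    proof -
      have "dirD (e 1) (z i) x = (if i = 3 then g x else 0) / t x"
        using t_nz[OF x] by (simp add: dz[OF x] dt[OF x] nf(8)[OF x] \<kappa>3 power2_eq_square field_simps)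
      then show ?thesis
        using t_nz[OF x] \<alpha>_nz[OF x] by (simp add: dt[OF x] gg_def)
    qed
    have D: "dirD (e j) (p 2) x = 0" "dirD (e j) a x = 0" "dirD (e j) g x = 0" "dirD (e j) t x = 0"
      if "j = 2 \<or> j = 3" for j
      using that dirD_p2[OF xU] dirD_a[OF xU] nf(11,12)[OF x] dt[OF x] by auto
    have gg: "dirD (e j) gg x = 0" and G: "dirD (e j) G x = 0" if "j = 2 \<or> j = 3" for j
      unfolding gg_def G_def using D[OF that] y_dif[OF x] differentiable_at[OF xU] t_nz[OF x] \<alpha>_nz[OF x]
      by (simp_all add: dirD_divide dirD_mult dirD_add dirD_diff)
    show "dirD (e 2) gg x = 0" "dirD (e 3) gg x = 0" "dirD (e 2) G x = 0" "dirD (e 3) G x = 0"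
      using gg G by auto
    \<comment> \<open>The factorisation of \<open>H\<close> reduces
      \<open>(p 2 x - a x) *\<^sub>R dirD (e 1) y x - H *\<^sub>R y x\<close> to a multiple of the
      third basis vector; hence the inhomogeneity \<open>G\<close> appears only for
      \<open>i = 3\<close>.\<close>
    fix i
    note R = dz'[OF x] ddz[OF x] nf(8,13-16)[OF x] \<kappa>3 H_factor[OF xU] G_def
    show "dirD (e 2) (dirD (e 2) (z i)) x
        = b x * dirD (e 2) (z i) x + r 2 x * dirD (e 3) (z i) x + (if i = 3 then G x else 0)"
      "dirD (e 2) (dirD (e 3) (z i)) x = - r 2 x * dirD (e 2) (z i) x - b x * dirD (e 3) (z i) x"
      "dirD (e 3) (dirD (e 2) (z i)) x = (r 3 x - b x) * dirD (e 3) (z i) x"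
      "dirD (e 3) (dirD (e 3) (z i)) x = - (r 3 x + b x) * dirD (e 2) (z i) x + (if i = 3 then G x else 0)"
      using t_nz[OF x] by (simp_all add: R field_simps)
  qed
  show ?thesis
  proof (rule gf.graph_normal_form)
    fix U0 I N f \<Phi> k
    assume gn: "open U0" "c \<in> U0" "U0 \<subseteq> ?B" "open I" "is_interval I" "open N"
      "smooth_on N f" "smooth_curve_on I (\<lambda>s. (\<chi> i. if i = 1 then s else s * k s) :: real^2)"
      "pos_def_improper_affine_sphere N (graph_map f) (\<lambda>_. e3)"
      "smooth_on (prod_dom I N) \<Phi>" "smooth_on U0 gf.\<Psi>" "\<Phi> ` prod_dom I N = U0"
      "\<And>y. y \<in> prod_dom I N \<Longrightarrow> gf.\<Psi> (\<Phi> y) = y" "\<And>x. x \<in> U0 \<Longrightarrow> \<Phi> (gf.\<Psi> x) = x"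
      "\<And>s y. s \<in> I \<Longrightarrow> y \<in> N \<Longrightarrow> z 3 (\<Phi> (slice s y)) = f y + k s"
      "(\<And>x. x \<in> ?B \<Longrightarrow> b x = 0) \<Longrightarrow> on_elliptic_paraboloid (graph_map f ` N)"
    let ?\<gamma> = "\<lambda>s. (\<chi> i. if i = 1 then s else s * k s) :: real^2"
    have model: "A *v \<phi> (\<Phi> w) + v = model_map ?\<gamma> f w" if w: "w \<in> prod_dom I N" for w
    proof -
      obtain s u where su: "w = slice s u" "s \<in> I" "u \<in> N" using prod_dom_slice[OF w] .
      let ?x = "\<Phi> w"
      have x: "?x \<in> ?B" using gn(3,12) w by blast
      have "gf.\<Psi> ?x = slice s u" using gn(13)[OF w] su(1) by simp
      then have "t ?x = s" "z 1 ?x = u $ 1" "z 2 ?x = u $ 2"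
        using gf.\<Psi>_nth[of ?x] by simp_all
      moreover have "z 3 ?x = f u + k s" using gn(15)[OF su(2,3)] su(1) by simp
      ultimately have "y ?x $ 1 = s * u $ 1" "y ?x $ 2 = s * u $ 2" "y ?x $ 3 = s * f u + s * k s" "y ?x $ 4 = s"
        using t_nz[OF x] by (auto simp: z_def \<kappa>_def t_def field_simps)
      moreover have "(\<chi> i. if i = 1 then u $ 1 else u $ 2) = u" by (simp add: vec_eq_iff forall_2)
      ultimately have "y ?x = model_map ?\<gamma> f w"
        by (simp add: vec_eq_iff forall_4 model_map_def Let_def su(1))
      then show ?thesis by (simp add: nf(4))
    qed
    show ?thesis
      by (rule exI[of _ U0], rule exI[of _ I], rule exI[of _ N], rule exI[of _ f], rule exI[of _ ?\<gamma>],
          rule exI[of _ \<Phi>], rule exI[of _ gf.\<Psi>], rule exI[of _ A], rule exI[of _ v])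
        (use gn nf(2,3) model BU in auto)
  qed
qed

end

section \<open>The classification near each point of a chart\<close>

theorem theorem7p17:
  fixes U :: "(real^3) set"
    and \<phi> \<xi> :: "real^3 \<Rightarrow> real^4"
    and h :: "real^3 \<Rightarrow> real^3^3"
    and \<Gamma> :: "real^3 \<Rightarrow> 3 \<Rightarrow> 3 \<Rightarrow> real^3"
    and H :: real
    and T V W :: "real^3 \<Rightarrow> real^3"
    and a4 a6 :: "real^3 \<Rightarrow> real"
  assumes chart: "open U" "connected U" "U \<noteq> {}"
    and blaschke: "blaschke3 U \<phi> \<xi> h \<Gamma>"
    and hypersphere: "\<forall>x\<in>U. \<forall>i. pd \<xi> i x = - H *\<^sub>R pd \<phi> i x"
    and proper: "H \<noteq> 0"
    and symmetry: "(\<forall>x\<in>U. sym_group h \<Gamma> x \<cong> Z3_group) \<or> (\<forall>x\<in>U. sym_group h \<Gamma> x \<cong> SO2_group)"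
    and frame_smooth: "smooth_on U T" "smooth_on U V" "smooth_on U W"
    and frame_on: "\<forall>x\<in>U. hmet h x (T x) (T x) = -1 \<and> hmet h x (V x) (V x) = 1 \<and> hmet h x (W x) (W x) = 1
        \<and> hmet h x (T x) (V x) = 0 \<and> hmet h x (T x) (W x) = 0 \<and> hmet h x (V x) (W x) = 0"
    and K_form: "\<forall>x\<in>U.
           Kbil h \<Gamma> x (T x) (T x) = (-2 * a4 x) *\<^sub>R T x
         \<and> Kbil h \<Gamma> x (T x) (V x) = a4 x *\<^sub>R V x
         \<and> Kbil h \<Gamma> x (T x) (W x) = a4 x *\<^sub>R W x
         \<and> Kbil h \<Gamma> x (V x) (V x) = (- a4 x) *\<^sub>R T x + a6 x *\<^sub>R V x
         \<and> Kbil h \<Gamma> x (V x) (W x) = (- a6 x) *\<^sub>R W x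
         \<and> Kbil h \<Gamma> x (W x) (W x) = (- a4 x) *\<^sub>R T x - a6 x *\<^sub>R V x"
    and a_signs: "\<forall>x\<in>U. a4 x > 0 \<and> a6 x \<ge> 0"
    and a6_case: "(\<forall>x\<in>U. sym_group h \<Gamma> x \<cong> Z3_group) \<longrightarrow> (\<forall>x\<in>U. a6 x > 0)"
                 "(\<forall>x\<in>U. sym_group h \<Gamma> x \<cong> SO2_group) \<longrightarrow> (\<forall>x\<in>U. a6 x = 0)"
    and H_eq: "\<forall>x\<in>U. H = (hmet h x (lc_cov h V T x) (V x))\<^sup>2 - (a4 x)\<^sup>2"
  shows "\<forall>p\<in>U. \<exists>U0 I N f \<gamma> \<Phi> \<Psi> (A :: real^4^4) b.
           open U0 \<and> p \<in> U0 \<and> U0 \<subseteq> U \<and>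
           open I \<and> is_interval I \<and> open N \<and>
           smooth_on N f \<and> smooth_curve_on I \<gamma> \<and>
           pos_def_improper_affine_sphere N (graph_map f) (\<lambda>_. e3) \<and>
           smooth_on (prod_dom I N) \<Phi> \<and> smooth_on U0 \<Psi> \<and>
           \<Phi> ` prod_dom I N = U0 \<and>
           (\<forall>y\<in>prod_dom I N. \<Psi> (\<Phi> y) = y) \<and> (\<forall>x\<in>U0. \<Phi> (\<Psi> x) = x) \<and>
           invertible A \<and>
           (\<forall>y\<in>prod_dom I N. A *v \<phi> (\<Phi> y) + b = model_map \<gamma> f y) \<and>
           ((\<forall>x\<in>U. sym_group h \<Gamma> x \<cong> SO2_group) \<longrightarrow> on_elliptic_paraboloid (graph_map f ` N))"
proof
  fix p0 assume p0: "p0 \<in> U"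
  \<comment> \<open>The named frame is indexed so that the structure equations become sums; T takes
    index 1, where the sign is -1.\<close>
  define e where "e = (\<lambda>i :: 3. if i = 1 then T else if i = 2 then V else W)"
  define s where "s = (\<lambda>i :: 3. if i = 1 then -1 else 1 :: real)"
  interpret equiaffine U \<phi> \<xi> h \<Gamma>
    by unfold_locales (rule blaschke)
  interpret orthonormal_frame U \<phi> \<xi> h \<Gamma> e s H
  proof unfold_locales
    show "smooth_on U (e i)" for i using frame_smooth by (simp add: e_def)
    show "s i = 1 \<or> s i = -1" for i by (simp add: s_def)
    show "pd \<xi> i x = - H *\<^sub>R pd \<phi> i x" if "x \<in> U" for x i using hypersphere that by blast
    show "hmet h x (e i x) (e j x) = (if i = j then s i else 0)" if x: "x \<in> U" for x i j
      using frame_on[rule_format, OF x] hmet_sym[OF x, of "V x" "T x"] hmet_sym[OF x, of "W x" "T x"]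
        hmet_sym[OF x, of "W x" "V x"] exhaust_3[of i] exhaust_3[of j]
      by (auto simp: e_def s_def)
  qed
  have frame: "e 1 = T" "e 2 = V" "e 3 = W" "s 1 = -1" "s 2 = 1" "s 3 = 1"
    by (simp_all add: e_def s_def)
  interpret symmetric_hypersphere U \<phi> \<xi> h \<Gamma> e s H a4 a6
    using K_form a_signs H_eq by unfold_locales (auto simp: frame L_def)
  have "\<forall>x\<in>U. a6 x = 0" if "\<forall>x\<in>U. sym_group h \<Gamma> x \<cong> SO2_group"
    using a6_case(2) that by blast
  then show "\<exists>U0 I N f \<gamma> \<Phi> \<Psi> (A :: real^4^4) b.
           open U0 \<and> p0 \<in> U0 \<and> U0 \<subseteq> U \<and>
           open I \<and> is_interval I \<and> open N \<and>
           smooth_on N f \<and> smooth_curve_on I \<gamma> \<and>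
           pos_def_improper_affine_sphere N (graph_map f) (\<lambda>_. e3) \<and>
           smooth_on (prod_dom I N) \<Phi> \<and> smooth_on U0 \<Psi> \<and>
           \<Phi> ` prod_dom I N = U0 \<and>
           (\<forall>y\<in>prod_dom I N. \<Psi> (\<Phi> y) = y) \<and> (\<forall>x\<in>U0. \<Phi> (\<Psi> x) = x) \<and>
           invertible A \<and>
           (\<forall>y\<in>prod_dom I N. A *v \<phi> (\<Phi> y) + b = model_map \<gamma> f y) \<and>
           ((\<forall>x\<in>U. sym_group h \<Gamma> x \<cong> SO2_group) \<longrightarrow> on_elliptic_paraboloid (graph_map f ` N))"
    using local_model[OF p0 proper] by blast
qed

end
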